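(* Let $R$ be a field with algebraic closure $\overline{R}$ and let $c\in M_n(R)$. Assume that $c$ is similar in $M_n(\overline{R})$ to $\bigoplus_i J_{n_i}(\lambda_i)$ with $\lambda_i\in\overline{R}$. Then: (i) $S_n(c,R)$ is a Frobenius $R$-algebra if and only if $n_i=n_j$ whenever $\lambda_i=\lambda_j$. (ii) $S_n(c,R)$ is a separable Frobenius $R$-algebra if and only if $n_i=1$ for every $i$.
   Context: $M_n(R)$ is the ring of $n\times n$ matrices over $R$, and $S_n(c,R)=\{a\in M_n(R)\mid ac=ca\}$ is the centralizer algebra of $c$. $J_m(\lambda)$ denotes the $m\times m$ Jordan block with all diagonal entries $\lambda$, ones on the superdiagonal and zeros elsewhere; $\bigoplus_i$ denotes the block diagonal direct sum of matrices. An extension of unital associative algebras $A/B$ (a unital ring homomorphism $B\to A$) is a Frobenius extension if $A$ is finitely generated projective as a right $B$-module and $A\cong \mathrm{Hom}(A_B,B_B)$ as $B$-$A$-bimodules. It is separable if the multiplication map $A\otimes_B A\to A$ is a split epimorphism of $A$-$A$-bimodules. A separable Frobenius extension is a Frobenius extension that is separable. For a field $R$, an $R$-algebra $A$ is called a (separable) Frobenius $R$-algebra if $A/R$ is a (separable) Frobenius extension. *)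

theory Defs
  imports
    "HOL-Algebra.Algebra"
    "HOL-Algebra.Algebraic_Closure_Type"
    "Jordan_Normal_Form.Jordan_Normal_Form"
begin

section \<open>Bimodules over rings that need not be commutative\<close>

text \<open>The underlying abelian group of a bimodule is its monoid part, which is written
  multiplicatively as in the group theory library: \<^term>\<open>monoid.mult M\<close> is the addition of the
  bimodule \<^term>\<open>M\<close>, and \<^term>\<open>monoid.one M\<close> its zero.\<close>

record ('l, 'r, 'm) bimod = "'m monoid" +
  lact :: "'l \<Rightarrow> 'm \<Rightarrow> 'm"
  ract :: "'m \<Rightarrow> 'r \<Rightarrow> 'm"

locale bimodule = L: ring L + R: ring R + M: comm_group M
  for L :: "('l, 'x) ring_scheme" and R :: "('r, 'y) ring_scheme"
    and M :: "('l, 'r, 'm, 'z) bimod_scheme" +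
  assumes lact_closed: "l \<in> carrier L \<Longrightarrow> m \<in> carrier M \<Longrightarrow> lact M l m \<in> carrier M"
    and ract_closed: "r \<in> carrier R \<Longrightarrow> m \<in> carrier M \<Longrightarrow> ract M m r \<in> carrier M"
    and lact_add: "l \<in> carrier L \<Longrightarrow> m \<in> carrier M \<Longrightarrow> m' \<in> carrier M \<Longrightarrow>
      lact M l (m \<otimes>\<^bsub>M\<^esub> m') = lact M l m \<otimes>\<^bsub>M\<^esub> lact M l m'"
    and ract_add: "r \<in> carrier R \<Longrightarrow> m \<in> carrier M \<Longrightarrow> m' \<in> carrier M \<Longrightarrow>
      ract M (m \<otimes>\<^bsub>M\<^esub> m') r = ract M m r \<otimes>\<^bsub>M\<^esub> ract M m' r"
    and add_lact: "l \<in> carrier L \<Longrightarrow> l' \<in> carrier L \<Longrightarrow> m \<in> carrier M \<Longrightarrow>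
      lact M (l \<oplus>\<^bsub>L\<^esub> l') m = lact M l m \<otimes>\<^bsub>M\<^esub> lact M l' m"
    and add_ract: "r \<in> carrier R \<Longrightarrow> r' \<in> carrier R \<Longrightarrow> m \<in> carrier M \<Longrightarrow>
      ract M m (r \<oplus>\<^bsub>R\<^esub> r') = ract M m r \<otimes>\<^bsub>M\<^esub> ract M m r'"
    and mult_lact: "l \<in> carrier L \<Longrightarrow> l' \<in> carrier L \<Longrightarrow> m \<in> carrier M \<Longrightarrow>
      lact M (l \<otimes>\<^bsub>L\<^esub> l') m = lact M l (lact M l' m)"
    and mult_ract: "r \<in> carrier R \<Longrightarrow> r' \<in> carrier R \<Longrightarrow> m \<in> carrier M \<Longrightarrow>
      ract M m (r \<otimes>\<^bsub>R\<^esub> r') = ract M (ract M m r) r'"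
    and one_lact: "m \<in> carrier M \<Longrightarrow> lact M \<one>\<^bsub>L\<^esub> m = m"
    and one_ract: "m \<in> carrier M \<Longrightarrow> ract M m \<one>\<^bsub>R\<^esub> = m"
    and lact_ract: "l \<in> carrier L \<Longrightarrow> r \<in> carrier R \<Longrightarrow> m \<in> carrier M \<Longrightarrow>
      ract M (lact M l m) r = lact M l (ract M m r)"

definition left_linear ::
    "('l, 'x) ring_scheme \<Rightarrow> ('l, 'r, 'm, 'y) bimod_scheme \<Rightarrow> ('l, 's, 'n, 'z) bimod_scheme
      \<Rightarrow> ('m \<Rightarrow> 'n) set" where
  "left_linear L M N =
    {h \<in> hom M N. \<forall>l\<in>carrier L. \<forall>m\<in>carrier M. h (lact M l m) = lact N l (h m)}"

definition right_linear ::
    "('r, 'x) ring_scheme \<Rightarrow> ('l, 'r, 'm, 'y) bimod_scheme \<Rightarrow> ('k, 'r, 'n, 'z) bimod_scheme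
      \<Rightarrow> ('m \<Rightarrow> 'n) set" where
  "right_linear R M N =
    {h \<in> hom M N. \<forall>r\<in>carrier R. \<forall>m\<in>carrier M. h (ract M m r) = ract N (h m) r}"

definition bimod_hom ::
    "('l, 'w) ring_scheme \<Rightarrow> ('r, 'x) ring_scheme \<Rightarrow> ('l, 'r, 'm, 'y) bimod_scheme
      \<Rightarrow> ('l, 'r, 'n, 'z) bimod_scheme \<Rightarrow> ('m \<Rightarrow> 'n) set" where
  "bimod_hom L R M N = left_linear L M N \<inter> right_linear R M N"

definition bimod_isomorphic ::
    "('l, 'w) ring_scheme \<Rightarrow> ('r, 'x) ring_scheme \<Rightarrow> ('l, 'r, 'm, 'y) bimod_scheme
      \<Rightarrow> ('l, 'r, 'n, 'z) bimod_scheme \<Rightarrow> bool" where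
  "bimod_isomorphic L R M N \<longleftrightarrow>
    (\<exists>h\<in>bimod_hom L R M N. bij_betw h (carrier M) (carrier N))"

text \<open>The ring \<open>A\<close> as a bimodule, with scalars acting on the left through \<open>f\<close> and on the
  right through \<open>g\<close>.\<close>

definition ring_bimod ::
    "('l \<Rightarrow> 'a) \<Rightarrow> ('a, 'x) ring_scheme \<Rightarrow> ('r \<Rightarrow> 'a) \<Rightarrow> ('l, 'r, 'a) bimod" where
  "ring_bimod f A g =
    \<lparr>carrier = carrier A, monoid.mult = add A, one = \<zero>\<^bsub>A\<^esub>,
     lact = (\<lambda>l x. f l \<otimes>\<^bsub>A\<^esub> x), ract = (\<lambda>x r. x \<otimes>\<^bsub>A\<^esub> g r)\<rparr>"

definition free_bimod :: "('b, 'x) ring_scheme \<Rightarrow> nat \<Rightarrow> ('b, 'b, nat \<Rightarrow> 'b) bimod" where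
  "free_bimod B k =
    \<lparr>carrier = {..<k} \<rightarrow>\<^sub>E carrier B,
     monoid.mult = (\<lambda>u v. \<lambda>i\<in>{..<k}. u i \<oplus>\<^bsub>B\<^esub> v i),
     one = (\<lambda>i\<in>{..<k}. \<zero>\<^bsub>B\<^esub>),
     lact = (\<lambda>b u. \<lambda>i\<in>{..<k}. b \<otimes>\<^bsub>B\<^esub> u i),
     ract = (\<lambda>u b. \<lambda>i\<in>{..<k}. u i \<otimes>\<^bsub>B\<^esub> b)\<rparr>"

text \<open>A right module is finitely generated projective if it is (isomorphic to) a direct summand
  of a free right module of finite rank.\<close>

definition fg_projective_right ::
    "('b, 'x) ring_scheme \<Rightarrow> ('l, 'b, 'm, 'y) bimod_scheme \<Rightarrow> bool" where
  "fg_projective_right B M \<longleftrightarrow>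
    (\<exists>k. \<exists>\<iota>\<in>right_linear B M (free_bimod B k). \<exists>\<pi>\<in>right_linear B (free_bimod B k) M.
       \<forall>m\<in>carrier M. \<pi> (\<iota> m) = m)"

text \<open>For an \<open>S\<close>-\<open>B\<close>-bimodule \<open>M\<close> and a \<open>T\<close>-\<open>B\<close>-bimodule \<open>N\<close>, the right \<open>B\<close>-linear maps
  from \<open>M\<close> to \<open>N\<close> form a \<open>T\<close>-\<open>S\<close>-bimodule.\<close>

definition right_hom_bimod ::
    "('b, 'x) ring_scheme \<Rightarrow> ('s, 'b, 'm, 'y) bimod_scheme \<Rightarrow> ('t, 'b, 'n, 'z) bimod_scheme
      \<Rightarrow> ('t, 's, 'm \<Rightarrow> 'n) bimod" where
  "right_hom_bimod B M N =
    \<lparr>carrier = right_linear B M N \<inter> extensional (carrier M),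
     monoid.mult = (\<lambda>\<phi> \<psi>. \<lambda>m\<in>carrier M. \<phi> m \<otimes>\<^bsub>N\<^esub> \<psi> m),
     one = (\<lambda>m\<in>carrier M. \<one>\<^bsub>N\<^esub>),
     lact = (\<lambda>t \<phi>. \<lambda>m\<in>carrier M. lact N t (\<phi> m)),
     ract = (\<lambda>\<phi> s. \<lambda>m\<in>carrier M. \<phi> (lact M s m))\<rparr>"

lemma comm_group_cong:
  assumes "comm_group G" "carrier H = carrier G" "monoid.mult H = monoid.mult G"
    "monoid.one H = monoid.one G"
  shows "comm_group H"
proof -
  interpret G: comm_group G by fact
  show ?thesis
    by (rule comm_groupI) (auto simp: assms(2-4) G.m_assoc intro: G.m_comm G.l_inv_ex)
qed

lemma bimodule_ring_bimod:
  assumes "ring_hom_ring L A f" "ring_hom_ring R A g"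
  shows "bimodule L R (ring_bimod f A g)"
proof -
  interpret f: ring_hom_ring L A f by fact
  interpret g: ring_hom_ring R A g by fact
  have grp: "comm_group (ring_bimod f A g)"
    by (rule comm_group_cong[OF f.S.a_comm_group]) (simp_all add: ring_bimod_def)
  interpret comm_group "ring_bimod f A g" by (rule grp)
  show ?thesis
    by unfold_locales
      (auto simp: ring_bimod_def f.S.r_distr f.S.l_distr f.S.m_assoc)
qed

lemma bimodule_right_hom_bimod:
  assumes "bimodule S B M" "bimodule T B N"
  shows "bimodule T S (right_hom_bimod B M N)"
proof -
  interpret M: bimodule S B M by fact
  interpret N: bimodule T B N by fact
  let ?H = "right_hom_bimod B M N"
  have N_one: "ract N \<one>\<^bsub>N\<^esub> b = \<one>\<^bsub>N\<^esub>" if "b \<in> carrier B" for b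
  proof -
    have "ract N \<one>\<^bsub>N\<^esub> b \<otimes>\<^bsub>N\<^esub> ract N \<one>\<^bsub>N\<^esub> b = ract N \<one>\<^bsub>N\<^esub> b"
      using N.ract_add[of b "\<one>\<^bsub>N\<^esub>" "\<one>\<^bsub>N\<^esub>"] that by simp
    then show ?thesis
      using that N.ract_closed[of b "\<one>\<^bsub>N\<^esub>"] by (metis N.M.l_cancel_one' N.M.one_closed)
  qed
  have N_inv: "inv\<^bsub>N\<^esub> (ract N n b) = ract N (inv\<^bsub>N\<^esub> n) b"
    if "n \<in> carrier N" "b \<in> carrier B" for n b
  proof -
    have "ract N (inv\<^bsub>N\<^esub> n) b \<otimes>\<^bsub>N\<^esub> ract N n b = \<one>\<^bsub>N\<^esub>"
      using N.ract_add[of b "inv\<^bsub>N\<^esub> n" n] that N_one by simp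
    then show ?thesis
      using that by (intro N.M.inv_equality) (auto simp: N.ract_closed)
  qed
  have mem: "\<phi> \<in> carrier ?H \<longleftrightarrow> \<phi> \<in> extensional (carrier M) \<and> (\<forall>m\<in>carrier M. \<phi> m \<in> carrier N) \<and>
      (\<forall>m\<in>carrier M. \<forall>m'\<in>carrier M. \<phi> (m \<otimes>\<^bsub>M\<^esub> m') = \<phi> m \<otimes>\<^bsub>N\<^esub> \<phi> m') \<and>
      (\<forall>b\<in>carrier B. \<forall>m\<in>carrier M. \<phi> (ract M m b) = ract N (\<phi> m) b)" for \<phi>
    by (auto simp: right_hom_bimod_def right_linear_def hom_def)
  have ops: "monoid.mult ?H = (\<lambda>\<phi> \<psi>. \<lambda>m\<in>carrier M. \<phi> m \<otimes>\<^bsub>N\<^esub> \<psi> m)" "\<one>\<^bsub>?H\<^esub> = (\<lambda>m\<in>carrier M. \<one>\<^bsub>N\<^esub>)"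
    "lact ?H = (\<lambda>t \<phi>. \<lambda>m\<in>carrier M. lact N t (\<phi> m))"
    "ract ?H = (\<lambda>\<phi> s. \<lambda>m\<in>carrier M. \<phi> (lact M s m))"
    by (simp_all add: right_hom_bimod_def)
  note closed = M.lact_closed M.ract_closed N.lact_closed N.ract_closed
  have inv: "\<exists>\<psi>\<in>carrier ?H. \<psi> \<otimes>\<^bsub>?H\<^esub> \<phi> = \<one>\<^bsub>?H\<^esub>" if "\<phi> \<in> carrier ?H" for \<phi>
  proof
    show "(\<lambda>m\<in>carrier M. inv\<^bsub>N\<^esub> (\<phi> m)) \<in> carrier ?H"
      using that unfolding mem by (auto simp: closed N.M.inv_mult N_inv)
    show "(\<lambda>m\<in>carrier M. inv\<^bsub>N\<^esub> (\<phi> m)) \<otimes>\<^bsub>?H\<^esub> \<phi> = \<one>\<^bsub>?H\<^esub>"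
      using that unfolding mem ops by auto
  qed
  have "comm_group ?H"
  proof (rule comm_groupI)
    show "x \<otimes>\<^bsub>?H\<^esub> y \<in> carrier ?H" if "x \<in> carrier ?H" "y \<in> carrier ?H" for x y
      using that unfolding mem ops by (auto simp: closed N.M.m_ac N.ract_add)
  next
    show "\<one>\<^bsub>?H\<^esub> \<in> carrier ?H"
      unfolding mem ops by (auto simp: closed N_one)
  next
    show "x \<otimes>\<^bsub>?H\<^esub> y \<otimes>\<^bsub>?H\<^esub> z = x \<otimes>\<^bsub>?H\<^esub> (y \<otimes>\<^bsub>?H\<^esub> z)"
      if "x \<in> carrier ?H" "y \<in> carrier ?H" "z \<in> carrier ?H" for x y z
      using that unfolding mem ops by (auto intro!: restrict_ext simp: N.M.m_assoc)
  next
    show "x \<otimes>\<^bsub>?H\<^esub> y = y \<otimes>\<^bsub>?H\<^esub> x" if "x \<in> carrier ?H" "y \<in> carrier ?H" for x y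
      using that unfolding mem ops by (auto intro!: restrict_ext simp: N.M.m_comm)
  next
    show "\<one>\<^bsub>?H\<^esub> \<otimes>\<^bsub>?H\<^esub> x = x" if "x \<in> carrier ?H" for x
      by (rule extensionalityI[of _ "carrier M"])
        (use that in \<open>auto simp: mem ops\<close>)
  qed (rule inv)
  then interpret H: comm_group ?H .
  show ?thesis
  proof unfold_locales
    show "lact ?H t \<phi> \<in> carrier ?H" if "t \<in> carrier T" "\<phi> \<in> carrier ?H" for t \<phi>
      using that unfolding mem ops by (auto simp: closed N.lact_add N.lact_ract)
    show "ract ?H \<phi> s \<in> carrier ?H" if "s \<in> carrier S" "\<phi> \<in> carrier ?H" for s \<phi>
      using that unfolding mem ops by (auto simp: closed M.lact_add M.lact_ract[symmetric])
  qed ((rule extensionalityI[of _ "carrier M"];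
        auto simp: mem ops closed N.lact_add M.lact_add N.add_lact M.add_lact N.mult_lact
          M.mult_lact N.one_lact M.one_lact)+)
qed


section \<open>Tensor products of bimodules\<close>

definition tensor_relations ::
    "('b, 'x) ring_scheme \<Rightarrow> ('s, 'b, 'm, 'y) bimod_scheme \<Rightarrow> ('b, 't, 'n, 'z) bimod_scheme
      \<Rightarrow> ('m \<times> 'n \<Rightarrow>\<^sub>0 int) set" where
  "tensor_relations B M N = generate (free_Abelian_group (carrier M \<times> carrier N))
    ({frag_of (m \<otimes>\<^bsub>M\<^esub> m', n) - frag_of (m, n) - frag_of (m', n) | m m' n.
        m \<in> carrier M \<and> m' \<in> carrier M \<and> n \<in> carrier N} \<union>
     {frag_of (m, n \<otimes>\<^bsub>N\<^esub> n') - frag_of (m, n) - frag_of (m, n') | m n n'.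
        m \<in> carrier M \<and> n \<in> carrier N \<and> n' \<in> carrier N} \<union>
     {frag_of (ract M m b, n) - frag_of (m, lact N b n) | m b n.
        m \<in> carrier M \<and> b \<in> carrier B \<and> n \<in> carrier N})"

text \<open>The elements of the tensor product over \<open>B\<close> are cosets of the subgroup of relations.  A
  scalar acts on a coset by acting on the pairs that generate the free abelian group; adding the
  subgroup turns the image of the coset into a coset again.\<close>

definition tensor_bimod ::
    "('b, 'x) ring_scheme \<Rightarrow> ('s, 'b, 'm, 'y) bimod_scheme \<Rightarrow> ('b, 't, 'n, 'z) bimod_scheme
      \<Rightarrow> ('s, 't, ('m \<times> 'n \<Rightarrow>\<^sub>0 int) set) bimod" where
  "tensor_bimod B M N =
    (let F = free_Abelian_group (carrier M \<times> carrier N); K = tensor_relations B M N in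
      \<lparr>carrier = carrier (F Mod K), monoid.mult = monoid.mult (F Mod K), one = \<one>\<^bsub>F Mod K\<^esub>,
       lact = (\<lambda>s U. K <#>\<^bsub>F\<^esub> (frag_extend (\<lambda>(m, n). frag_of (lact M s m, n)) ` U)),
       ract = (\<lambda>U t. K <#>\<^bsub>F\<^esub> (frag_extend (\<lambda>(m, n). frag_of (m, ract N n t)) ` U))\<rparr>)"

definition pure_tensor ::
    "('b, 'x) ring_scheme \<Rightarrow> ('s, 'b, 'm, 'y) bimod_scheme \<Rightarrow> ('b, 't, 'n, 'z) bimod_scheme
      \<Rightarrow> 'm \<Rightarrow> 'n \<Rightarrow> ('m \<times> 'n \<Rightarrow>\<^sub>0 int) set" where
  "pure_tensor B M N m n =
    tensor_relations B M N #>\<^bsub>free_Abelian_group (carrier M \<times> carrier N)\<^esub> frag_of (m, n)"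

lemma tensor_relations_subgroup:
  assumes "bimodule S B M" "bimodule B T N"
  shows "subgroup (tensor_relations B M N) (free_Abelian_group (carrier M \<times> carrier N))"
proof -
  interpret M: bimodule S B M by fact
  interpret N: bimodule B T N by fact
  let ?F = "free_Abelian_group (carrier M \<times> carrier N)"
  interpret F: comm_group ?F by (rule abelian_free_Abelian_group)
  have diff: "x - y \<in> carrier ?F" if "x \<in> carrier ?F" "y \<in> carrier ?F" for x y
    using that keys_diff[of x y] by auto
  show ?thesis
    unfolding tensor_relations_def
    by (rule F.generate_is_subgroup)
      (use diff in \<open>auto simp del: carrier_free_Abelian_group_iff
        simp: M.ract_closed N.lact_closed\<close>)
qed

lemma tensor_relations_induct [consumes 3, case_names zero diff left right mid]:
  assumes "bimodule S B M" "bimodule B T N" "x \<in> tensor_relations B M N"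
    and "P 0"
    and "\<And>x y. P x \<Longrightarrow> P y \<Longrightarrow> P (x - y)"
    and "\<And>m m' n. m \<in> carrier M \<Longrightarrow> m' \<in> carrier M \<Longrightarrow> n \<in> carrier N \<Longrightarrow>
      P (frag_of (m \<otimes>\<^bsub>M\<^esub> m', n) - frag_of (m, n) - frag_of (m', n))"
    and "\<And>m n n'. m \<in> carrier M \<Longrightarrow> n \<in> carrier N \<Longrightarrow> n' \<in> carrier N \<Longrightarrow>
      P (frag_of (m, n \<otimes>\<^bsub>N\<^esub> n') - frag_of (m, n) - frag_of (m, n'))"
    and "\<And>m b n. m \<in> carrier M \<Longrightarrow> b \<in> carrier B \<Longrightarrow> n \<in> carrier N \<Longrightarrow>
      P (frag_of (ract M m b, n) - frag_of (m, lact N b n))"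
  shows "P x"
proof -
  interpret M: bimodule S B M by fact
  interpret N: bimodule B T N by fact
  let ?F = "free_Abelian_group (carrier M \<times> carrier N)"
  interpret F: comm_group ?F by (rule abelian_free_Abelian_group)
  have K: "subgroup (tensor_relations B M N) ?F"
    using assms(1,2) by (rule tensor_relations_subgroup)
  have in_F: "y \<in> carrier ?F" if "y \<in> tensor_relations B M N" for y
    using subgroup.mem_carrier[OF K that] .
  have neg: "P (- y)" if "P y" for y
    using assms(5)[OF assms(4) that] by simp
  have add: "P (y + z)" if "P y" "P z" for y z
    using assms(5)[OF that(1) neg[OF that(2)]] by simp
  have gen: "P y" if "y \<in>
    {frag_of (m \<otimes>\<^bsub>M\<^esub> m', n) - frag_of (m, n) - frag_of (m', n) | m m' n.
        m \<in> carrier M \<and> m' \<in> carrier M \<and> n \<in> carrier N} \<union>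
     {frag_of (m, n \<otimes>\<^bsub>N\<^esub> n') - frag_of (m, n) - frag_of (m, n') | m n n'.
        m \<in> carrier M \<and> n \<in> carrier N \<and> n' \<in> carrier N} \<union>
     {frag_of (ract M m b, n) - frag_of (m, lact N b n) | m b n.
        m \<in> carrier M \<and> b \<in> carrier B \<and> n \<in> carrier N}" for y
    using that by (elim UnE CollectE exE conjE) (simp_all add: assms(6-8))
  show ?thesis
    using assms(3) unfolding tensor_relations_def
  proof (induction rule: generate.induct)
    case one
    then show ?case using assms(4) by simp
  next
    case (incl h)
    then show ?case by (rule gen)
  next
    case (inv h)
    then have "h \<in> tensor_relations B M N"
      unfolding tensor_relations_def by (rule generate.incl)
    then have "Poly_Mapping.keys h \<subseteq> carrier M \<times> carrier N"
      using in_F by simp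
    then show ?case
      using neg[OF gen[OF inv]] by simp
  next
    case (eng h1 h2)
    then show ?case using add by simp
  qed
qed

lemma bimodule_tensor_bimod:
  fixes M :: "('s, 'b, 'm, 'y) bimod_scheme" and N :: "('b, 't, 'n, 'z) bimod_scheme"
  defines "F \<equiv> free_Abelian_group (carrier M \<times> carrier N)"
  assumes "bimodule S B M" "bimodule B T N"
  shows "bimodule S T (tensor_bimod B M N)"
    and "u \<in> carrier F \<Longrightarrow> v \<in> carrier F \<Longrightarrow>
      (tensor_relations B M N #>\<^bsub>F\<^esub> u) \<otimes>\<^bsub>tensor_bimod B M N\<^esub> (tensor_relations B M N #>\<^bsub>F\<^esub> v) =
        tensor_relations B M N #>\<^bsub>F\<^esub> (u + v)"
    and "s \<in> carrier S \<Longrightarrow> u \<in> carrier F \<Longrightarrow>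
      lact (tensor_bimod B M N) s (tensor_relations B M N #>\<^bsub>F\<^esub> u) =
        tensor_relations B M N #>\<^bsub>F\<^esub> frag_extend (\<lambda>(m, n). frag_of (lact M s m, n)) u"
    and "t \<in> carrier T \<Longrightarrow> u \<in> carrier F \<Longrightarrow>
      ract (tensor_bimod B M N) (tensor_relations B M N #>\<^bsub>F\<^esub> u) t =
        tensor_relations B M N #>\<^bsub>F\<^esub> frag_extend (\<lambda>(m, n). frag_of (m, ract N n t)) u"
proof -
  interpret M: bimodule S B M by fact
  interpret N: bimodule B T N by fact
  let ?F = "free_Abelian_group (carrier M \<times> carrier N)"
  interpret F: comm_group ?F by (rule abelian_free_Abelian_group)
  let ?K = "tensor_relations B M N"
  let ?T = "tensor_bimod B M N"
  have K: "subgroup ?K ?F"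
    using assms(2,3) by (rule tensor_relations_subgroup)
  interpret K: subgroup ?K ?F by (rule K)
  interpret K: normal ?K ?F using K by (rule F.subgroup_imp_normal)
  define cos where "cos u = ?K #>\<^bsub>?F\<^esub> u" for u
  define lam where "lam s = frag_extend (\<lambda>(m, n). frag_of (lact M s m, n :: 'n))" for s
  define rho where "rho t = frag_extend (\<lambda>(m :: 'm, n). frag_of (m, ract N n t))" for t
  have K_diff: "x - y \<in> ?K" if "x \<in> ?K" "y \<in> ?K" for x y
    using K.m_closed[OF that(1) K.m_inv_closed[OF that(2)]] K.mem_carrier[OF that(2)] by simp
  have K_add: "x + y \<in> ?K" if "x \<in> ?K" "y \<in> ?K" for x y
    using K.m_closed[OF that] by simp
  have K_zero: "0 \<in> ?K"
    using K.one_closed by simp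
  have rel: "frag_of (m \<otimes>\<^bsub>M\<^esub> m', n) - frag_of (m, n) - frag_of (m', n) \<in> ?K"
    if "m \<in> carrier M" "m' \<in> carrier M" "n \<in> carrier N" for m m' n
    using that unfolding tensor_relations_def by (intro generate.incl) blast
  have rel': "frag_of (m, n \<otimes>\<^bsub>N\<^esub> n') - frag_of (m, n) - frag_of (m, n') \<in> ?K"
    if "m \<in> carrier M" "n \<in> carrier N" "n' \<in> carrier N" for m n n'
    using that unfolding tensor_relations_def by (intro generate.incl) blast
  have rel'': "frag_of (ract M m b, n) - frag_of (m, lact N b n) \<in> ?K"
    if "m \<in> carrier M" "b \<in> carrier B" "n \<in> carrier N" for m b n
    using that unfolding tensor_relations_def by (intro generate.incl) blast
  have F_diff: "x - y \<in> carrier ?F" if "x \<in> carrier ?F" "y \<in> carrier ?F" for x y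
    using that keys_diff[of x y] by auto
  have F_add: "x + y \<in> carrier ?F" if "x \<in> carrier ?F" "y \<in> carrier ?F" for x y
    using F.m_closed[OF that] by simp
  have cos_eqI: "cos u = cos v" if "u \<in> carrier ?F" "v \<in> carrier ?F" "u - v \<in> ?K" for u v
  proof -
    have "u \<in> ?K #>\<^bsub>?F\<^esub> v"
      using that by (subst K.rcos_module) (auto intro: F.group_axioms)
    then show ?thesis
      unfolding cos_def using F.repr_independence K that(2) by metis
  qed
  have carr: "carrier ?T = cos ` carrier ?F"
    by (simp add: tensor_bimod_def Let_def carrier_FactGroup cos_def)
  have mult: "cos u \<otimes>\<^bsub>?T\<^esub> cos v = cos (u + v)" if "u \<in> carrier ?F" "v \<in> carrier ?F" for u v
    using K.rcos_sum[OF that] by (simp add: tensor_bimod_def Let_def cos_def)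
  have action: "?K <#>\<^bsub>?F\<^esub> (h ` cos u) = cos (h u)"
    if "u \<in> carrier ?F" "\<And>x y. h (x + y) = h x + h y" "h ` ?K \<subseteq> ?K" for h u
  proof
    show "?K <#>\<^bsub>?F\<^esub> (h ` cos u) \<subseteq> cos (h u)"
      using that K_add unfolding cos_def set_mult_def r_coset_def
      by (auto simp: add.assoc[symmetric] image_subset_iff)
    have "u \<in> cos u"
      unfolding cos_def by (rule F.rcos_self[OF that(1) K])
    show "cos (h u) \<subseteq> ?K <#>\<^bsub>?F\<^esub> (h ` cos u)"
    proof
      fix y assume "y \<in> cos (h u)"
      then obtain k where "k \<in> ?K" "y = k + h u"
        unfolding cos_def r_coset_def by auto
      then show "y \<in> ?K <#>\<^bsub>?F\<^esub> (h ` cos u)"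
        using \<open>u \<in> cos u\<close> unfolding set_mult_def by (intro UN_I) auto
    qed
  qed
  have lam_add: "lam s (x + y) = lam s x + lam s y" and lam_diff: "lam s (x - y) = lam s x - lam s y"
    and lam_0: "lam s 0 = 0" and lam_of: "lam s (frag_of (m, n)) = frag_of (lact M s m, n)"
    for s x y m n
    by (simp_all add: lam_def frag_extend_add frag_extend_diff)
  have rho_add: "rho t (x + y) = rho t x + rho t y" and rho_diff: "rho t (x - y) = rho t x - rho t y"
    and rho_0: "rho t 0 = 0" and rho_of: "rho t (frag_of (m, n)) = frag_of (m, ract N n t)"
    for t x y m n
    by (simp_all add: rho_def frag_extend_add frag_extend_diff)
  have lam_K: "lam s x \<in> ?K" if "s \<in> carrier S" "x \<in> ?K" for s x
    using assms(2,3) that(2)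
  proof (induction rule: tensor_relations_induct)
    case (left m m' n)
    then show ?case
      using rel[of "lact M s m" "lact M s m'" n] that(1)
      by (simp add: lam_diff lam_of M.lact_add M.lact_closed)
  next
    case (right m n n')
    then show ?case
      using rel'[of "lact M s m" n n'] that(1)
      by (simp add: lam_diff lam_of M.lact_closed)
  next
    case (mid m b n)
    then show ?case
      using rel''[of "lact M s m" b n] that(1)
      by (simp add: lam_diff lam_of M.lact_closed M.lact_ract)
  qed (simp_all add: lam_0 lam_diff K_zero K_diff)
  have rho_K: "rho t x \<in> ?K" if "t \<in> carrier T" "x \<in> ?K" for t x
    using assms(2,3) that(2)
  proof (induction rule: tensor_relations_induct)
    case (left m m' n)
    then show ?case
      using rel[of m m' "ract N n t"] that(1)
      by (simp add: rho_diff rho_of N.ract_closed)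
  next
    case (right m n n')
    then show ?case
      using rel'[of m "ract N n t" "ract N n' t"] that(1)
      by (simp add: rho_diff rho_of N.ract_add N.ract_closed)
  next
    case (mid m b n)
    then show ?case
      using rel''[of m b "ract N n t"] that(1)
      by (simp add: rho_diff rho_of N.ract_closed N.lact_ract)
  qed (simp_all add: rho_0 rho_diff K_zero K_diff)
  have F_ind: "P u" if "u \<in> carrier ?F" "P 0"
    "\<And>m n. m \<in> carrier M \<Longrightarrow> n \<in> carrier N \<Longrightarrow> P (frag_of (m, n))"
    "\<And>a b. P a \<Longrightarrow> P b \<Longrightarrow> P (a - b)" for P u
  proof -
    have "Poly_Mapping.keys u \<subseteq> carrier M \<times> carrier N"
      using that(1) by simp
    then show ?thesis
      by (induction rule: frag_induction) (use that(2-4) in auto)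
  qed
  have lam_F: "lam s u \<in> carrier ?F" if "s \<in> carrier S" "u \<in> carrier ?F" for s u
    using that(2)
  proof (rule F_ind)
    show "lam s (x - y) \<in> carrier ?F" if "lam s x \<in> carrier ?F" "lam s y \<in> carrier ?F" for x y
      unfolding lam_diff using that by (rule F_diff)
  qed (use that(1) in \<open>simp_all add: lam_0 lam_of M.lact_closed\<close>)
  have rho_F: "rho t u \<in> carrier ?F" if "t \<in> carrier T" "u \<in> carrier ?F" for t u
    using that(2)
  proof (rule F_ind)
    show "rho t (x - y) \<in> carrier ?F" if "rho t x \<in> carrier ?F" "rho t y \<in> carrier ?F" for x y
      unfolding rho_diff using that by (rule F_diff)
  qed (use that(1) in \<open>simp_all add: rho_0 rho_of N.ract_closed\<close>)
  have lact: "lact ?T s (cos u) = cos (lam s u)" if "s \<in> carrier S" "u \<in> carrier ?F" for s u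
    using action[of u "lam s", OF that(2) lam_add] lam_K[OF that(1)]
    by (auto simp: tensor_bimod_def Let_def lam_def[symmetric])
  have ract: "ract ?T (cos u) t = cos (rho t u)" if "t \<in> carrier T" "u \<in> carrier ?F" for t u
    using action[of u "rho t", OF that(2) rho_add] rho_K[OF that(1)]
    by (auto simp: tensor_bimod_def Let_def rho_def[symmetric])
  have eqs: "lam (s \<otimes>\<^bsub>S\<^esub> s') u = lam s (lam s' u)" "lam \<one>\<^bsub>S\<^esub> u = u"
    "rho (t \<otimes>\<^bsub>T\<^esub> t') u = rho t' (rho t u)" "rho \<one>\<^bsub>T\<^esub> u = u"
    "rho t (lam s u) = lam s (rho t u)"
    if "u \<in> carrier ?F" "s \<in> carrier S" "s' \<in> carrier S" "t \<in> carrier T" "t' \<in> carrier T"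
    for u s s' t t'
    by (rule F_ind[OF that(1)];
        use that(2-5) in \<open>simp add: lam_0 lam_of lam_diff rho_0 rho_of rho_diff
          M.mult_lact M.one_lact N.mult_ract N.one_ract\<close>)+
  have lam_plus: "lam (s \<oplus>\<^bsub>S\<^esub> s') u - (lam s u + lam s' u) \<in> ?K"
    if "u \<in> carrier ?F" "s \<in> carrier S" "s' \<in> carrier S" for u s s'
  proof (rule F_ind[OF that(1)])
    fix m n assume "m \<in> carrier M" "n \<in> carrier N"
    then show "lam (s \<oplus>\<^bsub>S\<^esub> s') (frag_of (m, n)) - (lam s (frag_of (m, n)) + lam s' (frag_of (m, n))) \<in> ?K"
      using that rel[of "lact M s m" "lact M s' m" n]
      by (simp add: lam_of M.add_lact M.lact_closed diff_diff_eq)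
  next
    fix a b
    assume "lam (s \<oplus>\<^bsub>S\<^esub> s') a - (lam s a + lam s' a) \<in> ?K"
      and "lam (s \<oplus>\<^bsub>S\<^esub> s') b - (lam s b + lam s' b) \<in> ?K"
    from K_diff[OF this]
    show "lam (s \<oplus>\<^bsub>S\<^esub> s') (a - b) - (lam s (a - b) + lam s' (a - b)) \<in> ?K"
      by (simp add: lam_diff algebra_simps)
  qed (simp add: lam_0 K_zero)
  have rho_plus: "rho (t \<oplus>\<^bsub>T\<^esub> t') u - (rho t u + rho t' u) \<in> ?K"
    if "u \<in> carrier ?F" "t \<in> carrier T" "t' \<in> carrier T" for u t t'
  proof (rule F_ind[OF that(1)])
    fix m n assume "m \<in> carrier M" "n \<in> carrier N"
    then show "rho (t \<oplus>\<^bsub>T\<^esub> t') (frag_of (m, n)) - (rho t (frag_of (m, n)) + rho t' (frag_of (m, n))) \<in> ?K"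
      using that rel'[of m "ract N n t" "ract N n t'"]
      by (simp add: rho_of N.add_ract N.ract_closed diff_diff_eq)
  next
    fix a b
    assume "rho (t \<oplus>\<^bsub>T\<^esub> t') a - (rho t a + rho t' a) \<in> ?K"
      and "rho (t \<oplus>\<^bsub>T\<^esub> t') b - (rho t b + rho t' b) \<in> ?K"
    from K_diff[OF this]
    show "rho (t \<oplus>\<^bsub>T\<^esub> t') (a - b) - (rho t (a - b) + rho t' (a - b)) \<in> ?K"
      by (simp add: rho_diff algebra_simps)
  qed (simp add: rho_0 K_zero)
  have grp: "comm_group ?T"
    by (rule comm_group_cong[OF F.abelian_FactGroup[OF K]])
      (simp_all add: tensor_bimod_def Let_def)
  interpret comm_group ?T by (rule grp)
  show "bimodule S T ?T"
  proof unfold_locales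
    show "lact ?T s x \<in> carrier ?T"
      if h: "s \<in> carrier S" "x \<in> carrier ?T" for s x
    proof -
      obtain u where [simp]: "x = cos u" and u: "u \<in> carrier ?F"
        using h unfolding carr by blast
      show ?thesis
        using h(1) u lam_F by (simp add: lact carr del: carrier_free_Abelian_group_iff)
    qed
    show "ract ?T x t \<in> carrier ?T"
      if h: "t \<in> carrier T" "x \<in> carrier ?T" for t x
    proof -
      obtain u where [simp]: "x = cos u" and u: "u \<in> carrier ?F"
        using h unfolding carr by blast
      show ?thesis
        using h(1) u rho_F by (simp add: ract carr del: carrier_free_Abelian_group_iff)
    qed
    show "lact ?T s (x \<otimes>\<^bsub>?T\<^esub> y) = lact ?T s x \<otimes>\<^bsub>?T\<^esub> lact ?T s y"
      if h: "s \<in> carrier S" "x \<in> carrier ?T" "y \<in> carrier ?T" for s x y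
    proof -
      obtain u where [simp]: "x = cos u" and u: "u \<in> carrier ?F"
        using h unfolding carr by blast
      obtain v where [simp]: "y = cos v" and v: "v \<in> carrier ?F"
        using h unfolding carr by blast
      show ?thesis
        using h(1) u v lam_F F_add
        by (simp add: lact mult lam_add del: carrier_free_Abelian_group_iff)
    qed
    show "ract ?T (x \<otimes>\<^bsub>?T\<^esub> y) t = ract ?T x t \<otimes>\<^bsub>?T\<^esub> ract ?T y t"
      if h: "t \<in> carrier T" "x \<in> carrier ?T" "y \<in> carrier ?T" for t x y
    proof -
      obtain u where [simp]: "x = cos u" and u: "u \<in> carrier ?F"
        using h unfolding carr by blast
      obtain v where [simp]: "y = cos v" and v: "v \<in> carrier ?F"
        using h unfolding carr by blast
      show ?thesis
        using h(1) u v rho_F F_add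
        by (simp add: ract mult rho_add del: carrier_free_Abelian_group_iff)
    qed
    show "lact ?T (s \<oplus>\<^bsub>S\<^esub> s') x = lact ?T s x \<otimes>\<^bsub>?T\<^esub> lact ?T s' x"
      if h: "s \<in> carrier S" "s' \<in> carrier S" "x \<in> carrier ?T" for s s' x
    proof -
      obtain u where [simp]: "x = cos u" and u: "u \<in> carrier ?F"
        using h unfolding carr by blast
      show ?thesis
        using h(1,2) u lam_F F_add lam_plus
        by (simp add: lact mult cos_eqI del: carrier_free_Abelian_group_iff)
    qed
    show "ract ?T x (t \<oplus>\<^bsub>T\<^esub> t') = ract ?T x t \<otimes>\<^bsub>?T\<^esub> ract ?T x t'"
      if h: "t \<in> carrier T" "t' \<in> carrier T" "x \<in> carrier ?T" for t t' x
    proof -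
      obtain u where [simp]: "x = cos u" and u: "u \<in> carrier ?F"
        using h unfolding carr by blast
      show ?thesis
        using h(1,2) u rho_F F_add rho_plus
        by (simp add: ract mult cos_eqI del: carrier_free_Abelian_group_iff)
    qed
    show "lact ?T (s \<otimes>\<^bsub>S\<^esub> s') x = lact ?T s (lact ?T s' x)"
      if h: "s \<in> carrier S" "s' \<in> carrier S" "x \<in> carrier ?T" for s s' x
    proof -
      obtain u where [simp]: "x = cos u" and u: "u \<in> carrier ?F"
        using h unfolding carr by blast
      show ?thesis
        using h(1,2) u lam_F eqs(1)[OF u h(1,2) N.R.one_closed N.R.one_closed]
        by (simp add: lact del: carrier_free_Abelian_group_iff)
    qed
    show "ract ?T x (t \<otimes>\<^bsub>T\<^esub> t') = ract ?T (ract ?T x t) t'"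
      if h: "t \<in> carrier T" "t' \<in> carrier T" "x \<in> carrier ?T" for t t' x
    proof -
      obtain u where [simp]: "x = cos u" and u: "u \<in> carrier ?F"
        using h unfolding carr by blast
      show ?thesis
        using h(1,2) u rho_F eqs(3)[OF u M.L.one_closed M.L.one_closed h(1,2)]
        by (simp add: ract del: carrier_free_Abelian_group_iff)
    qed
    show "lact ?T \<one>\<^bsub>S\<^esub> x = x"
      if h: "x \<in> carrier ?T" for x
    proof -
      obtain u where [simp]: "x = cos u" and u: "u \<in> carrier ?F"
        using h unfolding carr by blast
      show ?thesis
        using u eqs(2)[OF u M.L.one_closed M.L.one_closed N.R.one_closed N.R.one_closed]
        by (simp add: lact del: carrier_free_Abelian_group_iff)
    qed
    show "ract ?T x \<one>\<^bsub>T\<^esub> = x"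
      if h: "x \<in> carrier ?T" for x
    proof -
      obtain u where [simp]: "x = cos u" and u: "u \<in> carrier ?F"
        using h unfolding carr by blast
      show ?thesis
        using u eqs(4)[OF u M.L.one_closed M.L.one_closed N.R.one_closed N.R.one_closed]
        by (simp add: ract del: carrier_free_Abelian_group_iff)
    qed
    show "ract ?T (lact ?T s x) t = lact ?T s (ract ?T x t)"
      if h: "s \<in> carrier S" "t \<in> carrier T" "x \<in> carrier ?T" for s t x
    proof -
      obtain u where [simp]: "x = cos u" and u: "u \<in> carrier ?F"
        using h unfolding carr by blast
      show ?thesis
        using h(1,2) u lam_F rho_F eqs(5)[OF u h(1) M.L.one_closed h(2) N.R.one_closed]
        by (simp add: lact ract del: carrier_free_Abelian_group_iff)
    qed
  qed
  show "(?K #>\<^bsub>F\<^esub> u) \<otimes>\<^bsub>?T\<^esub> (?K #>\<^bsub>F\<^esub> v) = ?K #>\<^bsub>F\<^esub> (u + v)"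
    if "u \<in> carrier F" "v \<in> carrier F"
    using mult that unfolding F_def cos_def by blast
  show "lact ?T s (?K #>\<^bsub>F\<^esub> u) = ?K #>\<^bsub>F\<^esub> frag_extend (\<lambda>(m, n). frag_of (lact M s m, n)) u"
    if "s \<in> carrier S" "u \<in> carrier F"
    using lact that unfolding F_def cos_def lam_def by blast
  show "ract ?T (?K #>\<^bsub>F\<^esub> u) t = ?K #>\<^bsub>F\<^esub> frag_extend (\<lambda>(m, n). frag_of (m, ract N n t)) u"
    if "t \<in> carrier T" "u \<in> carrier F"
    using ract that unfolding F_def cos_def rho_def by blast
qed

text \<open>For a ring homomorphism \<open>f\<close> from \<open>B\<close> to \<open>A\<close>: the tensor square of \<open>A\<close> over \<open>B\<close>, as an
  \<open>A\<close>-\<open>A\<close>-bimodule, and the multiplication map on it.  The latter sends a coset to the common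
  value of the sums of products on its elements.\<close>

definition tensor_square ::
    "('b, 'x) ring_scheme \<Rightarrow> ('a, 'y) ring_scheme \<Rightarrow> ('b \<Rightarrow> 'a)
      \<Rightarrow> ('a, 'a, ('a \<times> 'a \<Rightarrow>\<^sub>0 int) set) bimod" where
  "tensor_square B A f = tensor_bimod B (ring_bimod id A f) (ring_bimod f A id)"

definition frag_mult :: "('a, 'y) ring_scheme \<Rightarrow> ('a \<times> 'a \<Rightarrow>\<^sub>0 int) \<Rightarrow> 'a" where
  "frag_mult A u =
    (\<Oplus>\<^bsub>A\<^esub>p\<in>Poly_Mapping.keys u. add_pow A (Poly_Mapping.lookup u p) (fst p \<otimes>\<^bsub>A\<^esub> snd p))"

definition tensor_mult :: "('a, 'y) ring_scheme \<Rightarrow> ('a \<times> 'a \<Rightarrow>\<^sub>0 int) set \<Rightarrow> 'a" where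
  "tensor_mult A U = the_elem (frag_mult A ` U)"

lemma (in ring) frag_mult_diff:
  assumes "Poly_Mapping.keys u \<subseteq> carrier R \<times> carrier R"
    "Poly_Mapping.keys v \<subseteq> carrier R \<times> carrier R"
  shows "frag_mult R (u - v) = frag_mult R u \<ominus> frag_mult R v" "frag_mult R u \<in> carrier R"
proof -
  let ?g = "\<lambda>u p. add_pow R (Poly_Mapping.lookup u p :: int) (fst p \<otimes> snd p)"
  let ?P = "Poly_Mapping.keys u \<union> Poly_Mapping.keys v"
  have P: "fst p \<otimes> snd p \<in> carrier R" if "p \<in> ?P" for p
    using assms that by auto
  then have closed: "?g w \<in> ?P \<rightarrow> carrier R" for w
    by auto
  have sum: "frag_mult R w = (\<Oplus>p\<in>?P. ?g w p)" if "Poly_Mapping.keys w \<subseteq> ?P" for w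
    unfolding frag_mult_def
  proof (rule add.finprod_mono_neutral_cong_left)
    show "?g w p = \<zero>" if "p \<in> ?P - Poly_Mapping.keys w" for p
      using that by (simp add: in_keys_iff add_pow_def)
  qed (use that closed in auto)
  show "frag_mult R u \<in> carrier R"
    using sum[of u] closed by simp
  have "frag_mult R (u - v) \<oplus> frag_mult R v = (\<Oplus>p\<in>?P. ?g (u - v) p \<oplus> ?g v p)"
    using sum[OF keys_diff] sum[of v] finsum_addf[OF closed closed] by simp
  also have "\<dots> = (\<Oplus>p\<in>?P. ?g u p)"
    using P closed
    by (intro finsum_cong') (auto simp: lookup_minus add.int_pow_mult[symmetric])
  finally have "frag_mult R (u - v) \<oplus> frag_mult R v = frag_mult R u"
    using sum[of u] by simp
  moreover have "frag_mult R (u - v) \<in> carrier R" "frag_mult R v \<in> carrier R"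
    using sum[OF keys_diff] sum[of v] closed by simp_all
  ultimately show "frag_mult R (u - v) = frag_mult R u \<ominus> frag_mult R v"
    by (metis a_minus_def add.inv_solve_right a_closed)
qed

lemma tensor_mult:
  assumes "ring_hom_ring B A f"
  shows "tensor_mult A \<in> bimod_hom A A (tensor_square B A f) (ring_bimod id A id)"
    and "a \<in> carrier A \<Longrightarrow> a' \<in> carrier A \<Longrightarrow>
      tensor_mult A (pure_tensor B (ring_bimod id A f) (ring_bimod f A id) a a') = a \<otimes>\<^bsub>A\<^esub> a'"
proof -
  interpret f: ring_hom_ring B A f by fact
  let ?M = "ring_bimod id A f" and ?N = "ring_bimod f A id"
  let ?F = "free_Abelian_group (carrier A \<times> carrier A)"
  let ?K = "tensor_relations B ?M ?N"
  have id: "ring_hom_ring A A id"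
    by (intro ring_hom_ring.intro ring_hom_ring_axioms.intro f.S.ring_axioms) (simp add: ring_hom_def)
  have M: "bimodule A B ?M" and N: "bimodule B A ?N"
    by (intro bimodule_ring_bimod assms id)+
  have carr: "carrier ?M = carrier A" "carrier ?N = carrier A"
    by (simp_all add: ring_bimod_def)
  note tensor = bimodule_tensor_bimod[OF M N, unfolded carr]
  have K: "subgroup ?K ?F"
    using tensor_relations_subgroup[OF M N] unfolding carr .
  interpret F: comm_group ?F by (rule abelian_free_Abelian_group)
  interpret K: subgroup ?K ?F by (rule K)
  have F_diff: "u - v \<in> carrier ?F" if "u \<in> carrier ?F" "v \<in> carrier ?F" for u v
    using that keys_diff[of u v] by auto
  have F_add: "u + v \<in> carrier ?F" if "u \<in> carrier ?F" "v \<in> carrier ?F" for u v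
    using F.m_closed[OF that] by simp
  have fm_diff: "frag_mult A (u - v) = frag_mult A u \<ominus>\<^bsub>A\<^esub> frag_mult A v"
    if "u \<in> carrier ?F" "v \<in> carrier ?F" for u v
    using f.S.frag_mult_diff(1) that by simp
  have closed: "frag_mult A u \<in> carrier A" if "u \<in> carrier ?F" for u
    using f.S.frag_mult_diff(2)[of u u] that by simp
  have fm_0: "frag_mult A 0 = \<zero>\<^bsub>A\<^esub>"
    by (simp add: frag_mult_def)
  have add: "frag_mult A (u + v) = frag_mult A u \<oplus>\<^bsub>A\<^esub> frag_mult A v"
    if "u \<in> carrier ?F" "v \<in> carrier ?F" for u v
    using fm_diff[OF F_add[OF that] that(2)] closed[OF that(1)] closed[OF that(2)]
      closed[OF F_add[OF that]] f.S.add.inv_solve_right unfolding a_minus_def by simp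
  have of: "frag_mult A (frag_of (x, y)) = x \<otimes>\<^bsub>A\<^esub> y" if "x \<in> carrier A" "y \<in> carrier A" for x y
    using that by (simp add: frag_mult_def add_pow_def int_pow_def nat_pow_def)
  have F_ind: "u \<in> carrier ?F \<and> P u" if "u \<in> carrier ?F" "P 0"
    "\<And>x y. x \<in> carrier A \<Longrightarrow> y \<in> carrier A \<Longrightarrow> P (frag_of (x, y))"
    "\<And>u v. u \<in> carrier ?F \<Longrightarrow> v \<in> carrier ?F \<Longrightarrow> P u \<Longrightarrow> P v \<Longrightarrow> P (u - v)" for P u
  proof -
    have "Poly_Mapping.keys u \<subseteq> carrier A \<times> carrier A"
      using that(1) by simp
    then show ?thesis
    proof (induction rule: frag_induction)
      case (diff u v)
      then show ?case using F_diff that(4) by blast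
    qed (use that(2,3) in auto)
  qed
  have ops: "x \<otimes>\<^bsub>?M\<^esub> y = x \<oplus>\<^bsub>A\<^esub> y" "x \<otimes>\<^bsub>?N\<^esub> y = x \<oplus>\<^bsub>A\<^esub> y"
    "ract ?M x b = x \<otimes>\<^bsub>A\<^esub> f b" "lact ?N b x = f b \<otimes>\<^bsub>A\<^esub> x"
    "lact ?M x y = x \<otimes>\<^bsub>A\<^esub> y" "ract ?N x y = x \<otimes>\<^bsub>A\<^esub> y" for x y b
    by (simp_all add: ring_bimod_def)
  have vanish: "x \<in> carrier ?F \<and> frag_mult A x = \<zero>\<^bsub>A\<^esub>" if "x \<in> ?K" for x
    using M N that
  proof (induction rule: tensor_relations_induct)
    case zero
    then show ?case using fm_0 by simp
  next
    case (diff x y)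
    then show ?case using F_diff fm_diff by (simp add: a_minus_def)
  next
    case (left x x' y)
    then show ?case
      using F_diff unfolding carr ops
      by (simp add: fm_diff of f.S.l_distr a_minus_def f.S.a_ac f.S.r_neg f.S.minus_add
          f.S.r_neg1 f.S.r_neg2 f.S.l_neg del: carrier_free_Abelian_group_iff)
  next
    case (right x y y')
    then show ?case
      using F_diff unfolding carr ops
      by (simp add: fm_diff of f.S.r_distr a_minus_def f.S.a_ac f.S.r_neg f.S.minus_add
          f.S.r_neg1 f.S.r_neg2 f.S.l_neg del: carrier_free_Abelian_group_iff)
  next
    case (mid x b y)
    then show ?case
      using F_diff unfolding carr ops
      by (simp add: fm_diff of f.S.m_assoc a_minus_def f.S.r_neg
          del: carrier_free_Abelian_group_iff)
  qed
  have cos: "tensor_mult A (?K #>\<^bsub>?F\<^esub> u) = frag_mult A u" if "u \<in> carrier ?F" for u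
  proof -
    have "frag_mult A w = frag_mult A u" if w: "w \<in> ?K #>\<^bsub>?F\<^esub> u" for w
    proof -
      obtain k where "k \<in> ?K" "w = k + u"
        using w unfolding r_coset_def by auto
      then show ?thesis
        using add vanish closed \<open>u \<in> carrier ?F\<close> by simp
    qed
    moreover have "u \<in> ?K #>\<^bsub>?F\<^esub> u"
      by (rule F.rcos_self[OF that K])
    ultimately have "frag_mult A ` (?K #>\<^bsub>?F\<^esub> u) = {frag_mult A u}"
      by blast
    then show ?thesis
      by (simp add: tensor_mult_def)
  qed
  show "tensor_mult A (pure_tensor B ?M ?N a a') = a \<otimes>\<^bsub>A\<^esub> a'"
    if "a \<in> carrier A" "a' \<in> carrier A"
    using that by (simp add: pure_tensor_def carr cos of)
  let ?T = "tensor_bimod B ?M ?N"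
  have elem: "\<exists>u\<in>carrier ?F. x = ?K #>\<^bsub>?F\<^esub> u" if "x \<in> carrier ?T" for x
    using that by (auto simp: tensor_bimod_def Let_def carrier_FactGroup carr)
  let ?lam = "\<lambda>s. frag_extend (\<lambda>(m, n). frag_of (s \<otimes>\<^bsub>A\<^esub> m, n))"
  let ?rho = "\<lambda>t. frag_extend (\<lambda>(m, n). frag_of (m, n \<otimes>\<^bsub>A\<^esub> t))"
  have lam: "?lam s u \<in> carrier ?F \<and> frag_mult A (?lam s u) = s \<otimes>\<^bsub>A\<^esub> frag_mult A u"
    if s: "s \<in> carrier A" and u: "u \<in> carrier ?F" for s u
  proof (rule conjunct2[OF F_ind[OF u]])
    fix u v
    assume uv: "u \<in> carrier ?F" "v \<in> carrier ?F"
      "?lam s u \<in> carrier ?F \<and> frag_mult A (?lam s u) = s \<otimes>\<^bsub>A\<^esub> frag_mult A u"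
      "?lam s v \<in> carrier ?F \<and> frag_mult A (?lam s v) = s \<otimes>\<^bsub>A\<^esub> frag_mult A v"
    show "?lam s (u - v) \<in> carrier ?F \<and>
      frag_mult A (?lam s (u - v)) = s \<otimes>\<^bsub>A\<^esub> frag_mult A (u - v)"
      unfolding frag_extend_diff
      using uv s F_diff closed[OF uv(1)] closed[OF uv(2)]
      by (simp add: fm_diff a_minus_def f.S.r_distr f.S.r_minus del: carrier_free_Abelian_group_iff)
  qed (use s in \<open>simp_all add: fm_0 of f.S.m_assoc\<close>)
  have rho: "?rho t u \<in> carrier ?F \<and> frag_mult A (?rho t u) = frag_mult A u \<otimes>\<^bsub>A\<^esub> t"
    if t: "t \<in> carrier A" and u: "u \<in> carrier ?F" for t u
  proof (rule conjunct2[OF F_ind[OF u]])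
    fix u v
    assume uv: "u \<in> carrier ?F" "v \<in> carrier ?F"
      "?rho t u \<in> carrier ?F \<and> frag_mult A (?rho t u) = frag_mult A u \<otimes>\<^bsub>A\<^esub> t"
      "?rho t v \<in> carrier ?F \<and> frag_mult A (?rho t v) = frag_mult A v \<otimes>\<^bsub>A\<^esub> t"
    show "?rho t (u - v) \<in> carrier ?F \<and>
      frag_mult A (?rho t (u - v)) = frag_mult A (u - v) \<otimes>\<^bsub>A\<^esub> t"
      unfolding frag_extend_diff
      using uv t F_diff closed[OF uv(1)] closed[OF uv(2)]
      by (simp add: fm_diff a_minus_def f.S.l_distr f.S.l_minus del: carrier_free_Abelian_group_iff)
  qed (use t in \<open>simp_all add: fm_0 of f.S.m_assoc\<close>)
  let ?A = "ring_bimod id A id"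
  have A: "carrier ?A = carrier A" "x \<otimes>\<^bsub>?A\<^esub> y = x \<oplus>\<^bsub>A\<^esub> y"
    "lact ?A x y = x \<otimes>\<^bsub>A\<^esub> y" "ract ?A x y = x \<otimes>\<^bsub>A\<^esub> y" for x y
    by (simp_all add: ring_bimod_def)
  have T: "tensor_mult A x \<in> carrier A"
    "y \<in> carrier ?T \<Longrightarrow>
      tensor_mult A (x \<otimes>\<^bsub>?T\<^esub> y) = tensor_mult A x \<oplus>\<^bsub>A\<^esub> tensor_mult A y"
    "s \<in> carrier A \<Longrightarrow> tensor_mult A (lact ?T s x) = s \<otimes>\<^bsub>A\<^esub> tensor_mult A x"
    "t \<in> carrier A \<Longrightarrow> tensor_mult A (ract ?T x t) = tensor_mult A x \<otimes>\<^bsub>A\<^esub> t"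
    if x: "x \<in> carrier ?T" for x y s t
  proof -
    obtain u where u: "x = ?K #>\<^bsub>?F\<^esub> u" "u \<in> carrier ?F"
      using elem[OF x] by blast
    then show "tensor_mult A x \<in> carrier A"
      using cos closed by simp
    show "tensor_mult A (x \<otimes>\<^bsub>?T\<^esub> y) = tensor_mult A x \<oplus>\<^bsub>A\<^esub> tensor_mult A y"
      if "y \<in> carrier ?T"
    proof -
      obtain v where v: "y = ?K #>\<^bsub>?F\<^esub> v" "v \<in> carrier ?F"
        using elem[OF \<open>y \<in> carrier ?T\<close>] by blast
      have "tensor_mult A (x \<otimes>\<^bsub>?T\<^esub> y) = frag_mult A (u + v)"
        unfolding u(1) v(1) tensor(2)[OF u(2) v(2)] using u(2) v(2) F_add cos by blast
      then show ?thesis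
        unfolding u(1) v(1) cos[OF u(2)] cos[OF v(2)] using add[OF u(2) v(2)] by simp
    qed
    show "tensor_mult A (lact ?T s x) = s \<otimes>\<^bsub>A\<^esub> tensor_mult A x" if "s \<in> carrier A"
      using lam[OF that u(2)] cos
      unfolding u(1) tensor(3)[OF that u(2), unfolded ops] cos[OF u(2)] by metis
    show "tensor_mult A (ract ?T x t) = tensor_mult A x \<otimes>\<^bsub>A\<^esub> t" if "t \<in> carrier A"
      using rho[OF that u(2)] cos
      unfolding u(1) tensor(4)[OF that u(2), unfolded ops] cos[OF u(2)] by metis
  qed
  show "tensor_mult A \<in> bimod_hom A A (tensor_square B A f) ?A"
    unfolding bimod_hom_def left_linear_def right_linear_def hom_def tensor_square_def A
    using T by blast
qed

section \<open>Separable and Frobenius extensions\<close>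

definition frobenius_extension ::
    "('b, 'x) ring_scheme \<Rightarrow> ('a, 'y) ring_scheme \<Rightarrow> ('b \<Rightarrow> 'a) \<Rightarrow> bool" where
  "frobenius_extension B A f \<longleftrightarrow>
    ring_hom_ring B A f \<and>
    fg_projective_right B (ring_bimod id A f) \<and>
    bimod_isomorphic B A (ring_bimod f A id)
      (right_hom_bimod B (ring_bimod id A f) (ring_bimod id B id))"

definition separable_extension ::
    "('b, 'x) ring_scheme \<Rightarrow> ('a, 'y) ring_scheme \<Rightarrow> ('b \<Rightarrow> 'a) \<Rightarrow> bool" where
  "separable_extension B A f \<longleftrightarrow>
    ring_hom_ring B A f \<and>
    (\<exists>\<sigma>\<in>bimod_hom A A (ring_bimod id A id) (tensor_square B A f).
       \<forall>a\<in>carrier A. tensor_mult A (\<sigma> a) = a)"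

definition separable_frobenius_extension ::
    "('b, 'x) ring_scheme \<Rightarrow> ('a, 'y) ring_scheme \<Rightarrow> ('b \<Rightarrow> 'a) \<Rightarrow> bool" where
  "separable_frobenius_extension B A f \<longleftrightarrow>
    frobenius_extension B A f \<and> separable_extension B A f"

definition frobenius_algebra ::
    "('r, 'x) ring_scheme \<Rightarrow> ('r, 'a, 'y) module_scheme \<Rightarrow> bool" where
  "frobenius_algebra R A \<longleftrightarrow> frobenius_extension R A (\<lambda>r. r \<odot>\<^bsub>A\<^esub> \<one>\<^bsub>A\<^esub>)"

definition separable_frobenius_algebra ::
    "('r, 'x) ring_scheme \<Rightarrow> ('r, 'a, 'y) module_scheme \<Rightarrow> bool" where
  "separable_frobenius_algebra R A \<longleftrightarrow>
    separable_frobenius_extension R A (\<lambda>r. r \<odot>\<^bsub>A\<^esub> \<one>\<^bsub>A\<^esub>)"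


section \<open>Centralizer matrix algebras\<close>

definition centralizer_algebra :: "nat \<Rightarrow> 'a :: field mat \<Rightarrow> ('a, 'a mat) module" where
  "centralizer_algebra n c =
    \<lparr>carrier = {a \<in> carrier_mat n n. a * c = c * a},
     monoid.mult = (*), one = 1\<^sub>m n, ring.zero = 0\<^sub>m n n, add = (+), module.smult = (\<cdot>\<^sub>m)\<rparr>"

lemma ring_hom_ring_centralizer_algebra:
  assumes "c \<in> carrier_mat n n"
  shows "ring_hom_ring ring_of_type_algebra (centralizer_algebra n c)
    (\<lambda>r. r \<odot>\<^bsub>centralizer_algebra n c\<^esub> \<one>\<^bsub>centralizer_algebra n c\<^esub>)"
proof -
  let ?A = "centralizer_algebra n c"
  have A: "carrier ?A = {a \<in> carrier_mat n n. a * c = c * a}" "x \<otimes>\<^bsub>?A\<^esub> y = x * y"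
    "x \<oplus>\<^bsub>?A\<^esub> y = x + y" "\<one>\<^bsub>?A\<^esub> = 1\<^sub>m n" "\<zero>\<^bsub>?A\<^esub> = 0\<^sub>m n n" "r \<odot>\<^bsub>?A\<^esub> x = r \<cdot>\<^sub>m x" for x y r
    by (simp_all add: centralizer_algebra_def)
  note assoc = assoc_mult_mat[of _ n n _ n _ n]
  have mult: "x * y * c = c * (x * y)"
    if "x \<in> carrier_mat n n" "y \<in> carrier_mat n n" "x * c = c * x" "y * c = c * y" for x y
    using assoc[OF that(1,2) assms] assoc[OF that(1) assms that(2)] assoc[OF assms that(1,2)] that(3,4)
    by simp
  have minus: "- x * c = c * - x" if "x \<in> carrier_mat n n" "x * c = c * x" for x
    using that assms by simp
  have ring: "ring ?A"
  proof (rule ringI)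
    show "abelian_group ?A"
    proof (rule abelian_groupI)
      show "\<exists>y\<in>carrier ?A. y \<oplus>\<^bsub>?A\<^esub> x = \<zero>\<^bsub>?A\<^esub>" if "x \<in> carrier ?A" for x
        using that uminus_l_inv_mat[of x n n] minus[of x] unfolding A
        by (intro bexI[of _ "- x"]) auto
    qed (use assms in \<open>auto simp: A add_mult_distrib_mat[of _ n n] mult_add_distrib_mat[of _ n n]
        assoc_add_mat[of _ n n] intro: comm_add_mat[of _ n n]\<close>)
    show "monoid ?A"
    proof (rule monoidI)
      show "x \<otimes>\<^bsub>?A\<^esub> y \<in> carrier ?A" if "x \<in> carrier ?A" "y \<in> carrier ?A" for x y
        using that mult[of x y] mult_carrier_mat[of x n n y n] unfolding A by simp
    qed (use assms in \<open>auto simp: A assoc\<close>)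
  qed (auto simp: A add_mult_distrib_mat[of _ n n] mult_add_distrib_mat[of _ n n])
  have scalar: "(r \<cdot>\<^sub>m 1\<^sub>m n) * x = r \<cdot>\<^sub>m x" "x * (r \<cdot>\<^sub>m 1\<^sub>m n) = r \<cdot>\<^sub>m x"
    if "x \<in> carrier_mat n n" for r :: 'a and x
    using that mult_smult_assoc_mat[of "1\<^sub>m n" n n x n r] mult_smult_distrib[of x n n "1\<^sub>m n" n r]
    by simp_all
  have smult_smult: "r \<cdot>\<^sub>m (r' \<cdot>\<^sub>m x) = (r * r') \<cdot>\<^sub>m x" for r r' :: 'a and x
    by (rule eq_matI) (simp_all add: mult.assoc)
  have one_smult: "1 \<cdot>\<^sub>m 1\<^sub>m n = (1\<^sub>m n :: 'a mat)"
    by (rule eq_matI) simp_all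
  have "(\<lambda>r. r \<odot>\<^bsub>?A\<^esub> \<one>\<^bsub>?A\<^esub>) \<in> Ring.ring_hom ring_of_type_algebra ?A"
    unfolding A
    by (rule ring_hom_memI)
      (use assms in \<open>simp_all add: A ring_of_type_algebra_def scalar smult_smult
        one_smult mult.commute add_smult_distrib_right_mat[of _ n n]\<close>)
  then show ?thesis
    by (intro ring_hom_ring.intro ring_hom_ring_axioms.intro ring ring_from_type_algebra)
qed

end

theory Submission
  imports Defs "HOL-Library.Function_Algebras"
begin

text \<open>Let \<open>A\<close> be the centralizer of \<open>c\<close> in the matrix ring \<open>M\<close>, let \<open>q\<close> be a polynomial over the base field with
\<open>q(c) = 0\<close>, and let \<open>E(g)\<close> be the derivative of \<open>q\<close> at \<open>c\<close> in the direction \<open>g\<close>.  Writing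
\<open>(q(x) - q(y)) / (x - y)\<close> as a sum of terms \<open>e x^i y^j\<close>, one has \<open>E(g)\<close> equal to the sum of the
\<open>e c^i g c^j\<close>.  Three properties make this map the main tool: its values commute with \<open>c\<close>, because
\<open>c E(g) - E(g) c = q(c) g - g q(c)\<close>; it is \<open>A\<close>-linear on both sides; and it is self-adjoint for the
trace form on \<open>M\<close>.

If \<open>E(g) = 1\<close> for some \<open>g\<close>, then \<open>A\<close> is a Frobenius algebra with Frobenius form \<open>a \<mapsto> tr(a g)\<close>: the map
\<open>x \<mapsto> E(x g)\<close> is a linear projection of \<open>M\<close> onto \<open>A\<close>, and the functional \<open>m \<mapsto> tr(k m)\<close> on \<open>A\<close> is
\<open>m \<mapsto> tr(E(k) m g)\<close>.  The equation \<open>E(g) = 1\<close> is linear in \<open>g\<close> with coefficients in the base field, so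
a solution over an extension field yields a solution over the base field: apply to its entries a
linear functional that fixes \<open>1\<close>.  This descent also works over finite fields, where a
functional in general position need not exist.  Over the extension the equation is solved one Jordan
block at a time.  On a block of size \<open>k\<close> with eigenvalue \<open>\<mu>\<close> there is a solution if \<open>\<mu>\<close> is a root of
\<open>q\<close> of multiplicity exactly \<open>k\<close>, and when \<open>q\<close> is the minimal polynomial this holds for all blocks as
soon as blocks with the same eigenvalue have the same size.

Conversely a Frobenius form on \<open>A\<close> is \<open>a \<mapsto> tr(a g)\<close> for some \<open>g\<close>, and it stays nondegenerate after
extension of the field.  Let \<open>q = (x - \<mu>) r\<close> be the minimal polynomial and let \<open>V\<close> be the eigenspace for
\<open>\<mu>\<close>.  Testing the form on matrices \<open>z v r(c)\<close>, where the columns of \<open>z\<close> lie in \<open>V\<close>, shows that \<open>r(c) g\<close>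
is injective on \<open>V\<close>.  Its values there lie in the range of \<open>r(c)\<close>, which is contained in \<open>V\<close>; so \<open>V\<close> is that
range.  If a block with eigenvalue \<open>\<mu>\<close> were shorter than the multiplicity of \<open>\<mu>\<close> in \<open>q\<close>, then \<open>r\<close> would
vanish on this block and its eigenvector would not be in the range.

If all blocks have size one, let \<open>u(k, l)\<close> be the matrix units.  The element
\<open>\<Sum> E(u(k, l)) \<otimes> E(Y u(l, k))\<close> of the tensor square commutes with \<open>A\<close> for every matrix \<open>Y\<close>, since
\<open>\<Sum> u(k, l) \<otimes> u(l, k)\<close> commutes with all matrices.  Multiplication sends it to
\<open>E(\<Sum> u(k, l) E(Y u(l, k)))\<close>, and requiring this to be \<open>1\<close> is again a linear equation, now for \<open>Y\<close>.  It is
solved over the extension by Lagrange interpolation at the eigenvalues.  Conversely, let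
\<open>\<Sum> x \<otimes> y\<close> be a separating element, let \<open>E(g) = 1\<close>, and suppose that some block with eigenvalue \<open>\<mu>\<close>
has size at least two.  Put \<open>q = (x - \<mu>) r\<close> and \<open>z = r(c)\<close>.  Then \<open>z z = 0\<close>, while the product rule for the
derivative gives \<open>z g z = z\<close>.  The average \<open>\<Phi>(h) = \<Sum> x h y\<close> commutes with \<open>c\<close>, whence
\<open>z = \<Phi>(z) = \<Phi>(z g z) = z \<Phi>(g) z = z z \<Phi>(g) = 0\<close>.  But if \<open>r(c) = 0\<close>, then the product rule makes \<open>c - \<mu>\<close>
invertible, which is absurd for an eigenvalue.\<close>

section \<open>Square matrices\<close>

lemma square_mult_simps:
  fixes A B C :: "'a :: field mat"
  assumes "A \<in> carrier_mat n n" "B \<in> carrier_mat n n"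
  shows "C \<in> carrier_mat n n \<Longrightarrow> (A * B) * C = A * (B * C)"
    and "C \<in> carrier_mat n n \<Longrightarrow> (A + B) * C = A * C + B * C"
    and "C \<in> carrier_mat n n \<Longrightarrow> C * (A + B) = C * A + C * B"
    and "(k \<cdot>\<^sub>m A) * B = k \<cdot>\<^sub>m (A * B)" "A * (k \<cdot>\<^sub>m B) = k \<cdot>\<^sub>m (A * B)"
    and "k \<cdot>\<^sub>m (A + B) = k \<cdot>\<^sub>m A + k \<cdot>\<^sub>m B"
    and "A * B \<in> carrier_mat n n"
  using assms assoc_mult_mat[of A n n B n C n] add_mult_distrib_mat[of A n n B C n]
    mult_add_distrib_mat[of C n n A n B] mult_smult_assoc_mat[of A n n B n k]
    mult_smult_distrib[of A n n B n k] add_smult_distrib_left_mat[of A n n B k]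
  by auto

lemma square_add_ac:
  fixes A B C :: "'a :: field mat"
  assumes "A \<in> carrier_mat n n" "B \<in> carrier_mat n n"
  shows "A + B = B + A"
    and "C \<in> carrier_mat n n \<Longrightarrow> (A + B) + C = A + (B + C)"
    and "C \<in> carrier_mat n n \<Longrightarrow> A + (B + C) = B + (A + C)"
  using assms by (auto simp: add.commute add.left_commute add.assoc)

lemmas square_simps = square_mult_simps square_add_ac

lemma square_zero_simps [simp]:
  fixes A :: "'a :: field mat"
  assumes "A \<in> carrier_mat n n"
  shows "0\<^sub>m n n * A = 0\<^sub>m n n" "A * 0\<^sub>m n n = 0\<^sub>m n n" "0\<^sub>m n n + A = A" "A + 0\<^sub>m n n = A"
    "1\<^sub>m n * A = A" "A * 1\<^sub>m n = A"
  using assms by auto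

lemma smult_smult_mat: "k \<cdot>\<^sub>m (l \<cdot>\<^sub>m A) = (k * l) \<cdot>\<^sub>m (A :: 'a :: field mat)"
  by (rule eq_matI) (simp_all add: mult.assoc)

lemma smult_zero_one [simp]:
  fixes A :: "'a :: field mat"
  shows "0 \<cdot>\<^sub>m 1\<^sub>m n = (0\<^sub>m n n :: 'a mat)" "A \<in> carrier_mat n m \<Longrightarrow> 0 \<cdot>\<^sub>m A = 0\<^sub>m n m" "1 \<cdot>\<^sub>m A = A" "k \<cdot>\<^sub>m 0\<^sub>m n m = (0\<^sub>m n m :: 'a mat)"
  by auto

lemma square_mult_left_commute:
  fixes a b x :: "'a :: field mat"
  assumes "a \<in> carrier_mat n n" "b \<in> carrier_mat n n" "x \<in> carrier_mat n n" "a * b = b * a"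
  shows "a * (b * x) = b * (a * x)"
proof -
  have "a * (b * x) = (a * b) * x"
    by (rule assoc_mult_mat[symmetric]) (use assms in auto)
  also have "\<dots> = b * (a * x)"
    unfolding assms(4) by (rule assoc_mult_mat) (use assms in auto)
  finally show ?thesis .
qed

definition mat_trace :: "'a :: comm_ring_1 mat \<Rightarrow> 'a" where
  "mat_trace A = (\<Sum>i<dim_row A. A $$ (i, i))"

lemma mat_trace_add: "A \<in> carrier_mat n n \<Longrightarrow> B \<in> carrier_mat n n \<Longrightarrow>
    mat_trace (A + B) = mat_trace A + mat_trace B"
  by (auto simp: mat_trace_def sum.distrib)

lemma mat_trace_smult: "A \<in> carrier_mat n n \<Longrightarrow> mat_trace (k \<cdot>\<^sub>m A) = k * mat_trace A"
  by (auto simp: mat_trace_def sum_distrib_left)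

lemma mat_trace_zero [simp]: "mat_trace (0\<^sub>m n n) = 0"
  by (simp add: mat_trace_def)

lemma index_mult_square:
  assumes "A \<in> carrier_mat n n" "B \<in> carrier_mat n n" "i < n" "j < n"
  shows "(A * B) $$ (i, j) = (\<Sum>k<n. A $$ (i, k) * B $$ (k, j))"
  using assms by (auto simp: scalar_prod_def atLeast0LessThan)

lemma mat_trace_mult:
  assumes "A \<in> carrier_mat n n" "B \<in> carrier_mat n n"
  shows "mat_trace (A * B) = (\<Sum>i<n. \<Sum>k<n. A $$ (i, k) * B $$ (k, i))"
  using assms by (auto simp: mat_trace_def index_mult_square[OF assms] simp del: index_mult_mat(1))

lemma mat_trace_comm:
  assumes "A \<in> carrier_mat n n" "B \<in> carrier_mat n n"
  shows "mat_trace (A * B) = mat_trace (B * A)"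
  unfolding mat_trace_mult[OF assms] mat_trace_mult[OF assms(2,1)]
  by (subst sum.swap) (simp add: mult.commute)

definition unit_mat :: "nat \<Rightarrow> nat \<Rightarrow> nat \<Rightarrow> 'a :: field mat" where
  "unit_mat n k l = mat n n (\<lambda>(i, j). if i = k \<and> j = l then 1 else 0)"

lemma unit_mat_carrier [simp]: "unit_mat n k l \<in> carrier_mat n n"
  by (simp add: unit_mat_def)

lemma mat_trace_unit_mat:
  assumes "A \<in> carrier_mat n n" "k < n" "l < n"
  shows "mat_trace (A * unit_mat n k l) = A $$ (l, k)"
proof -
  have "mat_trace (A * unit_mat n k l) = (\<Sum>i<n. \<Sum>j<n. if j = k then if i = l then A $$ (i, j) else 0 else 0)"
    unfolding mat_trace_mult[OF assms(1) unit_mat_carrier]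
    by (intro sum.cong) (auto simp: unit_mat_def)
  also have "\<dots> = A $$ (l, k)"
    using assms(2,3) by (simp add: sum.delta)
  finally show ?thesis .
qed

lemma mat_trace_nondegenerate:
  assumes "A \<in> carrier_mat n n" "\<And>Z. Z \<in> carrier_mat n n \<Longrightarrow> mat_trace (A * Z) = 0"
  shows "A = (0\<^sub>m n n :: 'a :: field mat)"
  using assms(1) assms(2)[OF unit_mat_carrier] mat_trace_unit_mat[OF assms(1)]
  by (intro eq_matI) auto

lemma square_minus_simps:
  fixes A B C :: "'a :: field mat"
  assumes "A \<in> carrier_mat n n" "B \<in> carrier_mat n n"
  shows "A - B \<in> carrier_mat n n"
    and "C \<in> carrier_mat n n \<Longrightarrow> (A - B) * C = A * C - B * C"
    and "C \<in> carrier_mat n n \<Longrightarrow> C * (A - B) = C * A - C * B"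
  using assms minus_mult_distrib_mat[of A n n B C n] mult_minus_distrib_mat[of C n n A n B] by auto

lemma square_diff_eq_zero:
  fixes A B :: "'a :: field mat"
  assumes "A \<in> carrier_mat n n" "B \<in> carrier_mat n n" "A - B = 0\<^sub>m n n"
  shows "A = B"
proof (rule eq_matI)
  fix i j assume "i < dim_row B" "j < dim_col B"
  moreover have "(A - B) $$ (i, j) = 0\<^sub>m n n $$ (i, j)"
    by (simp only: assms(3))
  ultimately show "A $$ (i, j) = B $$ (i, j)"
    using assms(1,2) by auto
qed (use assms(1,2) in auto)

lemma square_add_left_cancel:
  fixes A B B' :: "'a :: field mat"
  assumes "A \<in> carrier_mat n n" "B \<in> carrier_mat n n" "B' \<in> carrier_mat n n" "A + B = A + B'"
  shows "B = B'"
proof (rule eq_matI)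
  fix i j assume "i < dim_row B'" "j < dim_col B'"
  moreover have "(A + B) $$ (i, j) = (A + B') $$ (i, j)"
    by (simp only: assms(4))
  ultimately show "B $$ (i, j) = B' $$ (i, j)"
    using assms(1-3) by auto
qed (use assms(1-3) in auto)

lemma index_unit_mat_sandwich:
  assumes "A \<in> carrier_mat n n" "B \<in> carrier_mat n n" "k < n" "l < n" "i < n" "j < n"
  shows "(A * unit_mat n k l * B) $$ (i, j) = A $$ (i, k) * B $$ (l, j)"
proof -
  have 1: "(A * unit_mat n k l) $$ (i, t) = (if t = l then A $$ (i, k) else 0)" if "t < n" for t
  proof -
    have "(A * unit_mat n k l) $$ (i, t) = (\<Sum>s<n. if s = k then if t = l then A $$ (i, s) else 0 else 0)"
      unfolding index_mult_square[OF assms(1) unit_mat_carrier assms(5) that]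
      using that by (intro sum.cong refl) (auto simp: unit_mat_def)
    then show ?thesis
      using assms(3) by (simp add: sum.delta)
  qed
  have "(A * unit_mat n k l * B) $$ (i, j) = (\<Sum>t<n. if t = l then A $$ (i, k) * B $$ (t, j) else 0)"
    unfolding index_mult_square[OF square_mult_simps(7)[OF assms(1) unit_mat_carrier] assms(2,5,6)]
    by (intro sum.cong refl) (simp add: 1)
  then show ?thesis
    using assms(4) by (simp add: sum.delta)
qed

text \<open>The ring of square matrices is prime: if one entry of \<open>B\<close> is nonzero, sandwiched matrix units read
  off every entry of \<open>A\<close>.\<close>

lemma square_mats_prime:
  fixes A B :: "'a :: field mat"
  assumes "A \<in> carrier_mat n n" "B \<in> carrier_mat n n"
    and "\<And>V. V \<in> carrier_mat n n \<Longrightarrow> A * V * B = 0\<^sub>m n n" and "B \<noteq> 0\<^sub>m n n"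
  shows "A = 0\<^sub>m n n"
proof -
  obtain l j where lj: "l < n" "j < n" "B $$ (l, j) \<noteq> 0"
    using assms(2,4) by (metis carrier_matD eq_matI index_zero_mat)
  have "A $$ (i, k) = 0" if "i < n" "k < n" for i k
    using index_unit_mat_sandwich[OF assms(1,2) that(2) lj(1) that(1) lj(2)] lj that
      assms(3)[OF unit_mat_carrier[of n k l]] by simp
  then show ?thesis
    using assms(1) by (intro eq_matI) auto
qed

lemma left_regular_imp_right_inverse:
  fixes B :: "'a :: field mat"
  assumes B: "B \<in> carrier_mat n n"
    and inj: "\<And>Z. Z \<in> carrier_mat n n \<Longrightarrow> B * Z = 0\<^sub>m n n \<Longrightarrow> Z = 0\<^sub>m n n"
  obtains B' where "B' \<in> carrier_mat n n" "B * B' = 1\<^sub>m n"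
proof -
  have "det B \<noteq> 0"
  proof
    assume "det B = 0"
    then obtain v where v: "v \<in> carrier_vec n" "v \<noteq> 0\<^sub>v n" "B *\<^sub>v v = 0\<^sub>v n"
      using det_0_iff_vec_prod_zero_field[OF B] by blast
    define Z where "Z = mat n n (\<lambda>(i, j). v $ i)"
    have Z: "Z \<in> carrier_mat n n"
      by (simp add: Z_def)
    have "B * Z = 0\<^sub>m n n"
    proof (rule eq_matI)
      fix i j assume "i < dim_row (0\<^sub>m n n :: 'a mat)" "j < dim_col (0\<^sub>m n n :: 'a mat)"
      then have ij: "i < n" "j < n" by auto
      have "col Z j = v"
        using ij v(1) by (intro eq_vecI) (auto simp: Z_def)
      then have "(B * Z) $$ (i, j) = (B *\<^sub>v v) $ i"
        using ij B Z by simp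
      then show "(B * Z) $$ (i, j) = 0\<^sub>m n n $$ (i, j)"
        using ij v(3) by simp
    qed (use B Z in auto)
    then have "Z = 0\<^sub>m n n"
      by (rule inj[OF Z])
    have "v $ i = 0" if "i < n" for i
    proof -
      have "Z $$ (i, i) = 0"
        unfolding \<open>Z = 0\<^sub>m n n\<close> using that by simp
      then show ?thesis
        using that by (simp add: Z_def)
    qed
    then show False
      using v(1,2) by (metis carrier_vecD eq_vecI index_zero_vec)
  qed
  then show ?thesis
    using det_non_zero_imp_unit[OF B, of "()"] that by (auto simp: Units_def ring_mat_def)
qed

section \<open>Finite sums of matrices\<close>

definition sum_mat :: "nat \<Rightarrow> ('i \<Rightarrow> 'a :: field mat) \<Rightarrow> 'i set \<Rightarrow> 'a mat" where
  "sum_mat n f I = mat n n (\<lambda>(i, j). \<Sum>x\<in>I. f x $$ (i, j))"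

lemma sum_mat_carrier [simp]: "sum_mat n f I \<in> carrier_mat n n"
  by (simp add: sum_mat_def)

lemma sum_mat_empty [simp]: "sum_mat n f {} = 0\<^sub>m n n"
  by (rule eq_matI) (auto simp: sum_mat_def)

lemma sum_mat_insert:
  "finite I \<Longrightarrow> x \<notin> I \<Longrightarrow> f x \<in> carrier_mat n n \<Longrightarrow> sum_mat n f (insert x I) = f x + sum_mat n f I"
  by (rule eq_matI) (auto simp: sum_mat_def)

lemma sum_mat_cong: "(\<And>x. x \<in> I \<Longrightarrow> f x = g x) \<Longrightarrow> sum_mat n f I = sum_mat n g I"
  unfolding sum_mat_def by (intro cong_mat refl) (auto intro: sum.cong)

lemma sum_mat_add:
  assumes "\<And>x. x \<in> I \<Longrightarrow> f x \<in> carrier_mat n n" "\<And>x. x \<in> I \<Longrightarrow> g x \<in> carrier_mat n n"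
  shows "sum_mat n (\<lambda>x. f x + g x) I = sum_mat n f I + sum_mat n g I"
proof (rule eq_matI)
  fix i j assume "i < dim_row (sum_mat n f I + sum_mat n g I)" "j < dim_col (sum_mat n f I + sum_mat n g I)"
  then have ij: "i < n" "j < n"
    by (auto simp: sum_mat_def)
  have "(f x + g x) $$ (i, j) = f x $$ (i, j) + g x $$ (i, j)" if "x \<in> I" for x
    using assms(1)[OF that] assms(2)[OF that] ij by auto
  then show "sum_mat n (\<lambda>x. f x + g x) I $$ (i, j) = (sum_mat n f I + sum_mat n g I) $$ (i, j)"
    using ij by (simp add: sum_mat_def sum.distrib)
qed (auto simp: sum_mat_def)

lemma sum_mat_smult:
  assumes "\<And>x. x \<in> I \<Longrightarrow> f x \<in> carrier_mat n n"
  shows "sum_mat n (\<lambda>x. k \<cdot>\<^sub>m f x) I = k \<cdot>\<^sub>m sum_mat n f I"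
proof (rule eq_matI)
  fix i j assume "i < dim_row (k \<cdot>\<^sub>m sum_mat n f I)" "j < dim_col (k \<cdot>\<^sub>m sum_mat n f I)"
  then have ij: "i < n" "j < n"
    by (auto simp: sum_mat_def)
  have "(k \<cdot>\<^sub>m f x) $$ (i, j) = k * f x $$ (i, j)" if "x \<in> I" for x
    using assms(1)[OF that] ij by auto
  then show "sum_mat n (\<lambda>x. k \<cdot>\<^sub>m f x) I $$ (i, j) = (k \<cdot>\<^sub>m sum_mat n f I) $$ (i, j)"
    using ij by (simp add: sum_mat_def sum_distrib_left)
qed (auto simp: sum_mat_def)

lemma sum_mat_unit_decomposition:
  assumes "V \<in> carrier_mat n n"
  shows "V = sum_mat n (\<lambda>(i, j). V $$ (i, j) \<cdot>\<^sub>m unit_mat n i j) ({..<n} \<times> {..<n})"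
proof (rule eq_matI)
  fix a b assume ab: "a < dim_row (sum_mat n (\<lambda>(i, j). V $$ (i, j) \<cdot>\<^sub>m unit_mat n i j) ({..<n} \<times> {..<n}))"
    "b < dim_col (sum_mat n (\<lambda>(i, j). V $$ (i, j) \<cdot>\<^sub>m unit_mat n i j) ({..<n} \<times> {..<n}))"
  then have ab: "a < n" "b < n"
    by (auto simp: sum_mat_def)
  have "sum_mat n (\<lambda>(i, j). V $$ (i, j) \<cdot>\<^sub>m unit_mat n i j) ({..<n} \<times> {..<n}) $$ (a, b) =
      (\<Sum>p\<in>{..<n} \<times> {..<n}. if p = (a, b) then V $$ p else 0)"
  proof -
    have "(case p of (i, j) \<Rightarrow> V $$ (i, j) \<cdot>\<^sub>m unit_mat n i j) $$ (a, b) =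
        (if p = (a, b) then V $$ p else 0)" for p
      using ab by (cases p) (auto simp: unit_mat_def)
    then show ?thesis
      using ab by (simp add: sum_mat_def)
  qed
  also have "\<dots> = V $$ (a, b)"
    using ab by (subst sum.delta) auto
  finally show "V $$ (a, b) = sum_mat n (\<lambda>(i, j). V $$ (i, j) \<cdot>\<^sub>m unit_mat n i j) ({..<n} \<times> {..<n}) $$ (a, b)" ..
qed (use assms in \<open>auto simp: sum_mat_def\<close>)

lemma mult_unit_mat:
  fixes a :: "'a :: field mat"
  assumes a: "a \<in> carrier_mat n n" and "k < n" "l < n"
  shows "a * unit_mat n k l = sum_mat n (\<lambda>i. a $$ (i, k) \<cdot>\<^sub>m unit_mat n i l) {..<n}"
    and "unit_mat n k l * a = sum_mat n (\<lambda>i. a $$ (l, i) \<cdot>\<^sub>m unit_mat n k i) {..<n}"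
proof -
  show "a * unit_mat n k l = sum_mat n (\<lambda>i. a $$ (i, k) \<cdot>\<^sub>m unit_mat n i l) {..<n}"
  proof (rule eq_matI)
    fix x y assume "x < dim_row (sum_mat n (\<lambda>i. a $$ (i, k) \<cdot>\<^sub>m unit_mat n i l) {..<n})"
      "y < dim_col (sum_mat n (\<lambda>i. a $$ (i, k) \<cdot>\<^sub>m unit_mat n i l) {..<n})"
    then have xy: "x < n" "y < n"
      by (auto simp: sum_mat_def)
    have "(a * unit_mat n k l) $$ (x, y) = (a * unit_mat n k l * 1\<^sub>m n) $$ (x, y)"
      using a by (simp add: square_mult_simps(1)[where n = n])
    also have "\<dots> = a $$ (x, k) * (if l = y then 1 else 0)"
      unfolding index_unit_mat_sandwich[OF a one_carrier_mat assms(2,3) xy] using assms(3) xy by simp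
    also have "\<dots> = (\<Sum>i<n. if i = x then a $$ (i, k) * (if l = y then 1 else 0) else 0)"
      using xy by simp
    also have "\<dots> = (\<Sum>i<n. (a $$ (i, k) \<cdot>\<^sub>m unit_mat n i l) $$ (x, y))"
      using xy by (intro sum.cong refl) (simp add: unit_mat_def)
    also have "\<dots> = sum_mat n (\<lambda>i. a $$ (i, k) \<cdot>\<^sub>m unit_mat n i l) {..<n} $$ (x, y)"
      using xy by (simp add: sum_mat_def)
    finally show "(a * unit_mat n k l) $$ (x, y) = sum_mat n (\<lambda>i. a $$ (i, k) \<cdot>\<^sub>m unit_mat n i l) {..<n} $$ (x, y)" .
  qed (use a in \<open>auto simp: sum_mat_def unit_mat_def\<close>)
  show "unit_mat n k l * a = sum_mat n (\<lambda>i. a $$ (l, i) \<cdot>\<^sub>m unit_mat n k i) {..<n}"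
  proof (rule eq_matI)
    fix x y assume "x < dim_row (sum_mat n (\<lambda>i. a $$ (l, i) \<cdot>\<^sub>m unit_mat n k i) {..<n})"
      "y < dim_col (sum_mat n (\<lambda>i. a $$ (l, i) \<cdot>\<^sub>m unit_mat n k i) {..<n})"
    then have xy: "x < n" "y < n"
      by (auto simp: sum_mat_def)
    have "(unit_mat n k l * a) $$ (x, y) = (1\<^sub>m n * unit_mat n k l * a) $$ (x, y)"
      by simp
    also have "\<dots> = (if k = x then 1 else 0) * a $$ (l, y)"
      unfolding index_unit_mat_sandwich[OF one_carrier_mat a assms(2,3) xy] using assms(2) xy by simp
    also have "\<dots> = (\<Sum>i<n. if i = y then (if k = x then 1 else 0) * a $$ (l, i) else 0)"
      using xy by simp
    also have "\<dots> = (\<Sum>i<n. (a $$ (l, i) \<cdot>\<^sub>m unit_mat n k i) $$ (x, y))"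
      using xy by (intro sum.cong refl) (simp add: unit_mat_def)
    also have "\<dots> = sum_mat n (\<lambda>i. a $$ (l, i) \<cdot>\<^sub>m unit_mat n k i) {..<n} $$ (x, y)"
      using xy by (simp add: sum_mat_def)
    finally show "(unit_mat n k l * a) $$ (x, y) = sum_mat n (\<lambda>i. a $$ (l, i) \<cdot>\<^sub>m unit_mat n k i) {..<n} $$ (x, y)" .
  qed (use a in \<open>auto simp: sum_mat_def unit_mat_def\<close>)
qed

lemma sum_mat_pairs:
  "sum_mat n (\<lambda>l. sum_mat n (\<lambda>k. G k l) J) I = sum_mat n (\<lambda>(k, l). G k l) (J \<times> I)"
proof (rule eq_matI)
  fix i j assume "i < dim_row (sum_mat n (\<lambda>(k, l). G k l) (J \<times> I))" "j < dim_col (sum_mat n (\<lambda>(k, l). G k l) (J \<times> I))"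
  then have ij: "i < n" "j < n"
    by (auto simp: sum_mat_def)
  have "(\<Sum>l\<in>I. \<Sum>k\<in>J. G k l $$ (i, j)) = (\<Sum>(k, l)\<in>J \<times> I. G k l $$ (i, j))"
    by (subst sum.swap) (rule sum.cartesian_product)
  then show "sum_mat n (\<lambda>l. sum_mat n (\<lambda>k. G k l) J) I $$ (i, j) = sum_mat n (\<lambda>(k, l). G k l) (J \<times> I) $$ (i, j)"
    using ij by (simp add: sum_mat_def split_def)
qed (auto simp: sum_mat_def)

lemma sum_unit_mat_trace:
  assumes Y: "Y \<in> carrier_mat n n" and B: "B \<in> carrier_mat n n"
  shows "sum_mat n (\<lambda>(k, l). unit_mat n k l * (Y * unit_mat n l k * B)) ({..<n} \<times> {..<n}) =
    mat_trace Y \<cdot>\<^sub>m B"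
proof (rule eq_matI)
  fix i j assume "i < dim_row (mat_trace Y \<cdot>\<^sub>m B)" "j < dim_col (mat_trace Y \<cdot>\<^sub>m B)"
  then have ij: "i < n" "j < n"
    using B by auto
  have "(unit_mat n k l * (Y * unit_mat n l k * B)) $$ (i, j) = (if k = i then Y $$ (l, l) * B $$ (k, j) else 0)"
    if "k < n" "l < n" for k l
  proof -
    have YB: "Y * unit_mat n l k * B \<in> carrier_mat n n"
      using Y B by (simp add: square_mult_simps(7)[where n = n])
    have "(unit_mat n k l * (Y * unit_mat n l k * B)) $$ (i, j) =
        (1\<^sub>m n * unit_mat n k l * (Y * unit_mat n l k * B)) $$ (i, j)"
      by simp
    also have "\<dots> = 1\<^sub>m n $$ (i, k) * (Y $$ (l, l) * B $$ (k, j))"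
      unfolding index_unit_mat_sandwich[OF one_carrier_mat YB that ij]
        index_unit_mat_sandwich[OF Y B that(2,1,2) ij(2)] ..
    finally show ?thesis
      using that ij by auto
  qed
  then have "sum_mat n (\<lambda>(k, l). unit_mat n k l * (Y * unit_mat n l k * B)) ({..<n} \<times> {..<n}) $$ (i, j) =
      (\<Sum>(k, l)\<in>{..<n} \<times> {..<n}. if k = i then Y $$ (l, l) * B $$ (k, j) else 0)"
    using ij by (auto simp: sum_mat_def split_def intro!: sum.cong)
  also have "\<dots> = (\<Sum>k<n. if k = i then (\<Sum>l<n. Y $$ (l, l)) * B $$ (k, j) else 0)"
    by (subst sum.cartesian_product[symmetric]) (intro sum.cong refl, auto simp: sum_distrib_right)
  also have "\<dots> = (mat_trace Y \<cdot>\<^sub>m B) $$ (i, j)"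
    using ij Y B by (simp add: mat_trace_def sum.delta)
  finally show "sum_mat n (\<lambda>(k, l). unit_mat n k l * (Y * unit_mat n l k * B)) ({..<n} \<times> {..<n}) $$ (i, j) =
      (mat_trace Y \<cdot>\<^sub>m B) $$ (i, j)" .
qed (use B in \<open>auto simp: sum_mat_def\<close>)

section \<open>Polynomials in a matrix and their directional derivative\<close>

definition poly_mat :: "'a :: field poly \<Rightarrow> 'a mat \<Rightarrow> 'a mat" where
  "poly_mat p c =
    fold_coeffs (\<lambda>a M. a \<cdot>\<^sub>m 1\<^sub>m (dim_row c) + c * M) p (0\<^sub>m (dim_row c) (dim_row c))"

text \<open>Horner's scheme over the dual numbers: the second component is the coefficient of \<open>\<epsilon>\<close> in
  \<open>p(c + \<epsilon> g)\<close>.  Equivalently, it is the upper right block of \<open>p\<close> evaluated at the block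
  matrix with rows \<open>c, g\<close> and \<open>0, c\<close>.\<close>

definition poly_diff :: "'a :: field poly \<Rightarrow> 'a mat \<Rightarrow> 'a mat \<Rightarrow> 'a mat" where
  "poly_diff p c g =
    snd (fold_coeffs (\<lambda>a (M, E). (a \<cdot>\<^sub>m 1\<^sub>m (dim_row c) + c * M, g * M + c * E)) p
      (0\<^sub>m (dim_row c) (dim_row c), 0\<^sub>m (dim_row c) (dim_row c)))"

context
  fixes n :: nat and c :: "'a :: field mat"
  assumes c [simp]: "c \<in> carrier_mat n n"
begin

lemma dim_row_c: "dim_row c = n"
  using c by blast

lemma poly_mat_0 [simp]: "poly_mat 0 c = 0\<^sub>m n n"
  by (simp add: poly_mat_def dim_row_c)

lemma poly_mat_pCons: "poly_mat (pCons a p) c = a \<cdot>\<^sub>m 1\<^sub>m n + c * poly_mat p c"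
  by (cases "p = 0 \<and> a = 0") (auto simp: poly_mat_def dim_row_c)

lemma poly_mat_carrier [simp]: "poly_mat p c \<in> carrier_mat n n"
  by (induction p) (auto simp: poly_mat_pCons square_mult_simps[where n = n])

lemma poly_diff_0 [simp]: "poly_diff 0 c g = 0\<^sub>m n n"
  by (simp add: poly_diff_def dim_row_c)

lemma poly_diff_pCons:
  assumes [simp]: "g \<in> carrier_mat n n"
  shows "poly_diff (pCons a p) c g = g * poly_mat p c + c * poly_diff p c g"
proof -
  let ?F = "\<lambda>p. fold_coeffs (\<lambda>a (M, E). (a \<cdot>\<^sub>m 1\<^sub>m (dim_row c) + c * M, g * M + c * E)) p
      (0\<^sub>m (dim_row c) (dim_row c), 0\<^sub>m (dim_row c) (dim_row c))"
  have step: "?F (pCons a p) = (a \<cdot>\<^sub>m 1\<^sub>m n + c * fst (?F p), g * fst (?F p) + c * snd (?F p))" for a p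
    by (cases "p = 0 \<and> a = 0") (auto simp: dim_row_c split: prod.split)
  have "fst (?F p) = poly_mat p c" for p
  proof (induction p)
    case 0
    show ?case by (simp add: dim_row_c)
  next
    case (pCons a p)
    show ?case unfolding step[of a p] fst_conv pCons.IH poly_mat_pCons ..
  qed
  then show ?thesis
    unfolding poly_diff_def step[of a p] by simp
qed

lemma poly_diff_carrier [simp]: "g \<in> carrier_mat n n \<Longrightarrow> poly_diff p c g \<in> carrier_mat n n"
  by (induction p) (auto simp: poly_diff_pCons square_mult_simps[where n = n])

lemma poly_mat_1 [simp]: "poly_mat 1 c = 1\<^sub>m n"
  by (simp add: one_pCons poly_mat_pCons)

lemma poly_mat_linear: "poly_mat [:a, 1:] c = a \<cdot>\<^sub>m 1\<^sub>m n + c"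
  by (simp add: poly_mat_pCons)

lemma poly_diff_linear: "g \<in> carrier_mat n n \<Longrightarrow> poly_diff [:a, 1:] c g = g"
  by (simp add: poly_diff_pCons poly_mat_pCons)

lemma commute_poly_mat:
  assumes [simp]: "a \<in> carrier_mat n n" and "a * c = c * a"
  shows "a * poly_mat p c = poly_mat p c * a"
proof (induction p)
  case (pCons k p)
  have "a * (c * poly_mat p c) = c * (poly_mat p c * a)"
    using square_mult_left_commute[of a n c "poly_mat p c"] assms(2) pCons.IH by simp
  then show ?case
    by (simp add: poly_mat_pCons square_simps[where n = n])
qed (use assms in auto)

lemma poly_mat_add: "poly_mat (p + q) c = poly_mat p c + poly_mat q c"
  by (induction p q rule: poly_induct2)
    (simp_all add: poly_mat_pCons square_simps[where n = n] add_smult_distrib_right_mat[of _ n n])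

lemma poly_mat_smult: "poly_mat (smult k p) c = k \<cdot>\<^sub>m poly_mat p c"
  by (induction p) (simp_all add: poly_mat_pCons square_simps[where n = n] smult_smult_mat)

lemma poly_mat_mult: "poly_mat (p * q) c = poly_mat p c * poly_mat q c"
proof (induction p)
  case (pCons a p)
  then show ?case
    by (simp add: poly_mat_pCons poly_mat_add poly_mat_smult square_simps[where n = n]
       )
qed simp

lemma poly_mat_commute: "poly_mat p c * poly_mat q c = poly_mat q c * poly_mat p c"
  by (simp flip: poly_mat_mult add: mult.commute)

lemma poly_mat_dvd:
  assumes "p dvd q" "poly_mat p c = 0\<^sub>m n n"
  shows "poly_mat q c = 0\<^sub>m n n"
  using assms by (auto simp: poly_mat_mult elim!: dvdE)

lemma poly_diff_add_poly:
  "g \<in> carrier_mat n n \<Longrightarrow> poly_diff (p + q) c g = poly_diff p c g + poly_diff q c g"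
  by (induction p q rule: poly_induct2)
    (simp_all add: poly_diff_pCons poly_mat_add square_simps[where n = n])

lemma poly_diff_smult_poly:
  "g \<in> carrier_mat n n \<Longrightarrow> poly_diff (smult k p) c g = k \<cdot>\<^sub>m poly_diff p c g"
  by (induction p) (simp_all add: poly_diff_pCons poly_mat_smult square_simps[where n = n])

lemma poly_diff_mult_poly:
  assumes [simp]: "g \<in> carrier_mat n n"
  shows "poly_diff (p * q) c g = poly_diff p c g * poly_mat q c + poly_mat p c * poly_diff q c g"
proof (induction p)
  case (pCons a p)
  then show ?case
    by (simp add: poly_diff_pCons poly_mat_pCons poly_diff_add_poly poly_diff_smult_poly
        poly_mat_mult square_simps[where n = n]
        smult_zero_one(2)[of _ n n])
qed simp

lemma poly_diff_add:
  "g \<in> carrier_mat n n \<Longrightarrow> h \<in> carrier_mat n n \<Longrightarrow>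
    poly_diff p c (g + h) = poly_diff p c g + poly_diff p c h"
  by (induction p) (simp_all add: poly_diff_pCons square_simps[where n = n])

lemma poly_diff_smult:
  "g \<in> carrier_mat n n \<Longrightarrow> poly_diff p c (k \<cdot>\<^sub>m g) = k \<cdot>\<^sub>m poly_diff p c g"
  by (induction p) (simp_all add: poly_diff_pCons square_simps[where n = n])

lemma poly_diff_zero [simp]: "poly_diff p c (0\<^sub>m n n) = 0\<^sub>m n n"
  by (induction p) (simp_all add: poly_diff_pCons)

text \<open>With \<open>b\<close> the block matrix with rows \<open>c, g\<close> and \<open>0, c\<close>, both sides are the upper right block of
  \<open>b p(b) = p(b) b\<close>.\<close>

lemma commutator_poly_diff:
  assumes [simp]: "g \<in> carrier_mat n n"
  shows "c * poly_diff p c g + g * poly_mat p c = poly_diff p c g * c + poly_mat p c * g"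
proof (induction p)
  case (pCons a p)
  have comm: "poly_mat p c * c = c * poly_mat p c"
    by (simp add: commute_poly_mat)
  have "c * poly_diff (pCons a p) c g + g * poly_mat (pCons a p) c =
      c * (c * poly_diff p c g + g * poly_mat p c) + (a \<cdot>\<^sub>m g + g * (c * poly_mat p c))"
    by (simp add: poly_diff_pCons poly_mat_pCons square_simps[where n = n])
  also have "\<dots> = poly_diff (pCons a p) c g * c + poly_mat (pCons a p) c * g"
    unfolding pCons.IH
    by (simp add: poly_diff_pCons poly_mat_pCons square_simps[where n = n] comm)
  finally show ?case .
qed simp

lemma poly_diff_central:
  assumes [simp]: "g \<in> carrier_mat n n" and "poly_mat q c = 0\<^sub>m n n"
  shows "poly_diff q c g * c = c * poly_diff q c g"
  using commutator_poly_diff[OF assms(1), of q] assms(2)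
  by (simp add: square_mult_simps[where n = n])

lemma poly_diff_commute_left:
  assumes [simp]: "a \<in> carrier_mat n n" "g \<in> carrier_mat n n" and "a * c = c * a"
  shows "poly_diff p c (a * g) = a * poly_diff p c g"
proof (induction p)
  case (pCons k p)
  have "c * (a * poly_diff p c g) = a * (c * poly_diff p c g)"
    using square_mult_left_commute[of c n a "poly_diff p c g"] assms(3) by simp
  then show ?case
    by (simp add: poly_diff_pCons pCons.IH square_simps[where n = n])
qed simp

lemma poly_diff_commute_right:
  assumes [simp]: "a \<in> carrier_mat n n" "g \<in> carrier_mat n n" and "a * c = c * a"
  shows "poly_diff p c (g * a) = poly_diff p c g * a"
proof (induction p)
  case (pCons k p)
  show ?case
    by (simp add: poly_diff_pCons pCons.IH commute_poly_mat[OF assms(1,3)] square_simps[where n = n])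
qed simp

lemma poly_diff_one: "poly_diff p c (1\<^sub>m n) = poly_mat (pderiv p) c"
  by (induction p)
    (simp_all add: poly_diff_pCons pderiv_pCons poly_mat_add poly_mat_pCons
      square_mult_simps[where n = n])

text \<open>The Bezoutian \<open>(p(x) - p(y)) / (x - y)\<close> is symmetric in its variables, and moving a factor around the
  trace exchanges left and right multiplication by \<open>c\<close>.\<close>

lemma mat_trace_poly_diff:
  assumes g [simp]: "g \<in> carrier_mat n n" and "h \<in> carrier_mat n n"
  shows "mat_trace (poly_diff p c g * h) = mat_trace (g * poly_diff p c h)"
  using assms(2)
proof (induction p arbitrary: h)
  case (pCons a p)
  note [simp] = pCons.prems
  have "mat_trace (poly_diff (pCons a p) c g * h) =
      mat_trace (g * (poly_mat p c * h)) + mat_trace (c * (poly_diff p c g * h))"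
    by (simp add: poly_diff_pCons square_simps[where n = n] mat_trace_add[where n = n])
  also have "mat_trace (c * (poly_diff p c g * h)) = mat_trace (poly_diff p c g * (h * c))"
    by (subst mat_trace_comm[where n = n]) (simp_all add: square_simps[where n = n])
  also have "\<dots> = mat_trace (g * (poly_diff p c h * c))"
    by (subst pCons.IH) (simp_all add: square_simps[where n = n] poly_diff_commute_right)
  also have "mat_trace (g * (poly_mat p c * h)) + \<dots> =
      mat_trace (g * (poly_diff p c h * c + poly_mat p c * h))"
    by (simp add: square_simps[where n = n] mat_trace_add[where n = n])
  also have "poly_diff p c h * c + poly_mat p c * h = poly_diff (pCons a p) c h"
    using commutator_poly_diff[of h p] square_add_ac(1)[of "h * poly_mat p c" n "c * poly_diff p c h"]
    by (simp add: poly_diff_pCons square_mult_simps(7)[where n = n])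
  finally show ?case .
qed simp

end

lemma poly_diff_sum_mat:
  assumes c: "c \<in> carrier_mat n n" and "finite I" "\<And>x. x \<in> I \<Longrightarrow> f x \<in> carrier_mat n n"
  shows "poly_diff p c (sum_mat n f I) = sum_mat n (\<lambda>x. poly_diff p c (f x)) I"
  using assms(2,3)
proof (induction I)
  case (insert x I)
  then show ?case
    using poly_diff_add[OF c, of "f x" "sum_mat n f I" p] poly_diff_carrier[OF c, of "f x" p]
    by (simp add: sum_mat_insert)
qed (simp add: poly_diff_zero[OF c])


section \<open>Extension of the base field\<close>

lemma (in field_hom) map_mat_smult: "map_mat hom (k \<cdot>\<^sub>m A) = hom k \<cdot>\<^sub>m map_mat hom A"
  by (rule eq_matI) (auto simp: hom_distribs)

lemma (in field_hom) map_mat_add: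
  "A \<in> carrier_mat n n \<Longrightarrow> B \<in> carrier_mat n n \<Longrightarrow>
    map_mat hom (A + B) = map_mat hom A + map_mat hom B"
  by (rule eq_matI) (auto simp: hom_distribs)

lemma (in field_hom) map_mat_0 [simp]: "map_mat hom (0\<^sub>m n m) = 0\<^sub>m n m"
  by (rule eq_matI) auto

lemma (in field_hom) poly_mat_map:
  assumes [simp]: "c \<in> carrier_mat n n"
  shows "poly_mat (map_poly hom p) (map_mat hom c) = map_mat hom (poly_mat p c)"
proof (induction p)
  case 0
  then show ?case by (simp add: poly_mat_0[where n = n] map_mat_0)
next
  case (pCons a p)
  then show ?case
    by (simp add: poly_mat_pCons[where n = n] map_poly_pCons_hom map_mat_add[where n = n] map_mat_smult
        mat_hom_one mat_hom_mult[of _ n n _ n] square_mult_simps[where n = n])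
qed

lemma (in field_hom) poly_diff_map:
  assumes [simp]: "c \<in> carrier_mat n n" "g \<in> carrier_mat n n"
  shows "poly_diff (map_poly hom p) (map_mat hom c) (map_mat hom g) = map_mat hom (poly_diff p c g)"
proof (induction p)
  case 0
  then show ?case by (simp add: poly_diff_0[where n = n] map_mat_0)
next
  case (pCons a p)
  then show ?case
    by (simp add: poly_diff_pCons[where n = n] map_poly_pCons_hom map_mat_add[where n = n]
        poly_mat_map[where n = n] mat_hom_mult[of _ n n _ n] square_mult_simps[where n = n])
qed

text \<open>Applied entrywise, such a \<open>\<rho>\<close> sends a solution of a linear system with coefficients in the base field
  to a solution over the base field.  All descent arguments below have this form; the lemmas of the
  locale say that the equations in question are linear with coefficients in the base field.\<close>

locale linear_functional = field_hom hom for hom :: "'a :: field \<Rightarrow> 'b :: field" +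
  fixes \<rho> :: "'b \<Rightarrow> 'a"
  assumes add: "\<rho> (x + y) = \<rho> x + \<rho> y"
    and scale: "\<rho> (hom r * x) = r * \<rho> x"
begin

lemma zero [simp]: "\<rho> 0 = 0"
  using scale[of 0 0] by simp

lemma scale': "\<rho> (x * hom r) = r * \<rho> x"
  using scale[of r x] by (simp add: mult.commute)

lemma sum: "\<rho> (sum f A) = (\<Sum>x\<in>A. \<rho> (f x))"
  by (induction A rule: infinite_finite_induct) (simp_all add: add)

lemma map_mat_mult_left:
  assumes "A \<in> carrier_mat n n" "B \<in> carrier_mat n n"
  shows "map_mat \<rho> (map_mat hom A * B) = A * map_mat \<rho> B"
proof (rule eq_matI)
  fix i j assume "i < dim_row (A * map_mat \<rho> B)" "j < dim_col (A * map_mat \<rho> B)"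
  then have ij: "i < n" "j < n"
    using assms by auto
  have "map_mat \<rho> (map_mat hom A * B) $$ (i, j) = \<rho> ((map_mat hom A * B) $$ (i, j))"
    using assms ij by (simp del: index_mult_mat(1))
  also have "\<dots> = (\<Sum>k<n. A $$ (i, k) * \<rho> (B $$ (k, j)))"
    using assms ij by (subst index_mult_square[where n = n]) (auto simp: sum scale)
  also have "\<dots> = (A * map_mat \<rho> B) $$ (i, j)"
    using assms ij by (subst index_mult_square[where n = n]) auto
  finally show "map_mat \<rho> (map_mat hom A * B) $$ (i, j) = (A * map_mat \<rho> B) $$ (i, j)" .
qed (use assms in auto)

lemma map_mat_mult_right:
  assumes "A \<in> carrier_mat n n" "B \<in> carrier_mat n n"
  shows "map_mat \<rho> (B * map_mat hom A) = map_mat \<rho> B * A"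
proof (rule eq_matI)
  fix i j assume "i < dim_row (map_mat \<rho> B * A)" "j < dim_col (map_mat \<rho> B * A)"
  then have ij: "i < n" "j < n"
    using assms by auto
  have "map_mat \<rho> (B * map_mat hom A) $$ (i, j) = \<rho> ((B * map_mat hom A) $$ (i, j))"
    using assms ij by (simp del: index_mult_mat(1))
  also have "\<dots> = (\<Sum>k<n. \<rho> (B $$ (i, k)) * A $$ (k, j))"
    using assms ij by (subst index_mult_square[where n = n]) (auto simp: sum scale' mult.commute)
  also have "\<dots> = (map_mat \<rho> B * A) $$ (i, j)"
    using assms ij by (subst index_mult_square[where n = n]) auto
  finally show "map_mat \<rho> (B * map_mat hom A) $$ (i, j) = (map_mat \<rho> B * A) $$ (i, j)" .
qed (use assms in auto)

lemma map_mat_plus: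
  "A \<in> carrier_mat n n \<Longrightarrow> B \<in> carrier_mat n n \<Longrightarrow>
    map_mat \<rho> (A + B) = map_mat \<rho> A + map_mat \<rho> B"
  by (rule eq_matI) (auto simp: add)

lemma map_mat_smult_one: "map_mat \<rho> (a \<cdot>\<^sub>m 1\<^sub>m n) = \<rho> a \<cdot>\<^sub>m 1\<^sub>m n"
  by (rule eq_matI) auto

lemma map_mat_zero [simp]: "map_mat \<rho> (0\<^sub>m n m) = 0\<^sub>m n m"
  by (rule eq_matI) auto

lemma mat_trace_map: "A \<in> carrier_mat n n \<Longrightarrow> mat_trace (map_mat \<rho> A) = \<rho> (mat_trace A)"
  by (auto simp: mat_trace_def sum)

lemma map_mat_poly_mat:
  assumes [simp]: "c \<in> carrier_mat n n"
  shows "map_mat \<rho> (poly_mat p (map_mat hom c)) = poly_mat (map_poly \<rho> p) c"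
proof (induction p)
  case 0
  then show ?case by (simp add: poly_mat_0[where n = n])
next
  case (pCons a p)
  then show ?case
    by (simp add: poly_mat_pCons[where n = n] map_poly_pCons map_mat_plus[where n = n] map_mat_smult_one
        map_mat_mult_left[where n = n] square_mult_simps[where n = n])
qed

lemma map_mat_poly_diff:
  assumes [simp]: "c \<in> carrier_mat n n" "g \<in> carrier_mat n n"
  shows "map_mat \<rho> (poly_diff (map_poly hom p) (map_mat hom c) g) = poly_diff p c (map_mat \<rho> g)"
proof (induction p)
  case 0
  then show ?case by (simp add: poly_diff_0[where n = n])
next
  case (pCons a p)
  then show ?case
    by (simp add: poly_diff_pCons[where n = n] poly_mat_map[where n = n] map_poly_pCons_hom
        map_mat_plus[where n = n] map_mat_mult_left[where n = n] map_mat_mult_right[where n = n]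
        square_mult_simps[where n = n])
qed

end

text \<open>Value \<open>1\<close> at \<open>1\<close> is what inhomogeneous equations need; other points serve to show that an element
  of the extension is zero when all functionals kill it.\<close>

lemma (in field_hom) exists_linear_functional:
  assumes "x \<noteq> 0"
  shows "\<exists>\<rho>. linear_functional hom \<rho> \<and> \<rho> x = 1"
proof -
  let ?s = "\<lambda>r y. hom r * y"
  interpret vector_space_pair "(*) :: 'a \<Rightarrow> 'a \<Rightarrow> 'a" ?s
    by unfold_locales (simp_all add: algebra_simps hom_distribs)
  have "Vector_Spaces.linear (*) ?s (\<lambda>r. hom r * x)"
    by unfold_locales (simp_all add: algebra_simps hom_distribs)
  moreover have "inj_on (\<lambda>r. hom r * x) UNIV"
    using assms by (auto simp: inj_on_def)
  ultimately obtain \<rho> where lin: "Vector_Spaces.linear ?s (*) \<rho>"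
    and inv: "\<And>r. \<rho> (hom r * x) = r"
    using linear_exists_left_inverse_on[OF _ vs1.subspace_UNIV] by blast
  interpret \<rho>: Vector_Spaces.linear ?s "(*)" \<rho> by (fact lin)
  have "linear_functional hom \<rho>"
    by unfold_locales (simp_all add: \<rho>.add \<rho>.scale)
  then show ?thesis
    using inv[of 1] by auto
qed


section \<open>Similarity and direct sums\<close>

context
  fixes n :: nat and P Q :: "'a :: field mat"
  assumes PQ [simp]: "P \<in> carrier_mat n n" "Q \<in> carrier_mat n n" "P * Q = 1\<^sub>m n" "Q * P = 1\<^sub>m n"
begin

lemma conj_mult:
  assumes [simp]: "A \<in> carrier_mat n n" "B \<in> carrier_mat n n"
  shows "(P * A * Q) * (P * B * Q) = P * (A * B) * Q"
proof -
  have "Q * (P * (B * Q)) = (Q * P) * (B * Q)"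
    by (rule assoc_mult_mat[symmetric, of _ n n _ n _ n]) (simp_all add: square_mult_simps[where n = n])
  then show ?thesis
    by (simp add: square_mult_simps[where n = n])
qed

lemma conj_add: "A \<in> carrier_mat n n \<Longrightarrow> B \<in> carrier_mat n n \<Longrightarrow>
    P * A * Q + P * B * Q = P * (A + B) * Q"
  by (simp add: square_mult_simps[where n = n])

lemma conj_poly_mat:
  assumes [simp]: "c \<in> carrier_mat n n"
  shows "poly_mat p (P * c * Q) = P * poly_mat p c * Q"
proof (induction p)
  case 0
  then show ?case by (simp add: poly_mat_0[where n = n] square_mult_simps[where n = n])
next
  case (pCons a p)
  have "poly_mat (pCons a p) (P * c * Q) = P * (a \<cdot>\<^sub>m 1\<^sub>m n) * Q + (P * c * Q) * (P * poly_mat p c * Q)"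
    unfolding poly_mat_pCons[where n = n, OF square_mult_simps(7)[OF square_mult_simps(7)[OF PQ(1) assms] PQ(2)]] pCons.IH
    by (simp add: square_mult_simps[where n = n])
  also have "\<dots> = P * (a \<cdot>\<^sub>m 1\<^sub>m n + c * poly_mat p c) * Q"
    by (subst conj_mult) (simp_all add: conj_add square_mult_simps(7)[where n = n] poly_mat_carrier[where n = n])
  finally show ?case
    by (simp add: poly_mat_pCons[where n = n])
qed

lemma conj_poly_diff:
  assumes [simp]: "c \<in> carrier_mat n n" "g \<in> carrier_mat n n"
  shows "poly_diff p (P * c * Q) (P * g * Q) = P * poly_diff p c g * Q"
proof (induction p)
  case 0
  then show ?case by (simp add: poly_diff_0[where n = n] square_mult_simps[where n = n])
next
  case (pCons a p)
  have carr: "P * c * Q \<in> carrier_mat n n" "P * g * Q \<in> carrier_mat n n"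
    by (simp_all add: square_mult_simps(7)[where n = n])
  have "poly_diff (pCons a p) (P * c * Q) (P * g * Q) =
      (P * g * Q) * (P * poly_mat p c * Q) + (P * c * Q) * (P * poly_diff p c g * Q)"
    unfolding poly_diff_pCons[OF carr] pCons.IH conj_poly_mat[OF assms(1)] ..
  also have "\<dots> = P * (g * poly_mat p c + c * poly_diff p c g) * Q"
    by (simp add: conj_mult conj_add square_mult_simps(7)[where n = n] poly_mat_carrier[where n = n]
        poly_diff_carrier[where n = n])
  finally show ?case
    by (simp add: poly_diff_pCons[where n = n])
qed

end

abbreviation direct_sum :: "'a :: field mat \<Rightarrow> 'a mat \<Rightarrow> 'a mat" where
  "direct_sum A B \<equiv>
    four_block_mat A (0\<^sub>m (dim_row A) (dim_row B)) (0\<^sub>m (dim_row B) (dim_row A)) B"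

context
  fixes n m :: nat
begin

lemma direct_sum_carrier:
  "A \<in> carrier_mat n n \<Longrightarrow> B \<in> carrier_mat m m \<Longrightarrow> direct_sum A B \<in> carrier_mat (n + m) (n + m)"
  by auto

lemma direct_sum_mult:
  assumes "A \<in> carrier_mat n n" "A' \<in> carrier_mat n n" "B \<in> carrier_mat m m" "B' \<in> carrier_mat m m"
  shows "direct_sum A B * direct_sum A' B' = direct_sum (A * A') (B * B')"
proof -
  have [simp]: "dim_row A = n" "dim_row A' = n" "dim_row B = m" "dim_row B' = m"
    using assms by auto
  show ?thesis
    by (subst mult_four_block_mat[of A n n _ m _ m B A' n _ m _ B'])
      (use assms in auto)
qed

lemma direct_sum_add:
  assumes "A \<in> carrier_mat n n" "A' \<in> carrier_mat n n" "B \<in> carrier_mat m m" "B' \<in> carrier_mat m m"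
  shows "direct_sum A B + direct_sum A' B' = direct_sum (A + A') (B + B')"
  using assms by (intro eq_matI) auto

lemma direct_sum_smult_one: "k \<cdot>\<^sub>m 1\<^sub>m (n + m) = direct_sum (k \<cdot>\<^sub>m 1\<^sub>m n) (k \<cdot>\<^sub>m 1\<^sub>m m)"
  by (rule eq_matI) auto

lemma direct_sum_zero: "0\<^sub>m (n + m) (n + m) = direct_sum (0\<^sub>m n n) (0\<^sub>m m m)"
  by (rule eq_matI) auto

lemma direct_sum_eq_iff:
  assumes "A \<in> carrier_mat n n" "A' \<in> carrier_mat n n" "B \<in> carrier_mat m m" "B' \<in> carrier_mat m m"
  shows "direct_sum A B = direct_sum A' B' \<longleftrightarrow> A = A' \<and> B = B'"
proof
  assume eq: "direct_sum A B = direct_sum A' B'"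
  have "A $$ (i, j) = A' $$ (i, j)" if "i < n" "j < n" for i j
    using arg_cong[OF eq, of "\<lambda>M. M $$ (i, j)"] that assms by auto
  moreover have "B $$ (i, j) = B' $$ (i, j)" if "i < m" "j < m" for i j
    using arg_cong[OF eq, of "\<lambda>M. M $$ (n + i, n + j)"] that assms by auto
  ultimately show "A = A' \<and> B = B'"
    using assms by (auto intro!: eq_matI)
qed auto

lemma direct_sum_poly_mat:
  assumes [simp]: "A \<in> carrier_mat n n" "B \<in> carrier_mat m m"
  shows "poly_mat p (direct_sum A B) = direct_sum (poly_mat p A) (poly_mat p B)"
proof (induction p)
  case 0
  then show ?case
    by (simp add: poly_mat_0[OF direct_sum_carrier[OF assms]] poly_mat_0[OF assms(1)]
        poly_mat_0[OF assms(2)] direct_sum_zero del: four_block_zero_mat)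
next
  case (pCons a p)
  show ?case
    unfolding poly_mat_pCons[OF direct_sum_carrier[OF assms]] poly_mat_pCons[OF assms(1)]
      poly_mat_pCons[OF assms(2)] pCons.IH direct_sum_smult_one
      direct_sum_mult[OF assms(1) poly_mat_carrier[OF assms(1)] assms(2) poly_mat_carrier[OF assms(2)]]
    by (rule direct_sum_add)
      (simp_all add: poly_mat_carrier[OF assms(1)] poly_mat_carrier[OF assms(2)]
        square_mult_simps(7)[where n = n] square_mult_simps(7)[where n = m])
qed

lemma direct_sum_poly_diff:
  assumes [simp]: "A \<in> carrier_mat n n" "B \<in> carrier_mat m m" "g \<in> carrier_mat n n" "h \<in> carrier_mat m m"
  shows "poly_diff p (direct_sum A B) (direct_sum g h) = direct_sum (poly_diff p A g) (poly_diff p B h)"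
proof (induction p)
  case 0
  then show ?case
    by (simp add: poly_diff_0[OF direct_sum_carrier[OF assms(1,2)]] poly_diff_0[OF assms(1)]
        poly_diff_0[OF assms(2)] direct_sum_zero del: four_block_zero_mat)
next
  case (pCons a p)
  note [simp] = poly_mat_carrier[OF assms(1)] poly_mat_carrier[OF assms(2)]
    poly_diff_carrier[OF assms(1)] poly_diff_carrier[OF assms(2)]
  show ?case
    unfolding poly_diff_pCons[OF direct_sum_carrier[OF assms(1,2)] direct_sum_carrier[OF assms(3,4)]]
      poly_diff_pCons[OF assms(1,3)] poly_diff_pCons[OF assms(2,4)] pCons.IH direct_sum_poly_mat[OF assms(1,2)]
      direct_sum_mult[OF assms(1) poly_diff_carrier[OF assms(1,3)] assms(2) poly_diff_carrier[OF assms(2,4)]]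
      direct_sum_mult[OF assms(3) poly_mat_carrier[OF assms(1)] assms(4) poly_mat_carrier[OF assms(2)]]
    by (rule direct_sum_add)
      (simp_all add: square_mult_simps(7)[where n = n] square_mult_simps(7)[where n = m])
qed

end


section \<open>Polynomials in a Jordan matrix\<close>

lemma poly_mat_linear_power_jordan_block:
  "poly_mat ([:- \<mu>, 1:] ^ i) (jordan_block k \<mu>) = jordan_block k 0 ^\<^sub>m i"
proof (induction i)
  case 0
  then show ?case by (simp add: poly_mat_1[where n = k])
next
  case (Suc i)
  have "poly_mat [:- \<mu>, 1:] (jordan_block k \<mu>) = jordan_block k 0"
    by (simp add: poly_mat_linear[where n = k]) (rule eq_matI, auto)
  then show ?case
    by (subst power_Suc2, subst poly_mat_mult[where n = k]) (simp_all add: Suc)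
qed

lemma poly_mat_jordan_block_eq_0:
  "[:- \<mu>, 1:] ^ k dvd p \<Longrightarrow> poly_mat p (jordan_block k \<mu>) = 0\<^sub>m k k"
  by (rule poly_mat_dvd[of _ k "[:- \<mu>, 1:] ^ k"])
    (auto simp: poly_mat_linear_power_jordan_block jordan_block_zero_pow intro!: eq_matI)

text \<open>The Bezout identity is lifted one power at a time: subtracting a multiple of \<open>r\<close> from \<open>t\<close> makes
  \<open>t\<close> vanish at \<open>\<mu>\<close>, so that it gives off one more linear factor.\<close>

lemma bezout_linear_power:
  fixes r :: "'a :: field poly"
  assumes "poly r \<mu> \<noteq> 0"
  shows "\<exists>s t. r * s + [:- \<mu>, 1:] ^ k * t = 1"
proof (induction k)
  case 0
  show ?case by (intro exI[of _ 0] exI[of _ 1]) simp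
next
  case (Suc k)
  then obtain s t where st: "r * s + [:- \<mu>, 1:] ^ k * t = 1"
    by blast
  define \<alpha> where "\<alpha> = poly t \<mu> / poly r \<mu>"
  have "poly (t - smult \<alpha> r) \<mu> = 0"
    using assms by (simp add: \<alpha>_def)
  then obtain t' where t': "t - smult \<alpha> r = [:- \<mu>, 1:] * t'"
    unfolding poly_eq_0_iff_dvd dvd_def by blast
  have "r * (s + smult \<alpha> ([:- \<mu>, 1:] ^ k)) + [:- \<mu>, 1:] ^ k * (t - smult \<alpha> r) = 1"
    using st by (simp add: algebra_simps)
  then show ?case
    unfolding t' by - (rule exI[of _ "s + smult \<alpha> ([:- \<mu>, 1:] ^ k)"], rule exI[of _ t'],
      simp only: power_Suc2 mult.assoc)
qed

lemma poly_mat_jordan_block_inverse: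
  assumes "poly r \<mu> \<noteq> (0 :: 'a :: field)"
  obtains s where "poly_mat r (jordan_block k \<mu>) * poly_mat s (jordan_block k \<mu>) = 1\<^sub>m k"
proof -
  obtain s t where st: "r * s + [:- \<mu>, 1:] ^ k * t = 1"
    using bezout_linear_power[OF assms] by blast
  have "1\<^sub>m k = poly_mat (r * s + [:- \<mu>, 1:] ^ k * t) (jordan_block k \<mu>)"
    unfolding st by (simp add: poly_mat_1[where n = k])
  also have "\<dots> = poly_mat (r * s) (jordan_block k \<mu>)"
    by (simp only: poly_mat_add[OF jordan_block_carrier])
      (simp add: poly_mat_jordan_block_eq_0 poly_mat_carrier[where n = k])
  also have "\<dots> = poly_mat r (jordan_block k \<mu>) * poly_mat s (jordan_block k \<mu>)"
    by (rule poly_mat_mult[OF jordan_block_carrier])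
  finally show ?thesis
    using that by metis
qed

lemma poly_mat_jordan_block_eq_0_iff:
  "poly_mat p (jordan_block k \<mu>) = 0\<^sub>m k k \<longleftrightarrow> [:- \<mu>, 1:] ^ k dvd p"
proof
  let ?J = "jordan_block k \<mu>" and ?u = "[:- \<mu>, 1:]"
  assume zero: "poly_mat p ?J = 0\<^sub>m k k"
  show "?u ^ k dvd p"
  proof (cases "p = 0")
    case False
    obtain r where r: "p = ?u ^ order \<mu> p * r" "\<not> ?u dvd r"
      using order_decomp[OF False] by blast
    obtain s where s: "poly_mat r ?J * poly_mat s ?J = 1\<^sub>m k"
      using poly_mat_jordan_block_inverse[of r \<mu> k] r(2) by (auto simp: poly_eq_0_iff_dvd)
    note [simp] = poly_mat_carrier[OF jordan_block_carrier]
    have "0\<^sub>m k k = poly_mat (?u ^ order \<mu> p) ?J * poly_mat r ?J * poly_mat s ?J"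
      using zero by (subst (asm) r(1), subst (asm) poly_mat_mult[of _ k]) simp_all
    also have "\<dots> = jordan_block k 0 ^\<^sub>m order \<mu> p"
      using s by (simp add: square_mult_simps(1)[where n = k])
        (simp add: poly_mat_linear_power_jordan_block)
    finally have nil: "jordan_block k 0 ^\<^sub>m order \<mu> p = (0\<^sub>m k k :: 'a mat)" ..
    have "k \<le> order \<mu> p"
    proof (rule ccontr)
      assume "\<not> k \<le> order \<mu> p"
      then show False
        using arg_cong[OF nil, of "\<lambda>M. M $$ (0, order \<mu> p)"] by (simp add: jordan_block_zero_pow)
    qed
    then show ?thesis
      using order_divides by blast
  qed simp
qed (rule poly_mat_jordan_block_eq_0)

text \<open>The left hand side is the sum of \<open>N^a g N^b\<close> over \<open>a + b = i - 1\<close>, where \<open>N\<close> is the nilpotent Jordan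
  block.  With \<open>g\<close> the matrix unit in the lower left corner each summand is a matrix unit, and together
  they fill a diagonal, which is the main one for \<open>i = k\<close>.\<close>

lemma poly_diff_linear_power_jordan_block:
  fixes \<mu> :: "'a :: field"
  assumes "i \<le> k" "0 < k"
  shows "poly_diff ([:- \<mu>, 1:] ^ i) (jordan_block k \<mu>) (unit_mat k (k - 1) 0) =
    mat k k (\<lambda>(a, b). if a + i = k + b then 1 else 0)"
  using assms(1)
proof (induction i)
  case 0
  have "poly_diff 1 (jordan_block k \<mu>) (unit_mat k (k - 1) 0) = 0\<^sub>m k k"
    by (simp add: one_pCons poly_diff_pCons[where n = k] poly_diff_0[where n = k] poly_mat_0[where n = k])
  then show ?case by auto
next
  case (Suc i)
  let ?J = "jordan_block k \<mu>" and ?u = "[:- \<mu>, 1:]" and ?g = "unit_mat k (k - 1) 0 :: 'a mat"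
  let ?N = "jordan_block k (0 :: 'a)"
  let ?M = "mat k k (\<lambda>(a, b). if a + i = k + b then 1 else 0 :: 'a)"
  have lin: "poly_mat ?u ?J = ?N"
    using poly_mat_linear_power_jordan_block[of \<mu> 1 k] by simp
  have "poly_diff (?u ^ Suc i) ?J ?g = ?g * (?N ^\<^sub>m i) + ?N * ?M"
    using Suc
    by (simp only: power_Suc, subst poly_diff_mult_poly[where n = k])
      (simp_all add: poly_diff_linear[where n = k] poly_mat_linear_power_jordan_block lin)
  also have "\<dots> = mat k k (\<lambda>(a, b). if a + Suc i = k + b then 1 else 0)"
  proof (rule eq_matI)
    fix a b assume "a < dim_row (mat k k (\<lambda>(a, b). if a + Suc i = k + b then 1 else 0))"
      "b < dim_col (mat k k (\<lambda>(a, b). if a + Suc i = k + b then 1 else 0))"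
    then have ab: "a < k" "b < k" by auto
    have "(?g * (?N ^\<^sub>m i)) $$ (a, b) =
        (\<Sum>l<k. if l = 0 then if a = k - 1 \<and> b = i then 1 else 0 else 0)"
      using ab
      by (subst index_mult_square[OF _ _ ab], simp, simp, intro sum.cong refl)
        (auto simp: unit_mat_def jordan_block_zero_pow)
    also have "\<dots> = (if a = k - 1 \<and> b = i then 1 else 0)"
      using ab by (simp add: sum.delta)
    finally have 1: "(?g * (?N ^\<^sub>m i)) $$ (a, b) = (if a = k - 1 \<and> b = i then 1 else 0)" .
    have "(?N * ?M) $$ (a, b) =
        (\<Sum>l<k. if l = Suc a then if l + i = k + b then 1 else 0 else 0)"
      using ab by (subst index_mult_square[OF _ _ ab], simp, simp, intro sum.cong refl) auto
    also have "\<dots> = (if Suc a < k \<and> a + Suc i = k + b then 1 else 0)"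
      using ab by (simp add: sum.delta)
    finally have 2: "(?N * ?M) $$ (a, b) = (if Suc a < k \<and> a + Suc i = k + b then 1 else 0)" .
    show "(?g * (?N ^\<^sub>m i) + ?N * ?M) $$ (a, b) =
        mat k k (\<lambda>(a, b). if a + Suc i = k + b then 1 else 0) $$ (a, b)"
      using ab 1 2 by (simp del: index_mult_mat(1)) auto
  qed auto
  finally show ?case .
qed

text \<open>By the product rule a cofactor \<open>r\<close> of the linear power only multiplies the derivative by \<open>r(J)\<close>, because
  the other summand contains the vanishing power.  If \<open>r(\<mu>)\<close> is nonzero, \<open>r(J)\<close> can be inverted
  inside the direction \<open>g\<close>.\<close>

lemma poly_diff_jordan_block_one:
  assumes "q = [:- \<mu>, 1:] ^ k * r" "poly r \<mu> \<noteq> 0" "0 < k"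
  shows "\<exists>g\<in>carrier_mat k k. poly_diff q (jordan_block k \<mu>) g = 1\<^sub>m k"
proof -
  let ?J = "jordan_block k \<mu>" and ?u = "[:- \<mu>, 1:]" and ?g = "unit_mat k (k - 1) 0 :: 'a mat"
  note [simp] = poly_mat_carrier[OF jordan_block_carrier] poly_diff_carrier[OF jordan_block_carrier]
  obtain s where s: "poly_mat r ?J * poly_mat s ?J = 1\<^sub>m k"
    using poly_mat_jordan_block_inverse[OF assms(2)] by blast
  have g: "?g * poly_mat s ?J \<in> carrier_mat k k"
    by (simp add: square_mult_simps(7)[where n = k])
  have one: "poly_diff (?u ^ k) ?J ?g = 1\<^sub>m k"
    using poly_diff_linear_power_jordan_block[of k k \<mu>] assms(3) by (auto intro!: eq_matI)
  have s_comm: "poly_mat s ?J * ?J = ?J * poly_mat s ?J"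
    by (rule commute_poly_mat[of ?J k ?J s, symmetric]) simp_all
  have "poly_diff q ?J (?g * poly_mat s ?J) = poly_diff (?u ^ k) ?J (?g * poly_mat s ?J) * poly_mat r ?J"
    unfolding assms(1) poly_diff_mult_poly[OF jordan_block_carrier g]
    using g by (simp add: poly_mat_jordan_block_eq_0 square_mult_simps(7)[where n = k])
  also have "\<dots> = 1\<^sub>m k"
    using s by (subst poly_diff_commute_right[OF jordan_block_carrier])
      (simp_all add: s_comm one poly_mat_commute[OF jordan_block_carrier, of s] del: One_nat_def)
  finally show ?thesis
    using g by blast
qed

text \<open>A generalized inverse of \<open>J - \<nu>\<close>: the transposed shift if \<open>\<nu>\<close> is the eigenvalue, and the inverse
  otherwise.\<close>

lemma jordan_block_regular:
  "\<exists>S\<in>carrier_mat k k. let D = poly_mat [:- \<nu>, 1:] (jordan_block k \<mu>) in D * S * D = D"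
proof (cases "\<mu> = \<nu>")
  case True
  let ?N = "jordan_block k (0 :: 'a)"
  let ?S = "mat k k (\<lambda>(i, j). if i = Suc j then 1 else 0 :: 'a)"
  have D: "poly_mat [:- \<nu>, 1:] (jordan_block k \<mu>) = ?N"
    using poly_mat_linear_power_jordan_block[of \<mu> 1 k] True by simp
  have "(?N * ?S) = mat k k (\<lambda>(i, j). if i = j \<and> Suc i < k then 1 else 0)" (is "_ = ?E")
  proof (rule eq_matI)
    fix i j assume "i < dim_row ?E" "j < dim_col ?E"
    then have ij: "i < k" "j < k" by auto
    have "(?N * ?S) $$ (i, j) = (\<Sum>l<k. if l = Suc i then if i = j then 1 else 0 else 0)"
      using ij by (subst index_mult_square[OF _ _ ij], simp, simp, intro sum.cong refl) auto
    then show "(?N * ?S) $$ (i, j) = ?E $$ (i, j)"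
      using ij by (simp add: sum.delta)
  qed auto
  moreover have "?E * ?N = ?N"
  proof (rule eq_matI)
    fix i j assume "i < dim_row ?N" "j < dim_col ?N"
    then have ij: "i < k" "j < k" by auto
    have "(?E * ?N) $$ (i, j) = (\<Sum>l<k. if l = i then if Suc i < k \<and> Suc i = j then 1 else 0 else 0)"
      using ij by (subst index_mult_square[OF _ _ ij], simp, simp, intro sum.cong refl) auto
    then show "(?E * ?N) $$ (i, j) = ?N $$ (i, j)"
      using ij by (auto simp: sum.delta)
  qed auto
  ultimately show ?thesis
    unfolding D Let_def by (intro bexI[of _ ?S]) auto
next
  case False
  let ?D = "poly_mat [:- \<nu>, 1:] (jordan_block k \<mu>)"
  obtain s where "?D * poly_mat s (jordan_block k \<mu>) = 1\<^sub>m k"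
    using poly_mat_jordan_block_inverse[of "[:- \<nu>, 1:]" \<mu> k] False by auto
  then show ?thesis
    unfolding Let_def
    by (intro bexI[of _ "poly_mat s (jordan_block k \<mu>)"]) (simp_all add: poly_mat_carrier[where n = k])
qed

text \<open>The matrix unit in the upper left corner projects onto the eigenvector of the block.  It certifies
  that this eigenvector is outside the range of \<open>p(J)\<close> whenever \<open>p\<close> vanishes on the block.\<close>

lemma jordan_block_eigenidempotent:
  fixes \<mu> :: "'a :: field"
  assumes "0 < k"
  shows "\<exists>W\<in>carrier_mat k k. W \<noteq> 0\<^sub>m k k \<and> W * W = W \<and>
    poly_mat [:- \<mu>, 1:] (jordan_block k \<mu>) * W = 0\<^sub>m k k \<and>
    (\<forall>p. [:- \<mu>, 1:] ^ k dvd p \<longrightarrow> W * poly_mat p (jordan_block k \<mu>) = 0\<^sub>m k k)"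
proof (intro bexI[of _ "unit_mat k 0 0"] conjI allI impI)
  let ?W = "unit_mat k 0 0 :: 'a mat"
  show "?W \<noteq> 0\<^sub>m k k"
  proof
    assume "?W = 0\<^sub>m k k"
    then have "?W $$ (0, 0) = 0\<^sub>m k k $$ (0, 0)"
      by (rule arg_cong)
    then show False
      using assms by (simp add: unit_mat_def)
  qed
  show "?W * ?W = ?W"
  proof (rule eq_matI)
    fix i j assume "i < dim_row ?W" "j < dim_col ?W"
    then have ij: "i < k" "j < k" by (auto simp: unit_mat_def)
    have "(?W * ?W) $$ (i, j) = (\<Sum>l<k. if l = 0 then if i = 0 \<and> j = 0 then 1 else 0 else 0)"
      unfolding index_mult_square[OF unit_mat_carrier unit_mat_carrier ij]
      using ij by (intro sum.cong refl) (auto simp: unit_mat_def)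
    then show "(?W * ?W) $$ (i, j) = ?W $$ (i, j)"
      using ij by (auto simp: sum.delta unit_mat_def)
  qed (auto simp: unit_mat_def)
  have D: "poly_mat [:- \<mu>, 1:] (jordan_block k \<mu>) = jordan_block k 0"
    using poly_mat_linear_power_jordan_block[of \<mu> 1 k] by simp
  show "poly_mat [:- \<mu>, 1:] (jordan_block k \<mu>) * ?W = 0\<^sub>m k k"
  proof (rule eq_matI)
    fix i j assume "i < dim_row (0\<^sub>m k k :: 'a mat)" "j < dim_col (0\<^sub>m k k :: 'a mat)"
    then have ij: "i < k" "j < k" by auto
    have "(jordan_block k 0 * ?W) $$ (i, j) = 0"
      using ij by (subst index_mult_square[where n = k]) (auto simp: unit_mat_def intro!: sum.neutral)
    then show "(poly_mat [:- \<mu>, 1:] (jordan_block k \<mu>) * ?W) $$ (i, j) = 0\<^sub>m k k $$ (i, j)"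
      unfolding D using ij by simp
  qed (auto simp: unit_mat_def D)
  show "?W * poly_mat p (jordan_block k \<mu>) = 0\<^sub>m k k" if "[:- \<mu>, 1:] ^ k dvd p" for p
    using poly_mat_jordan_block_eq_0[OF that] by simp
qed simp


lemma jordan_matrix_direct_sum:
  "jordan_matrix ((k, \<mu>) # xs) = direct_sum (jordan_block k \<mu>) (jordan_matrix xs)"
  by (simp add: jordan_matrix_Cons)

lemma poly_mat_jordan_matrix:
  "poly_mat p (jordan_matrix ((k, \<mu>) # xs)) =
    direct_sum (poly_mat p (jordan_block k \<mu>)) (poly_mat p (jordan_matrix xs))"
  unfolding jordan_matrix_direct_sum
  by (rule direct_sum_poly_mat[OF jordan_block_carrier jordan_matrix_carrier])

lemma poly_mat_jordan_matrix_eq_0_iff: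
  "poly_mat p (jordan_matrix xs) = 0\<^sub>m (sum_list (map fst xs)) (sum_list (map fst xs)) \<longleftrightarrow>
    (\<forall>(k, \<mu>)\<in>set xs. [:- \<mu>, 1:] ^ k dvd p)"
proof (induction xs)
  case Nil
  have "poly_mat p (jordan_matrix []) \<in> carrier_mat 0 0"
    using poly_mat_carrier[OF jordan_matrix_carrier[of "[]"], of p] by simp
  then show ?case by auto
next
  case (Cons x xs)
  obtain k \<mu> where x: "x = (k, \<mu>)" by force
  let ?N = "sum_list (map fst xs)"
  have "poly_mat p (jordan_matrix (x # xs)) = 0\<^sub>m (k + ?N) (k + ?N) \<longleftrightarrow>
      poly_mat p (jordan_block k \<mu>) = 0\<^sub>m k k \<and> poly_mat p (jordan_matrix xs) = 0\<^sub>m ?N ?N"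
    unfolding x poly_mat_jordan_matrix direct_sum_zero
    by (rule direct_sum_eq_iff[OF poly_mat_carrier[OF jordan_block_carrier] zero_carrier_mat
          poly_mat_carrier[OF jordan_matrix_carrier] zero_carrier_mat])
  then show ?case
    using Cons.IH by (simp add: x poly_mat_jordan_block_eq_0_iff)
qed

lemma poly_diff_jordan_matrix_one:
  assumes "\<And>k \<mu>. (k, \<mu>) \<in> set xs \<Longrightarrow> 0 < k \<and> (\<exists>r. q = [:- \<mu>, 1:] ^ k * r \<and> poly r \<mu> \<noteq> 0)"
  shows "\<exists>g\<in>carrier_mat (sum_list (map fst xs)) (sum_list (map fst xs)).
    poly_diff q (jordan_matrix xs) g = 1\<^sub>m (sum_list (map fst xs))"
  using assms
proof (induction xs)
  case Nil
  have "poly_diff q (jordan_matrix []) (1\<^sub>m 0) \<in> carrier_mat 0 0"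
    using poly_diff_carrier[OF jordan_matrix_carrier[of "[]"], of "1\<^sub>m 0" q] by simp
  then show ?case
    by (intro bexI[of _ "1\<^sub>m 0"]) auto
next
  case (Cons x xs)
  obtain k \<mu> where x: "x = (k, \<mu>)" by force
  let ?N = "sum_list (map fst xs)"
  obtain g where g: "g \<in> carrier_mat k k" "poly_diff q (jordan_block k \<mu>) g = 1\<^sub>m k"
    using Cons.prems[of k \<mu>] poly_diff_jordan_block_one[of q \<mu> k] by (auto simp: x)
  obtain h where h: "h \<in> carrier_mat ?N ?N" "poly_diff q (jordan_matrix xs) h = 1\<^sub>m ?N"
    using Cons.IH Cons.prems by fastforce
  have "poly_diff q (jordan_matrix (x # xs)) (direct_sum g h) = direct_sum (1\<^sub>m k) (1\<^sub>m ?N)"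
    unfolding x jordan_matrix_direct_sum using g h
    by (subst direct_sum_poly_diff[OF jordan_block_carrier jordan_matrix_carrier]) auto
  then show ?case
    using direct_sum_carrier[OF g(1) h(1)] unfolding x by (intro bexI[of _ "direct_sum g h"]) auto
qed

lemma jordan_matrix_regular:
  "\<exists>S\<in>carrier_mat (sum_list (map fst xs)) (sum_list (map fst xs)).
    let D = poly_mat [:- \<nu>, 1:] (jordan_matrix xs) in D * S * D = D"
proof (induction xs)
  case Nil
  have "poly_mat [:- \<nu>, 1:] (jordan_matrix []) \<in> carrier_mat 0 0"
    using poly_mat_carrier[OF jordan_matrix_carrier[of "[]"]] by simp
  then show ?case
    unfolding Let_def by (intro bexI[of _ "1\<^sub>m 0"] eq_matI) auto
next
  case (Cons x xs)
  obtain k \<mu> where x: "x = (k, \<mu>)" by force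
  let ?N = "sum_list (map fst xs)"
  let ?D = "poly_mat [:- \<nu>, 1:] (jordan_block k \<mu>)" and ?E = "poly_mat [:- \<nu>, 1:] (jordan_matrix xs)"
  obtain S where S: "S \<in> carrier_mat k k" "?D * S * ?D = ?D"
    using jordan_block_regular[of k \<nu> \<mu>] unfolding Let_def by blast
  obtain T where T: "T \<in> carrier_mat ?N ?N" "?E * T * ?E = ?E"
    using Cons.IH unfolding Let_def by blast
  note carr = poly_mat_carrier[OF jordan_block_carrier] poly_mat_carrier[OF jordan_matrix_carrier]
  have "direct_sum ?D ?E * direct_sum S T * direct_sum ?D ?E = direct_sum ?D ?E"
    unfolding direct_sum_mult[OF carr(1) S(1) carr(2) T(1)]
      direct_sum_mult[OF square_mult_simps(7)[OF carr(1) S(1)] carr(1)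
        square_mult_simps(7)[OF carr(2) T(1)] carr(2)] S(2) T(2) ..
  then show ?case
    using direct_sum_carrier[OF S(1) T(1)]
    unfolding x poly_mat_jordan_matrix Let_def by (intro bexI[of _ "direct_sum S T"]) auto
qed

lemma jordan_matrix_eigenidempotent:
  assumes "(k, \<mu>) \<in> set xs" "0 < k"
  shows "let N = sum_list (map fst xs); J = jordan_matrix xs in \<exists>W\<in>carrier_mat N N.
    W \<noteq> 0\<^sub>m N N \<and> W * W = W \<and> poly_mat [:- \<mu>, 1:] J * W = 0\<^sub>m N N \<and>
    (\<forall>p. [:- \<mu>, 1:] ^ k dvd p \<longrightarrow> W * poly_mat p J = 0\<^sub>m N N)"
  using assms(1)
proof (induction xs)
  case (Cons x xs)
  obtain l \<nu> where x: "x = (l, \<nu>)" by force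
  let ?N = "sum_list (map fst xs)"
  note carr = poly_mat_carrier[OF jordan_block_carrier] poly_mat_carrier[OF jordan_matrix_carrier]
  show ?case
  proof (cases "(k, \<mu>) \<in> set xs")
    case True
    then obtain W where W: "W \<in> carrier_mat ?N ?N" "W \<noteq> 0\<^sub>m ?N ?N" "W * W = W"
      "poly_mat [:- \<mu>, 1:] (jordan_matrix xs) * W = 0\<^sub>m ?N ?N"
      "\<And>p. [:- \<mu>, 1:] ^ k dvd p \<Longrightarrow> W * poly_mat p (jordan_matrix xs) = 0\<^sub>m ?N ?N"
      using Cons.IH unfolding Let_def by blast
    let ?W = "direct_sum (0\<^sub>m l l) W"
    have "?W \<noteq> 0\<^sub>m (l + ?N) (l + ?N)"
      unfolding direct_sum_zero using W(1,2) by (subst direct_sum_eq_iff[of _ l _ _ ?N]) auto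
    moreover have "?W * ?W = ?W"
      using W(1,3) by (subst direct_sum_mult[of _ l _ _ ?N]) auto
    moreover have "poly_mat [:- \<mu>, 1:] (jordan_matrix (x # xs)) * ?W = 0\<^sub>m (l + ?N) (l + ?N)"
      unfolding x poly_mat_jordan_matrix direct_sum_zero
      using W carr by (subst direct_sum_mult[of _ l _ _ ?N]) (auto simp del: four_block_zero_mat)
    moreover have "?W * poly_mat p (jordan_matrix (x # xs)) = 0\<^sub>m (l + ?N) (l + ?N)"
      if "[:- \<mu>, 1:] ^ k dvd p" for p
      unfolding x poly_mat_jordan_matrix direct_sum_zero
      using W(1) W(5)[OF that] carr by (subst direct_sum_mult[of _ l _ _ ?N]) (auto simp del: four_block_zero_mat)
    moreover have "?W \<in> carrier_mat (l + ?N) (l + ?N)"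
      by (rule direct_sum_carrier) (use W in auto)
    ultimately show ?thesis
      unfolding Let_def x by (intro bexI[of _ ?W]) simp_all
  next
    case False
    then have [simp]: "l = k" "\<nu> = \<mu>"
      using Cons.prems x by auto
    obtain W where W: "W \<in> carrier_mat k k" "W \<noteq> 0\<^sub>m k k" "W * W = W"
      "poly_mat [:- \<mu>, 1:] (jordan_block k \<mu>) * W = 0\<^sub>m k k"
      "\<And>p. [:- \<mu>, 1:] ^ k dvd p \<Longrightarrow> W * poly_mat p (jordan_block k \<mu>) = 0\<^sub>m k k"
      using jordan_block_eigenidempotent[OF assms(2), of \<mu>] by blast
    let ?W = "direct_sum W (0\<^sub>m ?N ?N)"
    have "?W \<noteq> 0\<^sub>m (k + ?N) (k + ?N)"
      unfolding direct_sum_zero using W(1,2) by (subst direct_sum_eq_iff[of _ k _ _ ?N]) auto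
    moreover have "?W * ?W = ?W"
      using W(1,3) by (subst direct_sum_mult[of _ k _ _ ?N]) auto
    moreover have "poly_mat [:- \<mu>, 1:] (jordan_matrix (x # xs)) * ?W = 0\<^sub>m (k + ?N) (k + ?N)"
      unfolding x poly_mat_jordan_matrix direct_sum_zero
      using W carr by (subst direct_sum_mult[of _ k _ _ ?N]) (auto simp del: four_block_zero_mat)
    moreover have "?W * poly_mat p (jordan_matrix (x # xs)) = 0\<^sub>m (k + ?N) (k + ?N)"
      if "[:- \<mu>, 1:] ^ k dvd p" for p
      unfolding x poly_mat_jordan_matrix direct_sum_zero
      using W(1) W(5)[OF that] carr by (subst direct_sum_mult[of _ k _ _ ?N]) (auto simp del: four_block_zero_mat)
    moreover have "?W \<in> carrier_mat (k + ?N) (k + ?N)"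
      by (rule direct_sum_carrier) (use W in auto)
    ultimately show ?thesis
      unfolding Let_def x by (intro bexI[of _ ?W]) simp_all
  qed
qed simp

context
  fixes n :: nat and C :: "'a :: field mat" and xs :: "(nat \<times> 'a) list"
  assumes C [simp]: "C \<in> carrier_mat n n" and jnf: "jordan_nf C xs"
begin

lemma jordan_nf_conj:
  obtains P Q where "P \<in> carrier_mat n n" "Q \<in> carrier_mat n n" "P * Q = 1\<^sub>m n" "Q * P = 1\<^sub>m n"
    "C = P * jordan_matrix xs * Q" "n = sum_list (map fst xs)"
proof -
  obtain P Q where wit: "similar_mat_wit C (jordan_matrix xs) P Q"
    using jnf unfolding jordan_nf_def similar_mat_def by blast
  note wit = similar_mat_witD2[OF C wit]
  have "n = sum_list (map fst xs)"
    using carrier_matD(1)[OF wit(5)] by simp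
  then show ?thesis
    using that wit by blast
qed

lemma jordan_nf_pos: "(k, \<mu>) \<in> set xs \<Longrightarrow> 0 < k"
  using jnf by (force simp: jordan_nf_def)

lemma poly_mat_jordan_nf_eq_0_iff:
  "poly_mat p C = 0\<^sub>m n n \<longleftrightarrow> (\<forall>(k, \<mu>)\<in>set xs. [:- \<mu>, 1:] ^ k dvd p)"
proof -
  obtain P Q where PQ: "P \<in> carrier_mat n n" "Q \<in> carrier_mat n n" "P * Q = 1\<^sub>m n" "Q * P = 1\<^sub>m n"
    and CJ: "C = P * jordan_matrix xs * Q" and N: "n = sum_list (map fst xs)"
    by (rule jordan_nf_conj)
  have J: "jordan_matrix xs \<in> carrier_mat n n"
    unfolding N by simp
  let ?M = "poly_mat p (jordan_matrix xs)"
  have M: "?M \<in> carrier_mat n n"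
    by (rule poly_mat_carrier[OF J])
  have "Q * (P * ?M * Q) * P = (Q * P) * ?M * (Q * P)"
    using PQ(1,2) M by (simp add: square_mult_simps[where n = n])
  then have "P * ?M * Q = 0\<^sub>m n n \<longleftrightarrow> ?M = 0\<^sub>m n n"
    using PQ M by (auto simp: square_mult_simps(7)[where n = n])
  then show ?thesis
    unfolding CJ conj_poly_mat[OF PQ J] using poly_mat_jordan_matrix_eq_0_iff[of p xs] N by simp
qed

lemma poly_diff_jordan_nf_one:
  assumes "\<And>k \<mu>. (k, \<mu>) \<in> set xs \<Longrightarrow> \<exists>r. q = [:- \<mu>, 1:] ^ k * r \<and> poly r \<mu> \<noteq> 0"
  shows "\<exists>g\<in>carrier_mat n n. poly_diff q C g = 1\<^sub>m n"
proof -
  obtain P Q where PQ: "P \<in> carrier_mat n n" "Q \<in> carrier_mat n n" "P * Q = 1\<^sub>m n" "Q * P = 1\<^sub>m n"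
    and CJ: "C = P * jordan_matrix xs * Q" and N: "n = sum_list (map fst xs)"
    by (rule jordan_nf_conj)
  have J: "jordan_matrix xs \<in> carrier_mat n n"
    unfolding N by simp
  obtain g where g: "g \<in> carrier_mat n n" "poly_diff q (jordan_matrix xs) g = 1\<^sub>m n"
    using poly_diff_jordan_matrix_one[of xs q, folded N] assms jordan_nf_pos by meson
  have "poly_diff q C (P * g * Q) = 1\<^sub>m n"
    unfolding CJ conj_poly_diff[OF PQ J g(1)] g(2) using PQ by simp
  then show ?thesis
    using PQ g by (intro bexI[of _ "P * g * Q"]) (simp_all add: square_mult_simps(7)[where n = n])
qed

lemma jordan_nf_regular:
  obtains S where "S \<in> carrier_mat n n"
    "poly_mat [:- \<nu>, 1:] C * S * poly_mat [:- \<nu>, 1:] C = poly_mat [:- \<nu>, 1:] C"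
proof -
  obtain P Q where PQ: "P \<in> carrier_mat n n" "Q \<in> carrier_mat n n" "P * Q = 1\<^sub>m n" "Q * P = 1\<^sub>m n"
    and CJ: "C = P * jordan_matrix xs * Q" and N: "n = sum_list (map fst xs)"
    by (rule jordan_nf_conj)
  have J: "jordan_matrix xs \<in> carrier_mat n n"
    unfolding N by simp
  let ?D = "poly_mat [:- \<nu>, 1:] (jordan_matrix xs)"
  have D: "?D \<in> carrier_mat n n"
    by (rule poly_mat_carrier[OF J])
  obtain S where S: "S \<in> carrier_mat n n" "?D * S * ?D = ?D"
    using jordan_matrix_regular[of xs \<nu>, folded N] unfolding Let_def by blast
  have DS: "?D * S \<in> carrier_mat n n"
    by (rule square_mult_simps(7)[OF D S(1)])
  have "P * ?D * Q * (P * S * Q) * (P * ?D * Q) = P * ?D * Q"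
    unfolding conj_mult[OF PQ D S(1)] conj_mult[OF PQ DS D] S(2) ..
  then show ?thesis
    unfolding CJ conj_poly_mat[OF PQ J]
    using PQ S by (intro that[of "P * S * Q"]) (simp_all add: square_mult_simps(7)[where n = n] CJ conj_poly_mat[OF PQ J])
qed

lemma jordan_nf_eigenidempotent:
  assumes "(k, \<mu>) \<in> set xs"
  obtains W where "W \<in> carrier_mat n n" "W \<noteq> 0\<^sub>m n n" "W * W = W"
    "poly_mat [:- \<mu>, 1:] C * W = 0\<^sub>m n n"
    "\<And>p. [:- \<mu>, 1:] ^ k dvd p \<Longrightarrow> W * poly_mat p C = 0\<^sub>m n n"
proof -
  obtain P Q where PQ: "P \<in> carrier_mat n n" "Q \<in> carrier_mat n n" "P * Q = 1\<^sub>m n" "Q * P = 1\<^sub>m n"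
    and CJ: "C = P * jordan_matrix xs * Q" and N: "n = sum_list (map fst xs)"
    by (rule jordan_nf_conj)
  have J: "jordan_matrix xs \<in> carrier_mat n n"
    unfolding N by simp
  obtain W where W: "W \<in> carrier_mat n n" "W \<noteq> 0\<^sub>m n n" "W * W = W"
    "poly_mat [:- \<mu>, 1:] (jordan_matrix xs) * W = 0\<^sub>m n n"
    "\<And>p. [:- \<mu>, 1:] ^ k dvd p \<Longrightarrow> W * poly_mat p (jordan_matrix xs) = 0\<^sub>m n n"
    using jordan_matrix_eigenidempotent[OF assms jordan_nf_pos[OF assms], folded N]
    unfolding Let_def N[symmetric] by blast
  note pm = conj_poly_mat[OF PQ J, folded CJ] and [simp] = poly_mat_carrier[OF J]
  have zero: "P * 0\<^sub>m n n * Q = 0\<^sub>m n n"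
    using PQ by simp
  show ?thesis
  proof (rule that[of "P * W * Q"])
    show "P * W * Q \<in> carrier_mat n n"
      using PQ W by (simp add: square_mult_simps(7)[where n = n])
    show "P * W * Q \<noteq> 0\<^sub>m n n"
    proof
      assume zero: "P * W * Q = 0\<^sub>m n n"
      have "W = (Q * P) * W * (Q * P)"
        using PQ W by simp
      also have "\<dots> = Q * (P * W * Q) * P"
        using PQ(1,2) W(1) by (simp add: square_mult_simps[where n = n])
      also have "\<dots> = 0\<^sub>m n n"
        unfolding zero using PQ by simp
      finally show False
        using W(2) by contradiction
    qed
    show "P * W * Q * (P * W * Q) = P * W * Q"
      unfolding conj_mult[OF PQ W(1) W(1)] W(3) ..
    show "poly_mat [:- \<mu>, 1:] C * (P * W * Q) = 0\<^sub>m n n"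
      unfolding pm conj_mult[OF PQ poly_mat_carrier[OF J] W(1)] W(4) zero ..
    show "P * W * Q * poly_mat p C = 0\<^sub>m n n" if "[:- \<mu>, 1:] ^ k dvd p" for p
      unfolding pm conj_mult[OF PQ W(1) poly_mat_carrier[OF J]] W(5)[OF that] zero ..
  qed
qed

end


section \<open>The minimal polynomial and the sizes of the Jordan blocks\<close>

context
  fixes hom :: "'a :: field \<Rightarrow> 'b :: field" and n :: nat and c :: "'a mat" and xs :: "(nat \<times> 'b) list"
  assumes hom: "field_hom hom" and c [simp]: "c \<in> carrier_mat n n"
    and jnf: "jordan_nf (map_mat hom c) xs"
begin

interpretation field_hom hom by (rule hom)

abbreviation (input) "c_ext \<equiv> map_mat hom c"

lemma c_ext [simp]: "c_ext \<in> carrier_mat n n"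
  by simp

text \<open>Minimality is demanded among annihilating polynomials over the extension, so that polynomials such
  as the quotient of \<open>q\<close> by a linear factor may be compared with \<open>q\<close>.\<close>

definition is_min_poly :: "'a poly \<Rightarrow> bool" where
  "is_min_poly q \<longleftrightarrow> q \<noteq> 0 \<and> poly_mat q c = 0\<^sub>m n n \<and>
    (\<forall>p. p \<noteq> 0 \<longrightarrow> poly_mat p c_ext = 0\<^sub>m n n \<longrightarrow> degree q \<le> degree p)"

text \<open>Take an annihilating polynomial of least degree over the extension and descend it with a functional
  that does not kill its leading coefficient; this preserves the degree.\<close>

lemma exists_min_poly: "\<exists>q. is_min_poly q"
proof -
  let ?P = "\<lambda>p. p \<noteq> 0 \<and> poly_mat p c_ext = 0\<^sub>m n n"
  have "[:- \<mu>, 1:] ^ k dvd (\<Prod>(k, \<mu>)\<leftarrow>xs. [:- \<mu>, 1:] ^ k)" if "(k, \<mu>) \<in> set xs" for k \<mu>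
    using that by (induction xs) auto
  moreover have "(\<Prod>(k, \<mu>)\<leftarrow>xs. [:- \<mu>, 1:] ^ k) \<noteq> 0"
    by (induction xs) auto
  ultimately have ex: "?P (\<Prod>(k, \<mu>)\<leftarrow>xs. [:- \<mu>, 1:] ^ k)"
    unfolding poly_mat_jordan_nf_eq_0_iff[OF c_ext jnf] by blast
  define p where "p = arg_min degree ?P"
  have p: "?P p" and min: "\<And>p'. ?P p' \<Longrightarrow> degree p \<le> degree p'"
    using arg_min_natI[of ?P, OF ex, of degree] arg_min_nat_le[of ?P _ degree] unfolding p_def by blast+
  obtain \<rho> where \<rho>: "linear_functional hom \<rho>" "\<rho> (lead_coeff p) = 1"
    using exists_linear_functional[of "lead_coeff p"] p by auto
  interpret \<rho>: linear_functional hom \<rho> by (rule \<rho>(1))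
  have "coeff (map_poly \<rho> p) (degree p) = 1"
    using \<rho>(2) by (simp add: coeff_map_poly)
  then have "degree (map_poly \<rho> p) = degree p" "map_poly \<rho> p \<noteq> 0"
    by (auto intro!: antisym le_degree map_poly_degree_leq)
  moreover have "poly_mat (map_poly \<rho> p) c = 0\<^sub>m n n"
    using \<rho>.map_mat_poly_mat[OF c, of p] p by simp
  ultimately have "is_min_poly (map_poly \<rho> p)"
    unfolding is_min_poly_def using min by auto
  then show ?thesis ..
qed

context
  fixes q :: "'a poly"
  assumes q: "is_min_poly q"
begin

abbreviation (input) "q_ext \<equiv> map_poly hom q"

lemma q_ext: "q_ext \<noteq> 0" "poly_mat q_ext c_ext = 0\<^sub>m n n" "degree q_ext = degree q"
  using q poly_mat_map[OF c, of q] by (auto simp: is_min_poly_def)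

lemma min_poly_annihilates: "poly_mat q c = 0\<^sub>m n n"
  using q by (simp add: is_min_poly_def)

lemma proper_divisor_not_annihilating:
  assumes "q_ext = [:- \<mu>, 1:] * r"
  shows "poly_mat r c_ext \<noteq> 0\<^sub>m n n"
proof
  assume zero: "poly_mat r c_ext = 0\<^sub>m n n"
  have "r \<noteq> 0"
    using assms q_ext(1) by auto
  moreover from this have "degree q_ext = Suc (degree r)"
    unfolding assms by (subst degree_mult_eq) auto
  ultimately show False
    using q zero q_ext(3) unfolding is_min_poly_def by force
qed

lemma block_dvd: "(k, \<mu>) \<in> set xs \<Longrightarrow> [:- \<mu>, 1:] ^ k dvd q_ext"
  using q_ext(2) unfolding poly_mat_jordan_nf_eq_0_iff[OF c_ext jnf] by auto

text \<open>If the multiplicity of a root exceeded the sizes of all its blocks, a linear factor could be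
  cancelled and the quotient would still annihilate \<open>c\<close>.\<close>

lemma order_le_block:
  assumes "poly q_ext \<mu> = 0"
  obtains k where "(k, \<mu>) \<in> set xs" "order \<mu> q_ext \<le> k"
proof (rule ccontr)
  note witness = that
  assume contra: "\<not> thesis"
  have less: "k < order \<mu> q_ext" if "(k, \<mu>) \<in> set xs" for k
    using witness[OF that] contra by (meson not_le)
  obtain r where r: "q_ext = [:- \<mu>, 1:] * r"
    using assms unfolding poly_eq_0_iff_dvd dvd_def by blast
  have "r \<noteq> 0"
    using r q_ext(1) by auto
  have "[:- \<nu>, 1:] ^ k dvd r" if k: "(k, \<nu>) \<in> set xs" for k \<nu>
  proof -
    have "order \<nu> q_ext = order \<nu> [:- \<mu>, 1:] + order \<nu> r"
      using q_ext(1) unfolding r by (rule order_mult)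
    moreover have "order \<nu> [:- \<mu>, 1:] = (if \<nu> = \<mu> then 1 else 0)"
      using order_power_n_n[of \<mu> 1] order_0I[of "[:- \<mu>, 1:]" \<nu>] by auto
    moreover have "k \<le> order \<nu> q_ext"
      using block_dvd[OF k] q_ext(1) order_divides by blast
    ultimately have "k \<le> order \<nu> r"
      using less[of k] k by (auto split: if_splits)
    then show ?thesis
      using order_divides by blast
  qed
  then have "poly_mat r c_ext = 0\<^sub>m n n"
    unfolding poly_mat_jordan_nf_eq_0_iff[OF c_ext jnf] by blast
  then show False
    using proper_divisor_not_annihilating[OF r] by blast
qed

lemma exact_block_factor:
  assumes "\<And>k k' \<mu>. (k, \<mu>) \<in> set xs \<Longrightarrow> (k', \<mu>) \<in> set xs \<Longrightarrow> k = k'" and k: "(k, \<mu>) \<in> set xs"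
  shows "\<exists>r. q_ext = [:- \<mu>, 1:] ^ k * r \<and> poly r \<mu> \<noteq> 0"
proof -
  have "[:- \<mu>, 1:] dvd [:- \<mu>, 1:] ^ k"
    using jordan_nf_pos[OF c_ext jnf k] by (intro dvd_power) simp
  then have "poly q_ext \<mu> = 0"
    unfolding poly_eq_0_iff_dvd using block_dvd[OF k] dvd_trans by blast
  then obtain k' where "(k', \<mu>) \<in> set xs" "order \<mu> q_ext \<le> k'"
    by (rule order_le_block)
  then have "order \<mu> q_ext \<le> k"
    using assms by blast
  moreover have "k \<le> order \<mu> q_ext"
    using block_dvd[OF k] q_ext(1) order_divides by blast
  ultimately have "order \<mu> q_ext = k"
    by simp
  then show ?thesis
    using order_decomp[OF q_ext(1), of \<mu>] unfolding poly_eq_0_iff_dvd by blast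
qed

text \<open>The hypothesis makes every block as large as the multiplicity of its eigenvalue, so the Jordan
  form provides a solution over the extension.\<close>

lemma poly_diff_one_descends:
  assumes "\<And>k k' \<mu>. (k, \<mu>) \<in> set xs \<Longrightarrow> (k', \<mu>) \<in> set xs \<Longrightarrow> k = k'"
  shows "\<exists>g\<in>carrier_mat n n. poly_diff q c g = 1\<^sub>m n"
proof -
  obtain g where g: "g \<in> carrier_mat n n" "poly_diff q_ext c_ext g = 1\<^sub>m n"
    using poly_diff_jordan_nf_one[OF c_ext jnf, of q_ext, OF exact_block_factor] assms by blast
  obtain \<rho> where \<rho>: "linear_functional hom \<rho>" "\<rho> 1 = 1"
    using exists_linear_functional[of 1] by auto
  interpret \<rho>: linear_functional hom \<rho> by (rule \<rho>(1))
  have "poly_diff q c (map_mat \<rho> g) = map_mat \<rho> (1\<^sub>m n)"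
    using \<rho>.map_mat_poly_diff[OF c g(1), of q] g(2) by simp
  also have "\<dots> = 1\<^sub>m n"
    using \<rho>(2) by (intro eq_matI) auto
  finally show ?thesis
    using g(1) by (intro bexI[of _ "map_mat \<rho> g"]) auto
qed

end

section \<open>Nondegenerate trace forms force equal block sizes\<close>

text \<open>The radical of the form over the extension is cut out by equations over the base field.  A nonzero
  entry of \<open>f\<close> would survive under a suitable functional and give a nonzero element of the radical over
  the base field.\<close>

lemma nondegenerate_extends:
  fixes f :: "'b mat"
  assumes g: "g \<in> carrier_mat n n"
    and nondeg: "\<And>a. a \<in> carrier_mat n n \<Longrightarrow> a * c = c * a \<Longrightarrow>
      (\<And>m. m \<in> carrier_mat n n \<Longrightarrow> m * c = c * m \<Longrightarrow> mat_trace (a * (m * g)) = 0) \<Longrightarrow> a = 0\<^sub>m n n"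
    and f: "f \<in> carrier_mat n n" "f * c_ext = c_ext * f"
    and zero: "\<And>m. m \<in> carrier_mat n n \<Longrightarrow> m * c = c * m \<Longrightarrow>
      mat_trace (f * (map_mat hom m * map_mat hom g)) = 0"
  shows "f = 0\<^sub>m n n"
proof (rule ccontr)
  assume "f \<noteq> 0\<^sub>m n n"
  then obtain i j where ij: "i < n" "j < n" "f $$ (i, j) \<noteq> 0"
    using f(1) by (metis carrier_matD eq_matI index_zero_mat)
  obtain \<rho> where \<rho>: "linear_functional hom \<rho>" "\<rho> (f $$ (i, j)) = 1"
    using exists_linear_functional[OF ij(3)] by blast
  interpret \<rho>: linear_functional hom \<rho> by (rule \<rho>(1))
  have "map_mat \<rho> f = 0\<^sub>m n n"
  proof (rule nondeg)
    show "map_mat \<rho> f * c = c * map_mat \<rho> f"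
      using arg_cong[OF f(2), of "map_mat \<rho>"]
      unfolding \<rho>.map_mat_mult_left[OF c f(1)] \<rho>.map_mat_mult_right[OF c f(1)] .
    fix m assume m: "m \<in> carrier_mat n n" "m * c = c * m"
    have mg: "m * g \<in> carrier_mat n n"
      by (rule square_mult_simps(7)[OF m(1) g])
    have "map_mat \<rho> f * (m * g) = map_mat \<rho> (f * (map_mat hom m * map_mat hom g))"
      unfolding \<rho>.map_mat_mult_right[OF mg f(1), symmetric] using m(1) g by (simp add: mat_hom_mult)
    then show "mat_trace (map_mat \<rho> f * (m * g)) = 0"
      using zero[OF m] \<rho>.mat_trace_map[of "f * (map_mat hom m * map_mat hom g)" n] f(1) m(1) g
      by (simp add: square_mult_simps(7)[where n = n])
  qed (use f(1) in simp)
  then have "map_mat \<rho> f $$ (i, j) = 0"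
    using ij by simp
  then show False
    using \<rho>(2) ij f(1) by simp
qed

end

lemma eigenmatrix_commute:
  fixes f C :: "'a :: field mat"
  assumes [simp]: "f \<in> carrier_mat n n" "C \<in> carrier_mat n n"
    and Df: "(k \<cdot>\<^sub>m 1\<^sub>m n + C) * f = 0\<^sub>m n n" and fD: "f * (k \<cdot>\<^sub>m 1\<^sub>m n + C) = 0\<^sub>m n n"
  shows "f * C = C * f"
proof (rule square_add_left_cancel[of "k \<cdot>\<^sub>m f" n])
  have "(k \<cdot>\<^sub>m 1\<^sub>m n + C) * f = k \<cdot>\<^sub>m f + C * f"
    by (simp add: square_mult_simps(2)[where n = n] square_mult_simps(4)[where n = n])
  moreover have "f * (k \<cdot>\<^sub>m 1\<^sub>m n + C) = k \<cdot>\<^sub>m f + f * C"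
    by (simp add: square_mult_simps(3)[where n = n] square_mult_simps(5)[where n = n])
  ultimately show "k \<cdot>\<^sub>m f + f * C = k \<cdot>\<^sub>m f + C * f"
    using Df fD by simp
qed (simp_all add: square_mult_simps(7)[where n = n])

text \<open>The multiplicity of \<open>\<mu>\<close> in the minimal polynomial is shown to be the size of each of its blocks.
  The argument runs with square matrices whose columns are vectors of the eigenspace, the kernel of
  \<open>?D\<close>.\<close>

lemma nondegenerate_imp_equal_blocks:
  fixes hom :: "'a :: field \<Rightarrow> 'b :: field"
  assumes hom: "field_hom hom" and c [simp]: "c \<in> carrier_mat n n"
    and jnf: "jordan_nf (map_mat hom c) xs"
    and g: "g \<in> carrier_mat n n"
    and nondeg: "\<And>a. a \<in> carrier_mat n n \<Longrightarrow> a * c = c * a \<Longrightarrow>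
      (\<And>m. m \<in> carrier_mat n n \<Longrightarrow> m * c = c * m \<Longrightarrow> mat_trace (a * (m * g)) = 0) \<Longrightarrow> a = 0\<^sub>m n n"
    and k: "(k, \<mu>) \<in> set xs" and k': "(k', \<mu>) \<in> set xs"
  shows "k = k'"
proof -
  interpret field_hom hom by (rule hom)
  let ?C = "map_mat hom c" and ?G = "map_mat hom g"
  have C [simp]: "?C \<in> carrier_mat n n" and G [simp]: "?G \<in> carrier_mat n n"
    using c g by simp_all
  obtain q where q: "is_min_poly hom n c q"
    using exists_min_poly[OF hom c jnf] by blast
  let ?q = "map_poly hom q"
  note qb = q_ext[OF hom c jnf q] and block_dvd = block_dvd[OF hom c jnf q]
  let ?u = "[:- \<mu>, 1:]"
  have "order \<mu> ?q = k" if k: "(k, \<mu>) \<in> set xs" for k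
  proof (rule ccontr)
    assume "order \<mu> ?q \<noteq> k"
    moreover have "k \<le> order \<mu> ?q"
      using block_dvd[OF k] qb(1) order_divides by blast
    ultimately have "?u ^ Suc k dvd ?q"
      using order_divides[of \<mu> "Suc k"] by auto
    then obtain t where t: "?q = ?u ^ Suc k * t"
      by (rule dvdE)
    define r where "r = ?u ^ k * t"
    have r: "?q = ?u * r" "?u ^ k dvd r"
      unfolding t r_def by (simp_all only: power_Suc mult.assoc dvd_triv_left)
    let ?D = "poly_mat ?u ?C" and ?R = "poly_mat r ?C"
    note [simp] = g poly_mat_carrier[OF C] square_mult_simps(7)[where n = n]
    have DR: "?D * ?R = 0\<^sub>m n n" and RD: "?R * ?D = 0\<^sub>m n n"
      using qb(2) unfolding r(1) by (simp_all only: poly_mat_mult[OF C] poly_mat_commute[OF C, of r])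
    have R: "?R \<noteq> 0\<^sub>m n n"
      by (rule proper_divisor_not_annihilating[OF hom c jnf q r(1)])
    obtain W where W [simp]: "W \<in> carrier_mat n n" and W': "W \<noteq> 0\<^sub>m n n" "W * W = W"
      "?D * W = 0\<^sub>m n n" "\<And>p. ?u ^ k dvd p \<Longrightarrow> W * poly_mat p ?C = 0\<^sub>m n n"
      by (rule jordan_nf_eigenidempotent[OF C jnf k]) blast
    obtain S where S [simp]: "S \<in> carrier_mat n n" and DSD: "?D * S * ?D = ?D"
      by (rule jordan_nf_regular[OF C jnf, of \<mu>])
    have D: "?D = - \<mu> \<cdot>\<^sub>m 1\<^sub>m n + ?C"
      by (rule poly_mat_linear[OF C])
    \<comment> \<open>The map \<open>R G\<close> is injective on the eigenspace: \<open>Z V R\<close> is in the radical for every \<open>V\<close>.\<close>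
    have inj: "Z = 0\<^sub>m n n"
      if Z [simp]: "Z \<in> carrier_mat n n" and DZ: "?D * Z = 0\<^sub>m n n" and RGZ: "?R * (?G * Z) = 0\<^sub>m n n" for Z
    proof (rule square_mats_prime[OF Z poly_mat_carrier[OF C, of r] _ R])
      fix V :: "'b mat" assume V [simp]: "V \<in> carrier_mat n n"
      let ?f = "Z * V * ?R"
      have "?D * ?f = (?D * Z) * (V * ?R)"
        by (simp add: square_mult_simps[where n = n])
      then have Df: "?D * ?f = 0\<^sub>m n n"
        unfolding DZ by simp
      have "?f * ?D = Z * V * (?R * ?D)"
        by (simp add: square_mult_simps[where n = n])
      then have fD: "?f * ?D = 0\<^sub>m n n"
        unfolding RD by simp
      have comm: "?f * ?C = ?C * ?f"
        by (rule eigenmatrix_commute[OF _ C Df[unfolded D] fD[unfolded D]]) simp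
      show "?f = 0\<^sub>m n n"
      proof (rule nondegenerate_extends[OF hom c jnf g _ _ comm])
        show "a = 0\<^sub>m n n" if "a \<in> carrier_mat n n" "a * c = c * a"
          "\<And>m. m \<in> carrier_mat n n \<Longrightarrow> m * c = c * m \<Longrightarrow> mat_trace (a * (m * g)) = 0" for a
          using that by (rule nondeg)
        fix m assume m: "m \<in> carrier_mat n n" "m * c = c * m"
        let ?m = "map_mat hom m"
        note [simp] = m(1)
        have m' [simp]: "?m \<in> carrier_mat n n"
          by simp
        have "?m * ?C = ?C * ?m"
          using arg_cong[OF m(2), of "map_mat hom"] m(1) c by (simp add: mat_hom_mult)
        then have Rm: "?R * ?m = ?m * ?R"
          by (simp add: commute_poly_mat[OF C m'])
        have "?f * (?m * ?G) = Z * V * ((?R * ?m) * ?G)"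
          by (simp add: square_mult_simps(1)[where n = n])
        also have "\<dots> = Z * (V * ?m * (?R * ?G))"
          unfolding Rm by (simp add: square_mult_simps(1)[where n = n])
        finally have "mat_trace (?f * (?m * ?G)) = mat_trace (V * ?m * (?R * ?G) * Z)"
          by (simp only:) (rule mat_trace_comm[where n = n]; simp)
        also have "V * ?m * (?R * ?G) * Z = V * ?m * (?R * (?G * Z))"
          by (simp add: square_mult_simps(1)[where n = n])
        finally show "mat_trace (?f * (?m * ?G)) = 0"
          unfolding RGZ by simp
      qed simp
    qed
    \<comment> \<open>The matrix \<open>1 - S D\<close> is a projection onto the eigenspace.  Adding \<open>S D\<close> turns the injective map
      \<open>R G\<close> on the eigenspace into an injective map on the whole space, which is then invertible.\<close>
    have M [simp]: "1\<^sub>m n - S * ?D \<in> carrier_mat n n"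
      by (rule minus_carrier_mat) simp
    define B where "B = ?R * ?G * (1\<^sub>m n - S * ?D) + S * ?D"
    have B [simp]: "B \<in> carrier_mat n n"
      unfolding B_def using g by simp
    have DB: "?D * (B * Z) = ?D * Z" if Z [simp]: "Z \<in> carrier_mat n n" for Z
    proof -
      have "?D * (B * Z) = (?D * ?R) * (?G * ((1\<^sub>m n - S * ?D) * Z)) + (?D * S * ?D) * Z"
        unfolding B_def by (simp add: square_mult_simps[where n = n])
      then show ?thesis
        unfolding DR DSD by simp
    qed
    have BZ: "B * Z = ?R * (?G * Z)" if Z [simp]: "Z \<in> carrier_mat n n" and DZ: "?D * Z = 0\<^sub>m n n" for Z
    proof -
      have "(1\<^sub>m n - S * ?D) * Z = Z - S * (?D * Z)"
        by (subst minus_mult_distrib_mat[of _ n n _ Z n]) (simp_all add: square_mult_simps(1)[where n = n])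
      then have "(1\<^sub>m n - S * ?D) * Z = Z"
        unfolding DZ using carrier_matD[OF Z] by (auto intro!: eq_matI)
      then show ?thesis
        unfolding B_def by (simp add: square_mult_simps[where n = n] DZ)
    qed
    obtain B' where B' [simp]: "B' \<in> carrier_mat n n" and BB': "B * B' = 1\<^sub>m n"
    proof (rule left_regular_imp_right_inverse[OF B])
      fix Z :: "'b mat" assume Z: "Z \<in> carrier_mat n n" and BZ0: "B * Z = 0\<^sub>m n n"
      have DZ: "?D * Z = 0\<^sub>m n n"
        unfolding DB[OF Z, symmetric] BZ0 by simp
      show "Z = 0\<^sub>m n n"
        using BZ[OF Z DZ] unfolding BZ0 by (intro inj[OF Z DZ]) (rule sym)
    qed
    \<comment> \<open>Hence the columns of \<open>W\<close>, which lie in the eigenspace, are in the range of \<open>R\<close>, although \<open>W\<close> kills it.\<close>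
    have BBW: "B * (B' * W) = W"
      using BB' by (simp flip: square_mult_simps(1)[where n = n])
    have "?D * (B' * W) = 0\<^sub>m n n"
      using DB[of "B' * W"] W'(3) by (simp add: BBW)
    then have "W = ?R * (?G * (B' * W))"
      using BZ[of "B' * W"] BBW by simp
    then have "W * W = W * (?R * (?G * (B' * W)))"
      by (rule arg_cong)
    also have "\<dots> = (W * ?R) * (?G * (B' * W))"
      by (rule assoc_mult_mat[symmetric, of _ n n _ n _ n]) simp_all
    finally show False
      using W'(1,2) W'(4)[OF r(2)] by simp
  qed
  then show ?thesis
    using k k' by metis
qed


section \<open>Contraction of the derivative\<close>

lemma (in linear_functional) map_mat_sum_mat:
  assumes "\<And>x. x \<in> I \<Longrightarrow> f x \<in> carrier_mat n n"
  shows "map_mat \<rho> (sum_mat n f I) = sum_mat n (\<lambda>x. map_mat \<rho> (f x)) I"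
proof (rule eq_matI)
  fix i j assume "i < dim_row (sum_mat n (\<lambda>x. map_mat \<rho> (f x)) I)"
    "j < dim_col (sum_mat n (\<lambda>x. map_mat \<rho> (f x)) I)"
  then have ij: "i < n" "j < n"
    by (auto simp: sum_mat_def)
  have "\<rho> (f x $$ (i, j)) = map_mat \<rho> (f x) $$ (i, j)" if "x \<in> I" for x
    using assms(1)[OF that] ij by auto
  then show "map_mat \<rho> (sum_mat n f I) $$ (i, j) = sum_mat n (\<lambda>x. map_mat \<rho> (f x)) I $$ (i, j)"
    using ij by (simp add: sum_mat_def sum)
qed (auto simp: sum_mat_def)

text \<open>In terms of a decomposition of the Bezoutian into terms \<open>e x^i y^j\<close> this is the sum of
  the \<open>e tr(c^i Y) c^j\<close>: the left factor is contracted against \<open>Y\<close> by the trace form.\<close>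

definition contraction :: "nat \<Rightarrow> 'a :: field poly \<Rightarrow> 'a mat \<Rightarrow> 'a mat \<Rightarrow> 'a mat" where
  "contraction n q c Y =
    sum_mat n (\<lambda>(k, l). unit_mat n k l * poly_diff q c (Y * unit_mat n l k)) ({..<n} \<times> {..<n})"

lemma contraction_carrier [simp]: "contraction n q c Y \<in> carrier_mat n n"
  by (simp add: contraction_def)

lemma contraction_add:
  assumes [simp]: "c \<in> carrier_mat n n" "Y \<in> carrier_mat n n" "Z \<in> carrier_mat n n"
  shows "contraction n q c (Y + Z) = contraction n q c Y + contraction n q c Z"
  unfolding contraction_def
  by (subst sum_mat_add[symmetric]) (auto simp: square_mult_simps[where n = n] poly_diff_add[where n = n]
      poly_diff_carrier[where n = n] split_def intro!: sum_mat_cong)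

lemma contraction_smult:
  assumes [simp]: "c \<in> carrier_mat n n" "Y \<in> carrier_mat n n"
  shows "contraction n q c (k \<cdot>\<^sub>m Y) = k \<cdot>\<^sub>m contraction n q c Y"
  unfolding contraction_def
  by (subst sum_mat_smult[symmetric]) (auto simp: square_mult_simps[where n = n] poly_diff_smult[where n = n]
      poly_diff_carrier[where n = n] split_def intro!: sum_mat_cong)

text \<open>On matrices with columns in the eigenspace for \<open>\<mu>\<close>, left multiplication by \<open>c\<close> is \<open>\<mu>\<close>, and the
  Bezoutian specializes to \<open>(q(\<mu>) - q(y)) / (\<mu> - y) = r(y)\<close>.\<close>

lemma contraction_eigenmatrix:
  assumes c [simp]: "c \<in> carrier_mat n n" "Y \<in> carrier_mat n n"
    and "poly_mat [:- \<mu>, 1:] c * Y = 0\<^sub>m n n" and q: "q = [:- \<mu>, 1:] * r"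
  shows "contraction n q c Y = mat_trace Y \<cdot>\<^sub>m poly_mat r c"
proof -
  have "poly_diff q c (Y * U) = Y * U * poly_mat r c" if [simp]: "U \<in> carrier_mat n n" for U
  proof -
    let ?D = "poly_mat [:- \<mu>, 1:] c"
    note [simp] = poly_mat_carrier[OF c(1)] poly_diff_carrier[OF c(1)] square_mult_simps(7)[where n = n]
    have "?D * poly_diff r c (Y * U) = poly_diff r c ((?D * Y) * U)"
      by (simp add: square_mult_simps(1)[where n = n] poly_diff_commute_left[OF c(1)]
          commute_poly_mat[OF c(1)])
    then have "?D * poly_diff r c (Y * U) = 0\<^sub>m n n"
      unfolding assms(3) by (simp add: poly_diff_zero[OF c(1)])
    then show ?thesis
      unfolding q by (simp add: poly_diff_mult_poly[OF c(1)] poly_diff_linear[OF c(1)] del: mult_pCons_left)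
  qed
  then show ?thesis
    unfolding contraction_def by (simp add: sum_unit_mat_trace poly_mat_carrier[OF c(1)])
qed

lemma (in linear_functional) map_mat_contraction:
  assumes [simp]: "c \<in> carrier_mat n n" "Y \<in> carrier_mat n n"
  shows "map_mat \<rho> (contraction n (map_poly hom q) (map_mat hom c) Y) = contraction n q c (map_mat \<rho> Y)"
proof -
  have U: "unit_mat n k l = map_mat hom (unit_mat n k l)" for k l
    by (rule eq_matI) (auto simp: unit_mat_def)
  have "map_mat \<rho> (unit_mat n k l * poly_diff (map_poly hom q) (map_mat hom c) (Y * unit_mat n l k)) =
      unit_mat n k l * poly_diff q c (map_mat \<rho> Y * unit_mat n l k)" for k l
  proof -
    have Yu: "Y * map_mat hom (unit_mat n l k) \<in> carrier_mat n n"
      by (simp add: square_mult_simps(7)[where n = n])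
    show ?thesis
      unfolding U[of k l] U[of l k]
      by (subst map_mat_mult_left[where n = n])
        (simp_all add: Yu poly_diff_carrier[where n = n] map_mat_poly_diff[where n = n]
          map_mat_mult_right[where n = n])
  qed
  then show ?thesis
    unfolding contraction_def
    by (subst map_mat_sum_mat) (auto simp: square_mult_simps(7)[where n = n] poly_diff_carrier[where n = n]
        split_def intro!: sum_mat_cong)
qed


section \<open>Diagonalizable matrices\<close>

text \<open>For \<open>Y\<close> of trace one with columns in the eigenspace for \<open>\<mu>\<close>, the left hand side is \<open>q' r\<close> evaluated
  at \<open>c\<close>, where \<open>r = q / (x - \<mu>)\<close>.  These polynomials vanish at all eigenvalues but \<open>\<mu>\<close>, where the value
  is \<open>r(\<mu>)^2\<close>, so a combination of them takes the value \<open>1\<close> at every eigenvalue.\<close>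

lemma exists_separating_matrix:
  fixes hom :: "'a :: field \<Rightarrow> 'b :: field"
  assumes hom: "field_hom hom" and c [simp]: "c \<in> carrier_mat n n"
    and jnf: "jordan_nf (map_mat hom c) xs"
    and one: "\<And>k \<mu>. (k, \<mu>) \<in> set xs \<Longrightarrow> k = 1"
  shows "\<exists>q. poly_mat q c = 0\<^sub>m n n \<and>
    (\<exists>Y\<in>carrier_mat n n. poly_diff q c (contraction n q c Y) = 1\<^sub>m n)"
proof -
  interpret field_hom hom by (rule hom)
  let ?C = "map_mat hom c"
  have C [simp]: "?C \<in> carrier_mat n n"
    by simp
  obtain q where q: "is_min_poly hom n c q"
    using exists_min_poly[OF hom c jnf] by blast
  let ?q = "map_poly hom q"
  let ?L = "\<lambda>Y. poly_diff ?q ?C (contraction n ?q ?C Y)"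
  have "\<exists>r. ?q = [:- \<mu>, 1:] * r \<and> poly r \<mu> \<noteq> 0" if "(k, \<mu>) \<in> set xs" for k \<mu>
    using exact_block_factor[OF hom c jnf q _ that] one that by (metis power_one_right)
  then obtain r where r: "\<And>\<mu>. \<mu> \<in> snd ` set xs \<Longrightarrow> ?q = [:- \<mu>, 1:] * r \<mu> \<and> poly (r \<mu>) \<mu> \<noteq> 0"
    by atomize_elim (rule choice, force)
  have L_add: "?L (Y + Z) = ?L Y + ?L Z" and L_smult: "?L (k \<cdot>\<^sub>m Y) = k \<cdot>\<^sub>m ?L Y"
    if "Y \<in> carrier_mat n n" "Z \<in> carrier_mat n n" for Y Z k
    using that by (simp_all add: contraction_add contraction_smult poly_diff_add[where n = n]
        poly_diff_smult[where n = n])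
  have eigen: "\<exists>Y\<in>carrier_mat n n. ?L Y = poly_mat (pderiv ?q * r \<mu>) ?C" if \<mu>: "\<mu> \<in> snd ` set xs" for \<mu>
  proof -
    obtain k where k: "(k, \<mu>) \<in> set xs"
      using \<mu> by force
    obtain W where W: "W \<in> carrier_mat n n" "W \<noteq> 0\<^sub>m n n" "poly_mat [:- \<mu>, 1:] ?C * W = 0\<^sub>m n n"
      by (rule jordan_nf_eigenidempotent[OF C jnf k])
    obtain Z where Z: "Z \<in> carrier_mat n n" "mat_trace (W * Z) \<noteq> 0"
      using mat_trace_nondegenerate[OF W(1)] W(2) by blast
    define Y where "Y = (1 / mat_trace (W * Z)) \<cdot>\<^sub>m (W * Z)"
    have WZ: "W * Z \<in> carrier_mat n n"
      using W Z by (simp add: square_mult_simps(7)[where n = n])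
    then have Y: "Y \<in> carrier_mat n n" "mat_trace Y = 1"
      using Z(2) by (simp_all add: Y_def mat_trace_smult[where n = n])
    have "poly_mat [:- \<mu>, 1:] ?C * (W * Z) = (poly_mat [:- \<mu>, 1:] ?C * W) * Z"
      using W(1) Z(1) by (simp add: square_mult_simps(1)[where n = n] poly_mat_carrier[OF C])
    then have DY: "poly_mat [:- \<mu>, 1:] ?C * Y = 0\<^sub>m n n"
      unfolding Y_def W(3) using WZ Z(1)
      by (simp add: square_mult_simps(5)[where n = n] poly_mat_carrier[OF C])
    have "?L Y = poly_diff ?q ?C (1\<^sub>m n * poly_mat (r \<mu>) ?C)"
      using contraction_eigenmatrix[OF C Y(1) DY, of ?q "r \<mu>"] r[OF \<mu>] Y(2)
      by (simp add: poly_mat_carrier[OF C])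
    also have "\<dots> = poly_diff ?q ?C (1\<^sub>m n) * poly_mat (r \<mu>) ?C"
      by (rule poly_diff_commute_right[OF C])
        (simp_all add: poly_mat_carrier[OF C] commute_poly_mat[OF C C, symmetric])
    also have "\<dots> = poly_mat (pderiv ?q * r \<mu>) ?C"
      by (simp add: poly_diff_one[OF C] poly_mat_mult[OF C])
    finally show ?thesis
      using Y(1) by blast
  qed
  \<comment> \<open>The weights of Lagrange interpolation, as \<open>q'\<close> and \<open>r \<mu>\<close> agree at \<open>\<mu>\<close>.\<close>
  define \<kappa> where "\<kappa> \<mu> = 1 / (poly (r \<mu>) \<mu>)\<^sup>2" for \<mu>
  have "\<exists>Y\<in>carrier_mat n n. ?L Y = poly_mat (\<Sum>\<mu>\<in>M. smult (\<kappa> \<mu>) (pderiv ?q * r \<mu>)) ?C"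
    if "finite M" "M \<subseteq> snd ` set xs" for M
    using that
  proof (induction M)
    case empty
    have "contraction n ?q ?C (0 \<cdot>\<^sub>m 0\<^sub>m n n) = 0\<^sub>m n n"
      by (subst contraction_smult) (simp_all add: smult_zero_one(2)[of _ n n])
    then show ?case
      by (intro bexI[of _ "0\<^sub>m n n"]) (simp_all add: poly_mat_0[OF C] poly_diff_zero[OF C])
  next
    case (insert \<mu> M)
    obtain Y where Y: "Y \<in> carrier_mat n n" "?L Y = poly_mat (\<Sum>\<mu>\<in>M. smult (\<kappa> \<mu>) (pderiv ?q * r \<mu>)) ?C"
      using insert by blast
    obtain Z where Z: "Z \<in> carrier_mat n n" "?L Z = poly_mat (pderiv ?q * r \<mu>) ?C"
      using eigen[of \<mu>] insert.prems by blast
    have "?L (\<kappa> \<mu> \<cdot>\<^sub>m Z + Y) = \<kappa> \<mu> \<cdot>\<^sub>m ?L Z + ?L Y"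
      using Y(1) Z(1) L_add[of "\<kappa> \<mu> \<cdot>\<^sub>m Z" Y] L_smult[OF Z(1) Z(1)] by simp
    also have "\<dots> = poly_mat (\<Sum>\<mu>\<in>insert \<mu> M. smult (\<kappa> \<mu>) (pderiv ?q * r \<mu>)) ?C"
      unfolding Y(2) Z(2) using insert.hyps by (simp add: poly_mat_add[OF C] poly_mat_smult[OF C])
    finally show ?case
      using Y(1) Z(1) by (intro bexI[of _ "\<kappa> \<mu> \<cdot>\<^sub>m Z + Y"]) auto
  qed
  from this[of "snd ` set xs"] obtain Y where Y: "Y \<in> carrier_mat n n"
    "?L Y = poly_mat (\<Sum>\<mu>\<in>snd ` set xs. smult (\<kappa> \<mu>) (pderiv ?q * r \<mu>)) ?C"
    by auto
  let ?p = "\<Sum>\<mu>\<in>snd ` set xs. smult (\<kappa> \<mu>) (pderiv ?q * r \<mu>)"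
  have "poly ?p \<nu> = 1" if \<nu>: "\<nu> \<in> snd ` set xs" for \<nu>
  proof -
    have "poly (pderiv ?q) \<nu> = poly (pderiv ([:- \<nu>, 1:] * r \<nu>)) \<nu>"
      by (simp only: conjunct1[OF r[OF \<nu>], symmetric])
    then have pd: "poly (pderiv ?q) \<nu> = poly (r \<nu>) \<nu>"
      by (simp add: pderiv_mult pderiv_pCons del: mult_pCons_left)
    have "poly (smult (\<kappa> \<mu>) (pderiv ?q * r \<mu>)) \<nu> = (if \<mu> = \<nu> then 1 else 0)"
      if \<mu>: "\<mu> \<in> snd ` set xs" for \<mu>
    proof (cases "\<mu> = \<nu>")
      case True
      then show ?thesis
        using r[OF \<nu>] pd by (simp add: \<kappa>_def power2_eq_square)
    next
      case False
      have "poly ([:- \<mu>, 1:] * r \<mu>) \<nu> = poly ([:- \<nu>, 1:] * r \<nu>) \<nu>"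
        using r[OF \<mu>] r[OF \<nu>] by metis
      then show ?thesis
        using False by simp
    qed
    then show ?thesis
      using \<nu> by (simp add: poly_sum)
  qed
  then have "[:- \<nu>, 1:] ^ k dvd ?p - 1" if "(k, \<nu>) \<in> set xs" for k \<nu>
    using that one[OF that] by (force simp flip: poly_eq_0_iff_dvd)
  then have "poly_mat (?p - 1) ?C = 0\<^sub>m n n"
    unfolding poly_mat_jordan_nf_eq_0_iff[OF C jnf] by blast
  then have "poly_mat ?p ?C = 1\<^sub>m n"
    using poly_mat_add[OF C, of "?p - 1" 1] by (simp add: poly_mat_1[OF C])
  then have LY: "?L Y = 1\<^sub>m n"
    using Y(2) by simp
  obtain \<rho> where \<rho>: "linear_functional hom \<rho>" "\<rho> 1 = 1"
    using exists_linear_functional[of 1] by auto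
  interpret \<rho>: linear_functional hom \<rho> by (rule \<rho>(1))
  have "poly_diff q c (contraction n q c (map_mat \<rho> Y)) = map_mat \<rho> (?L Y)"
    using Y(1) by (simp add: \<rho>.map_mat_poly_diff[where n = n] \<rho>.map_mat_contraction)
  also have "\<dots> = 1\<^sub>m n"
    unfolding LY using \<rho>(2) by (intro eq_matI) auto
  finally show ?thesis
    using min_poly_annihilates[OF hom c jnf q] Y(1)
    by (intro exI[of _ q] conjI bexI[of _ "map_mat \<rho> Y"]) auto
qed

text \<open>The map \<open>\<Phi>\<close> stands for the average \<open>h \<mapsto> \<Sum> x h y\<close> over a separating element \<open>\<Sum> x \<otimes> y\<close>; the
  hypotheses are the properties of the average used in the argument.  A block of size at
  least two makes \<open>z = r(c)\<close> square to zero, and averaging \<open>z g z = z\<close> forces \<open>z = 0\<close>.\<close>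

lemma separating_average_imp_diagonalizable:
  fixes hom :: "'a :: field \<Rightarrow> 'b :: field"
  assumes hom: "field_hom hom" and c [simp]: "c \<in> carrier_mat n n"
    and jnf: "jordan_nf (map_mat hom c) xs"
    and q: "poly_mat q c = 0\<^sub>m n n" and g [simp]: "g \<in> carrier_mat n n" and one: "poly_diff q c g = 1\<^sub>m n"
    and carr: "\<And>h. h \<in> carrier_mat n n \<Longrightarrow> \<Phi> h \<in> carrier_mat n n"
    and comm: "\<And>h. h \<in> carrier_mat n n \<Longrightarrow> \<Phi> h * map_mat hom c = map_mat hom c * \<Phi> h"
    and bilin: "\<And>p h. h \<in> carrier_mat n n \<Longrightarrow> \<Phi> (poly_mat p (map_mat hom c) * h * poly_mat p (map_mat hom c)) =
      poly_mat p (map_mat hom c) * \<Phi> h * poly_mat p (map_mat hom c)"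
    and fix_poly: "\<And>p. \<Phi> (poly_mat p (map_mat hom c)) = poly_mat p (map_mat hom c)"
    and k: "(k, \<mu>) \<in> set xs"
  shows "k = 1"
proof (rule ccontr)
  assume "k \<noteq> 1"
  interpret field_hom hom by (rule hom)
  let ?C = "map_mat hom c" and ?G = "map_mat hom g" and ?q = "map_poly hom q" and ?u = "[:- \<mu>, 1:]"
  have C [simp]: "?C \<in> carrier_mat n n" and G [simp]: "?G \<in> carrier_mat n n"
    by simp_all
  note [simp] = poly_mat_carrier[OF C] poly_diff_carrier[OF C] square_mult_simps(7)[where n = n]
  have q0: "poly_mat ?q ?C = 0\<^sub>m n n"
    by (simp add: poly_mat_map[OF c] q)
  have E1: "poly_diff ?q ?C ?G = 1\<^sub>m n"
    by (simp add: poly_diff_map[OF c g] one mat_hom_one)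
  have "Suc (Suc 0) \<le> k"
    using \<open>k \<noteq> 1\<close> jordan_nf_pos[OF C jnf k] by simp
  then have "?u ^ Suc (Suc 0) dvd ?u ^ k"
    by (rule le_imp_power_dvd)
  also have "?u ^ k dvd ?q"
    using q0 k unfolding poly_mat_jordan_nf_eq_0_iff[OF C jnf] by auto
  finally obtain w where w: "?q = ?u ^ Suc (Suc 0) * w"
    by (rule dvdE)
  define r where "r = ?u * w"
  have r: "?q = ?u * r" "r * r = ?q * w"
    unfolding w r_def by (simp_all only: power_Suc power_0 mult_1_right mult_1_left mult_ac)
  let ?z = "poly_mat r ?C" and ?D = "poly_mat ?u ?C" and ?E = "poly_diff r ?C ?G"
  have split: "?G * ?z + ?D * ?E = 1\<^sub>m n"
    using E1 unfolding r(1) by (simp add: poly_diff_mult_poly[OF C] poly_diff_linear[OF C] del: mult_pCons_left)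
  have zD: "?z * ?D = 0\<^sub>m n n"
    using q0 unfolding r(1) by (simp only: poly_mat_mult[OF C] poly_mat_commute[OF C, of ?u])
  have zz: "?z * ?z = 0\<^sub>m n n"
    unfolding poly_mat_mult[OF C, symmetric] r(2) by (simp add: poly_mat_mult[OF C] q0)
  have "?z = ?z * (?G * ?z + ?D * ?E)"
    unfolding split by simp
  also have "\<dots> = ?z * ?G * ?z + (?z * ?D) * ?E"
    by (simp add: square_mult_simps(1,3)[where n = n])
  also have "\<dots> = ?z * ?G * ?z"
    unfolding zD by simp
  finally have zGz: "?z * ?G * ?z = ?z" ..
  have "?z = \<Phi> (?z * ?G * ?z)"
    unfolding zGz by (rule fix_poly[symmetric])
  also have "\<dots> = ?z * \<Phi> ?G * ?z"
    by (rule bilin[OF G])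
  also have "\<dots> = ?z * (?z * \<Phi> ?G)"
    using commute_poly_mat[OF C carr[OF G] comm[OF G], of r] carr[OF G]
    by (simp add: square_mult_simps(1)[where n = n])
  also have "\<dots> = (?z * ?z) * \<Phi> ?G"
    using carr[OF G] by (simp add: square_mult_simps(1)[where n = n])
  also have "\<dots> = 0\<^sub>m n n"
    unfolding zz using carr[OF G] by simp
  finally have z0: "?z = 0\<^sub>m n n" .
  \<comment> \<open>With \<open>z = 0\<close> the product rule inverts \<open>c - \<mu>\<close>, contrary to the existence of an eigenvector.\<close>
  have DE: "?D * ?E = 1\<^sub>m n"
    using split unfolding z0 by simp
  have "?E * ?C = ?C * ?E"
    by (rule poly_diff_central[OF C G z0])
  then have ED: "?E * ?D = 1\<^sub>m n"
    using commute_poly_mat[OF C, of ?E ?u] DE by simp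
  obtain W where W: "W \<in> carrier_mat n n" "W \<noteq> 0\<^sub>m n n" "?D * W = 0\<^sub>m n n"
    by (rule jordan_nf_eigenidempotent[OF C jnf k])
  have "W = (?E * ?D) * W"
    unfolding ED using W(1) by simp
  also have "\<dots> = ?E * (?D * W)"
    using W(1) by (simp add: square_mult_simps(1)[where n = n])
  also have "\<dots> = 0\<^sub>m n n"
    unfolding W(3) by simp
  finally show False
    using W(2) by contradiction
qed


section \<open>Linear functionals on subspaces of matrices\<close>

lemma linear_eq_mat_trace:
  fixes \<psi> :: "'a :: field mat \<Rightarrow> 'a"
  assumes add: "\<And>V W. V \<in> carrier_mat n n \<Longrightarrow> W \<in> carrier_mat n n \<Longrightarrow> \<psi> (V + W) = \<psi> V + \<psi> W"
    and smult: "\<And>r V. V \<in> carrier_mat n n \<Longrightarrow> \<psi> (r \<cdot>\<^sub>m V) = r * \<psi> V"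
  obtains g where "g \<in> carrier_mat n n" "\<And>V. V \<in> carrier_mat n n \<Longrightarrow> \<psi> V = mat_trace (V * g)"
proof -
  define g where "g = mat n n (\<lambda>(i, j). \<psi> (unit_mat n j i))"
  have g: "g \<in> carrier_mat n n"
    by (simp add: g_def)
  have zero: "\<psi> (0\<^sub>m n n) = 0"
    using smult[of "0\<^sub>m n n" 0] by simp
  have sum: "\<psi> (sum_mat n F I) = (\<Sum>x\<in>I. \<psi> (F x))"
    if "finite I" "\<And>x. x \<in> I \<Longrightarrow> F x \<in> carrier_mat n n" for F :: "nat \<times> nat \<Rightarrow> 'a mat" and I
    using that by (induction I) (simp_all add: zero sum_mat_insert add)
  have "\<psi> V = mat_trace (V * g)" if V: "V \<in> carrier_mat n n" for V
  proof -
    have "\<psi> V = (\<Sum>(i, j)\<in>{..<n} \<times> {..<n}. V $$ (i, j) * \<psi> (unit_mat n i j))"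
      by (subst sum_mat_unit_decomposition[OF V], subst sum) (auto simp: smult split_def intro!: sum.cong)
    also have "\<dots> = (\<Sum>i<n. \<Sum>j<n. V $$ (i, j) * g $$ (j, i))"
      unfolding sum.cartesian_product[symmetric] by (intro sum.cong refl) (simp add: g_def)
    also have "\<dots> = mat_trace (V * g)"
      by (rule mat_trace_mult[OF V g, symmetric])
    finally show ?thesis .
  qed
  then show ?thesis
    using that g by blast
qed

text \<open>Such a projection extends linear functionals from \<open>U\<close> to all matrices.  It is obtained in the vector
  space of functions on pairs of indices, with matrices extended by zero.\<close>

lemma exists_matrix_projection:
  fixes U :: "'a :: field mat set"
  assumes U: "U \<subseteq> carrier_mat n n" "0\<^sub>m n n \<in> U"
    and add: "\<And>V W. V \<in> U \<Longrightarrow> W \<in> U \<Longrightarrow> V + W \<in> U" and smult: "\<And>r V. V \<in> U \<Longrightarrow> r \<cdot>\<^sub>m V \<in> U"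
  obtains P where "\<And>V. V \<in> carrier_mat n n \<Longrightarrow> P V \<in> U" "\<And>V. V \<in> U \<Longrightarrow> P V = V"
    "\<And>V W. V \<in> carrier_mat n n \<Longrightarrow> W \<in> carrier_mat n n \<Longrightarrow> P (V + W) = P V + P W"
    "\<And>r V. V \<in> carrier_mat n n \<Longrightarrow> P (r \<cdot>\<^sub>m V) = r \<cdot>\<^sub>m P V"
proof -
  let ?s = "\<lambda>(r :: 'a) v. \<lambda>x :: nat \<times> nat. r * v x"
  interpret vector_space_pair ?s ?s
    by unfold_locales (auto simp: fun_eq_iff algebra_simps)
  let ?M = "\<lambda>v :: nat \<times> nat \<Rightarrow> 'a. mat n n v"
  let ?v = "\<lambda>V :: 'a mat. \<lambda>(i, j). if i < n \<and> j < n then V $$ (i, j) else 0"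
  have M_add: "?M (v + w) = ?M v + ?M w" and M_smult: "?M (?s r v) = r \<cdot>\<^sub>m ?M v" for v w r
    by (auto intro!: eq_matI)
  have Mv: "?M (?v V) = V" if "V \<in> carrier_mat n n" for V
    using that by (auto intro!: eq_matI)
  let ?W = "{v. ?M v \<in> U}"
  have "vs1.subspace ?W"
    unfolding vs1.subspace_def mem_Collect_eq M_add M_smult
  proof (intro conjI allI ballI)
    have "?M 0 = 0\<^sub>m n n"
      by (auto intro!: eq_matI)
    then show "?M 0 \<in> U"
      using U(2) by simp
  qed (use add smult in auto)
  moreover have "Vector_Spaces.linear ?s ?s (\<lambda>v. v)"
    by unfold_locales auto
  ultimately obtain p where p: "range p \<subseteq> ?W" "Vector_Spaces.linear ?s ?s p" "\<And>v. v \<in> ?W \<Longrightarrow> p v = v"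
    using linear_exists_left_inverse_on[of "\<lambda>v. v" ?W] by auto
  interpret p: Vector_Spaces.linear ?s ?s p by (rule p(2))
  show ?thesis
  proof (rule that[of "\<lambda>V. ?M (p (?v V))"])
    show "?M (p (?v V)) \<in> U" for V
      using p(1) by blast
    show "?M (p (?v V)) = V" if "V \<in> U" for V
    proof -
      have V: "?M (?v V) = V"
        using that U(1) Mv by blast
      then have "p (?v V) = ?v V"
        using that by (intro p(3)) simp
      then show ?thesis
        using V by simp
    qed
    show "?M (p (?v (V + W))) = ?M (p (?v V)) + ?M (p (?v W))"
      if "V \<in> carrier_mat n n" "W \<in> carrier_mat n n" for V W
    proof -
      have "?v (V + W) = ?v V + ?v W"
        using that by (auto simp: fun_eq_iff)
      then show ?thesis
        by (simp only: p.add M_add)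
    qed
    show "?M (p (?v (r \<cdot>\<^sub>m V))) = r \<cdot>\<^sub>m ?M (p (?v V))" if "V \<in> carrier_mat n n" for V r
    proof -
      have "?v (r \<cdot>\<^sub>m V) = ?s r (?v V)"
        using that by (auto simp: fun_eq_iff)
      then show ?thesis
        by (simp only: p.scale M_smult)
    qed
  qed
qed


section \<open>Computing in the tensor square\<close>

lemma finprod_hom:
  assumes "comm_group G" "comm_group H" "h \<in> hom G H" "f \<in> I \<rightarrow> carrier G"
  shows "h (finprod G f I) = finprod H (\<lambda>i. h (f i)) I"
proof -
  interpret G: comm_group G by fact
  interpret H: comm_group H by fact
  interpret h: group_hom G H h
    using assms(3) by unfold_locales
  show ?thesis
    using assms(4)
  proof (induction I rule: infinite_finite_induct)
    case (insert x I)
    then have "h (finprod G f (insert x I)) = h (f x \<otimes>\<^bsub>G\<^esub> finprod G f I)"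
      by (subst G.finprod_insert) auto
    also have "\<dots> = h (f x) \<otimes>\<^bsub>H\<^esub> finprod H (\<lambda>i. h (f i)) I"
      using insert by (subst h.hom_mult) auto
    also have "\<dots> = finprod H (\<lambda>i. h (f i)) (insert x I)"
      using insert by (subst H.finprod_insert) (auto intro!: h.hom_closed)
    finally show ?case .
  qed simp_all
qed

lemma (in comm_monoid) finprod_swap:
  assumes "finite I" "finite J" "\<And>i j. i \<in> I \<Longrightarrow> j \<in> J \<Longrightarrow> f i j \<in> carrier G"
  shows "(\<Otimes>i\<in>I. \<Otimes>j\<in>J. f i j) = (\<Otimes>j\<in>J. \<Otimes>i\<in>I. f i j)"
  using assms(1,3)
proof (induction I)
  case (insert x I)
  have "(\<Otimes>j\<in>J. \<Otimes>i\<in>insert x I. f i j) = (\<Otimes>j\<in>J. f x j \<otimes> (\<Otimes>i\<in>I. f i j))"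
    using insert by (intro finprod_cong') (auto intro!: finprod_insert)
  also have "\<dots> = (\<Otimes>j\<in>J. f x j) \<otimes> (\<Otimes>j\<in>J. \<Otimes>i\<in>I. f i j)"
    using insert by (intro finprod_multf) auto
  finally show ?case
    using insert by (subst finprod_insert) auto
qed simp

text \<open>For a ring homomorphism \<open>f\<close> from \<open>B\<close> to \<open>A\<close>: the rules of calculation for pure tensors in the tensor
  square of \<open>A\<close> over \<open>B\<close>, whose elements are cosets of the subgroup of relations.\<close>

context
  fixes B :: "('b, 'x) ring_scheme" and A :: "('a, 'y) ring_scheme" and f :: "'b \<Rightarrow> 'a"
  assumes f: "ring_hom_ring B A f"
begin

interpretation f: ring_hom_ring B A f by (rule f)

abbreviation "tsquare \<equiv> tensor_square B A f"
abbreviation "tpure \<equiv> pure_tensor B (ring_bimod id A f) (ring_bimod f A id)"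
abbreviation "trel \<equiv> tensor_relations B (ring_bimod id A f) (ring_bimod f A id)"
abbreviation "tfree \<equiv> free_Abelian_group (carrier A \<times> carrier A)"

lemma bimodule_left: "bimodule A B (ring_bimod id A f)"
  and bimodule_right: "bimodule B A (ring_bimod f A id)"
  using f.S.ring_axioms
  by (auto intro!: bimodule_ring_bimod f ring_hom_ring.intro ring_hom_ring_axioms.intro simp: ring_hom_def)

lemma carrier_ring_bimod: "carrier (ring_bimod id A f) = carrier A" "carrier (ring_bimod f A id) = carrier A"
  by (simp_all add: ring_bimod_def)

lemmas tensor_ops =
  bimodule_tensor_bimod[OF bimodule_left bimodule_right, folded tensor_square_def, unfolded carrier_ring_bimod]

lemma tsquare_bimodule: "bimodule A A tsquare"
  by (rule tensor_ops(1))

interpretation tsquare: bimodule A A tsquare by (rule tsquare_bimodule)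

lemma trel_subgroup: "subgroup trel tfree"
  using tensor_relations_subgroup[OF bimodule_left bimodule_right] unfolding carrier_ring_bimod .

interpretation F: comm_group tfree by (rule abelian_free_Abelian_group)

lemma tfree_diff: "u \<in> carrier tfree \<Longrightarrow> v \<in> carrier tfree \<Longrightarrow> u - v \<in> carrier tfree"
  using keys_diff[of u v] by auto

lemma trel_coset_eq_iff:
  assumes "u \<in> carrier tfree" "v \<in> carrier tfree"
  shows "trel #>\<^bsub>tfree\<^esub> u = trel #>\<^bsub>tfree\<^esub> v \<longleftrightarrow> u - v \<in> trel"
proof -
  interpret K: subgroup trel tfree by (rule trel_subgroup)
  have "u \<in> trel #>\<^bsub>tfree\<^esub> v \<longleftrightarrow> u - v \<in> trel"
    using assms K.rcos_module[OF F.is_group assms(2,1)] by simp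
  then show ?thesis
    using F.repr_independence[OF _ assms(2) trel_subgroup] F.rcos_self[OF assms(1) trel_subgroup] by metis
qed

lemma tsquare_elem:
  assumes "x \<in> carrier tsquare"
  obtains u where "u \<in> carrier tfree" "x = trel #>\<^bsub>tfree\<^esub> u"
  using assms
  by (auto simp: tensor_square_def tensor_bimod_def Let_def carrier_FactGroup carrier_ring_bimod)

lemma frag_of_tfree [simp]: "x \<in> carrier A \<Longrightarrow> y \<in> carrier A \<Longrightarrow> frag_of (x, y) \<in> carrier tfree"
  by simp

lemma tcoset_closed: "u \<in> carrier tfree \<Longrightarrow> trel #>\<^bsub>tfree\<^esub> u \<in> carrier tsquare"
  by (simp add: tensor_square_def tensor_bimod_def Let_def carrier_FactGroup carrier_ring_bimod)

lemma tpure_eq: "tpure x y = trel #>\<^bsub>tfree\<^esub> frag_of (x, y)"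
  by (simp add: pure_tensor_def carrier_ring_bimod)

lemma tpure_closed [simp]: "x \<in> carrier A \<Longrightarrow> y \<in> carrier A \<Longrightarrow> tpure x y \<in> carrier tsquare"
  unfolding tpure_eq by (intro tcoset_closed frag_of_tfree)

lemma trel_generators:
  "x \<in> carrier A \<Longrightarrow> x' \<in> carrier A \<Longrightarrow> y \<in> carrier A \<Longrightarrow>
    frag_of (x \<oplus>\<^bsub>A\<^esub> x', y) - frag_of (x, y) - frag_of (x', y) \<in> trel"
  "x \<in> carrier A \<Longrightarrow> y \<in> carrier A \<Longrightarrow> y' \<in> carrier A \<Longrightarrow>
    frag_of (x, y \<oplus>\<^bsub>A\<^esub> y') - frag_of (x, y) - frag_of (x, y') \<in> trel"
  "x \<in> carrier A \<Longrightarrow> b \<in> carrier B \<Longrightarrow> y \<in> carrier A \<Longrightarrow>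
    frag_of (x \<otimes>\<^bsub>A\<^esub> f b, y) - frag_of (x, f b \<otimes>\<^bsub>A\<^esub> y) \<in> trel"
proof -
  have ops: "x \<oplus>\<^bsub>A\<^esub> x' = x \<otimes>\<^bsub>ring_bimod id A f\<^esub> x'" "x \<oplus>\<^bsub>A\<^esub> x' = x \<otimes>\<^bsub>ring_bimod f A id\<^esub> x'"
    "x \<otimes>\<^bsub>A\<^esub> f b = ract (ring_bimod id A f) x b" "f b \<otimes>\<^bsub>A\<^esub> x = lact (ring_bimod f A id) b x" for x x' b
    by (simp_all add: ring_bimod_def)
  show "frag_of (x \<oplus>\<^bsub>A\<^esub> x', y) - frag_of (x, y) - frag_of (x', y) \<in> trel"
    if "x \<in> carrier A" "x' \<in> carrier A" "y \<in> carrier A"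
    using that unfolding ops(1) tensor_relations_def carrier_ring_bimod by (intro generate.incl) blast
  show "frag_of (x, y \<oplus>\<^bsub>A\<^esub> y') - frag_of (x, y) - frag_of (x, y') \<in> trel"
    if "x \<in> carrier A" "y \<in> carrier A" "y' \<in> carrier A"
    using that unfolding ops(2) tensor_relations_def carrier_ring_bimod by (intro generate.incl) blast
  show "frag_of (x \<otimes>\<^bsub>A\<^esub> f b, y) - frag_of (x, f b \<otimes>\<^bsub>A\<^esub> y) \<in> trel"
    if "x \<in> carrier A" "b \<in> carrier B" "y \<in> carrier A"
    using that unfolding ops(3,4) tensor_relations_def carrier_ring_bimod by (intro generate.incl) blast
qed

lemma tfree_add: "u \<in> carrier tfree \<Longrightarrow> v \<in> carrier tfree \<Longrightarrow> u + v \<in> carrier tfree"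
  using F.m_closed[of u v] by simp

lemma tpure_add_left:
  assumes "x \<in> carrier A" "x' \<in> carrier A" "y \<in> carrier A"
  shows "tpure (x \<oplus>\<^bsub>A\<^esub> x') y = tpure x y \<otimes>\<^bsub>tsquare\<^esub> tpure x' y"
proof -
  note fr = frag_of_tfree[OF assms(1,3)] frag_of_tfree[OF assms(2,3)]
  show ?thesis
    unfolding tpure_eq tensor_ops(2)[OF fr]
      trel_coset_eq_iff[OF frag_of_tfree[OF f.S.a_closed[OF assms(1,2)] assms(3)] tfree_add[OF fr]]
    using trel_generators(1)[OF assms] by (simp add: diff_diff_eq)
qed

lemma tpure_add_right:
  assumes "x \<in> carrier A" "y \<in> carrier A" "y' \<in> carrier A"
  shows "tpure x (y \<oplus>\<^bsub>A\<^esub> y') = tpure x y \<otimes>\<^bsub>tsquare\<^esub> tpure x y'"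
proof -
  note fr = frag_of_tfree[OF assms(1,2)] frag_of_tfree[OF assms(1,3)]
  show ?thesis
    unfolding tpure_eq tensor_ops(2)[OF fr]
      trel_coset_eq_iff[OF frag_of_tfree[OF assms(1) f.S.a_closed[OF assms(2,3)]] tfree_add[OF fr]]
    using trel_generators(2)[OF assms] by (simp add: diff_diff_eq)
qed

lemma tpure_balanced:
  assumes "x \<in> carrier A" "b \<in> carrier B" "y \<in> carrier A"
  shows "tpure (x \<otimes>\<^bsub>A\<^esub> f b) y = tpure x (f b \<otimes>\<^bsub>A\<^esub> y)"
  unfolding tpure_eq using assms trel_generators(3)[OF assms]
  by (subst trel_coset_eq_iff) simp_all

lemma tpure_lact: "s \<in> carrier A \<Longrightarrow> x \<in> carrier A \<Longrightarrow> y \<in> carrier A \<Longrightarrow>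
    lact tsquare s (tpure x y) = tpure (s \<otimes>\<^bsub>A\<^esub> x) y"
  and tpure_ract: "s \<in> carrier A \<Longrightarrow> x \<in> carrier A \<Longrightarrow> y \<in> carrier A \<Longrightarrow>
    ract tsquare (tpure x y) s = tpure x (y \<otimes>\<^bsub>A\<^esub> s)"
  unfolding tpure_eq by (simp_all add: tensor_ops(3,4)) (simp_all add: ring_bimod_def)

lemma tpure_zero:
  assumes "y \<in> carrier A"
  shows "tpure \<zero>\<^bsub>A\<^esub> y = \<one>\<^bsub>tsquare\<^esub>" "tpure y \<zero>\<^bsub>A\<^esub> = \<one>\<^bsub>tsquare\<^esub>"
  using tpure_add_left[of "\<zero>\<^bsub>A\<^esub>" "\<zero>\<^bsub>A\<^esub>" y] tpure_add_right[of y "\<zero>\<^bsub>A\<^esub>" "\<zero>\<^bsub>A\<^esub>"] assms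
  by (simp_all add: tsquare.M.l_cancel_one')

lemma lact_hom: "s \<in> carrier A \<Longrightarrow> lact tsquare s \<in> hom tsquare tsquare"
  and ract_hom: "s \<in> carrier A \<Longrightarrow> (\<lambda>x. ract tsquare x s) \<in> hom tsquare tsquare"
  by (auto simp: hom_def tsquare.lact_closed tsquare.ract_closed tsquare.lact_add tsquare.ract_add)

lemma tensor_mult_coset_diff:
  assumes "u \<in> carrier tfree" "v \<in> carrier tfree"
  shows "tensor_mult A (trel #>\<^bsub>tfree\<^esub> (u - v)) =
    tensor_mult A (trel #>\<^bsub>tfree\<^esub> u) \<ominus>\<^bsub>A\<^esub> tensor_mult A (trel #>\<^bsub>tfree\<^esub> v)"
    and "tensor_mult A (trel #>\<^bsub>tfree\<^esub> u) \<in> carrier A"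
proof -
  have hom: "tensor_mult A \<in> hom tsquare (ring_bimod id A id)"
    using tensor_mult(1)[OF f] by (simp add: bimod_hom_def left_linear_def)
  have mult: "tensor_mult A (x \<otimes>\<^bsub>tsquare\<^esub> y) = tensor_mult A x \<oplus>\<^bsub>A\<^esub> tensor_mult A y"
    if "x \<in> carrier tsquare" "y \<in> carrier tsquare" for x y
    using hom that by (simp add: hom_def ring_bimod_def)
  have closed: "tensor_mult A (trel #>\<^bsub>tfree\<^esub> w) \<in> carrier A" if "w \<in> carrier tfree" for w
    using hom tcoset_closed[OF that] by (auto simp: hom_def ring_bimod_def)
  have "(trel #>\<^bsub>tfree\<^esub> (u - v)) \<otimes>\<^bsub>tsquare\<^esub> (trel #>\<^bsub>tfree\<^esub> v) = trel #>\<^bsub>tfree\<^esub> u"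
    using tensor_ops(2)[OF tfree_diff[OF assms] assms(2)] by simp
  then have "tensor_mult A (trel #>\<^bsub>tfree\<^esub> (u - v)) \<oplus>\<^bsub>A\<^esub> tensor_mult A (trel #>\<^bsub>tfree\<^esub> v) =
      tensor_mult A (trel #>\<^bsub>tfree\<^esub> u)"
    using mult[OF tcoset_closed[OF tfree_diff[OF assms]] tcoset_closed[OF assms(2)]] by argo
  then show "tensor_mult A (trel #>\<^bsub>tfree\<^esub> (u - v)) =
      tensor_mult A (trel #>\<^bsub>tfree\<^esub> u) \<ominus>\<^bsub>A\<^esub> tensor_mult A (trel #>\<^bsub>tfree\<^esub> v)"
    using closed[OF assms(1)] closed[OF assms(2)] closed[OF tfree_diff[OF assms]]
    by (metis a_minus_def f.S.add.inv_solve_right)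
  show "tensor_mult A (trel #>\<^bsub>tfree\<^esub> u) \<in> carrier A"
    by (rule closed[OF assms(1)])
qed

end

text \<open>The additive extension of \<open>w\<close> from the generators to the free abelian group, with values in a ring.\<close>

definition frag_sum :: "('k \<Rightarrow> 'b :: ring_1) \<Rightarrow> ('k \<Rightarrow>\<^sub>0 int) \<Rightarrow> 'b" where
  "frag_sum w u = (\<Sum>p\<in>Poly_Mapping.keys u. of_int (Poly_Mapping.lookup u p) * w p)"

lemma frag_sum_superset:
  "finite I \<Longrightarrow> Poly_Mapping.keys u \<subseteq> I \<Longrightarrow> frag_sum w u = (\<Sum>p\<in>I. of_int (Poly_Mapping.lookup u p) * w p)"
  unfolding frag_sum_def by (intro sum.mono_neutral_left) (auto simp: in_keys_iff)

lemma frag_sum_0 [simp]: "frag_sum w 0 = 0"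
  by (simp add: frag_sum_def)

lemma frag_sum_of [simp]: "frag_sum w (frag_of p) = w p"
  by (simp add: frag_sum_def)

lemma frag_sum_diff: "frag_sum w (u - v) = frag_sum w u - frag_sum w v"
proof -
  let ?I = "Poly_Mapping.keys u \<union> Poly_Mapping.keys v"
  have "frag_sum w (u - v) = (\<Sum>p\<in>?I. of_int (Poly_Mapping.lookup (u - v) p) * w p)"
    by (rule frag_sum_superset) (use keys_diff[of u v] in auto)
  also have "\<dots> = frag_sum w u - frag_sum w v"
    by (simp add: frag_sum_superset[of ?I] lookup_minus left_diff_distrib sum_subtractf)
  finally show ?thesis .
qed


section \<open>The Frobenius property of the centralizer\<close>

context
  fixes n :: nat and c :: "'a :: field mat"
  assumes c [simp]: "c \<in> carrier_mat n n"
begin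

abbreviation (input) "\<A> \<equiv> centralizer_algebra n c"
abbreviation (input) "\<R> \<equiv> ring_of_type_algebra :: 'a ring"
abbreviation (input) "scalar_map \<equiv> \<lambda>r :: 'a. r \<odot>\<^bsub>\<A>\<^esub> \<one>\<^bsub>\<A>\<^esub>"
abbreviation (input) "dual \<equiv> right_hom_bimod \<R> (ring_bimod id \<A> scalar_map) (ring_bimod id \<R> id)"

lemma mem_A [simp]: "a \<in> carrier \<A> \<longleftrightarrow> a \<in> carrier_mat n n \<and> a * c = c * a"
  by (simp add: centralizer_algebra_def)

lemma A_ops [simp]:
  "x \<otimes>\<^bsub>\<A>\<^esub> y = x * y" "x \<oplus>\<^bsub>\<A>\<^esub> y = x + y" "\<one>\<^bsub>\<A>\<^esub> = 1\<^sub>m n" "\<zero>\<^bsub>\<A>\<^esub> = 0\<^sub>m n n" "r \<odot>\<^bsub>\<A>\<^esub> x = r \<cdot>\<^sub>m x"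
  by (simp_all add: centralizer_algebra_def)

lemma R_ops [simp]:
  "carrier \<R> = UNIV" "r \<otimes>\<^bsub>\<R>\<^esub> s = r * s" "r \<oplus>\<^bsub>\<R>\<^esub> s = r + s" "\<one>\<^bsub>\<R>\<^esub> = 1" "\<zero>\<^bsub>\<R>\<^esub> = 0"
  by (simp_all add: ring_of_type_algebra_def)

lemma scalar_mult:
  assumes "a \<in> carrier_mat n n"
  shows "((r :: 'a) \<cdot>\<^sub>m 1\<^sub>m n) * a = r \<cdot>\<^sub>m a" "a * (r \<cdot>\<^sub>m 1\<^sub>m n) = r \<cdot>\<^sub>m a"
  using assms square_mult_simps(4)[of "1\<^sub>m n" n a r] square_mult_simps(5)[of a n "1\<^sub>m n" r] by simp_all

lemma A_mult_closed: "a \<in> carrier \<A> \<Longrightarrow> b \<in> carrier \<A> \<Longrightarrow> a * b \<in> carrier \<A>"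
  using square_mult_left_commute[of c n a b]
  by (auto simp: square_mult_simps[where n = n])

lemma mem_dual: "\<phi> \<in> carrier dual \<longleftrightarrow> \<phi> \<in> extensional (carrier \<A>) \<and>
    (\<forall>a\<in>carrier \<A>. \<forall>b\<in>carrier \<A>. \<phi> (a + b) = \<phi> a + \<phi> b) \<and>
    (\<forall>r. \<forall>a\<in>carrier \<A>. \<phi> (r \<cdot>\<^sub>m a) = r * \<phi> a)"
  by (auto simp: right_hom_bimod_def right_linear_def hom_def ring_bimod_def scalar_mult mult.commute)

text \<open>An isomorphism \<open>h\<close> onto the dual is determined by \<open>\<phi> = h 1\<close> through \<open>h a = (m \<mapsto> \<phi> (a m))\<close>, and its
  injectivity is nondegeneracy of \<open>\<phi>\<close>.  Extended to all matrices, \<open>\<phi>\<close> becomes a trace form.\<close>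

lemma nondegenerate_trace_form:
  assumes frob: "frobenius_algebra \<R> \<A>"
  obtains g where "g \<in> carrier_mat n n"
    "\<And>a. a \<in> carrier_mat n n \<Longrightarrow> a * c = c * a \<Longrightarrow>
      (\<And>m. m \<in> carrier_mat n n \<Longrightarrow> m * c = c * m \<Longrightarrow> mat_trace (a * (m * g)) = 0) \<Longrightarrow> a = 0\<^sub>m n n"
proof -
  obtain h where h: "h \<in> bimod_hom \<R> \<A> (ring_bimod scalar_map \<A> id) dual"
    and bij: "bij_betw h (carrier \<A>) (carrier dual)"
    using frob unfolding frobenius_algebra_def frobenius_extension_def bimod_isomorphic_def
    by (auto simp: ring_bimod_def)
  define \<phi> where "\<phi> = h (1\<^sub>m n)"
  have one: "1\<^sub>m n \<in> carrier \<A>" and zero: "0\<^sub>m n n \<in> carrier \<A>"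
    by simp_all
  have "\<phi> \<in> carrier dual"
    unfolding \<phi>_def using bij_betwE[OF bij] one by blast
  then have add: "\<phi> (a + b) = \<phi> a + \<phi> b" and smult: "\<phi> (r \<cdot>\<^sub>m a) = r * \<phi> a"
    if "a \<in> carrier \<A>" "b \<in> carrier \<A>" for a b r
    using that unfolding mem_dual by blast+
  note smult = smult[OF _ one]
  have act: "h (a * b) = (\<lambda>m\<in>carrier \<A>. h a (b * m))" if "a \<in> carrier \<A>" "b \<in> carrier \<A>" for a b
    using h that unfolding bimod_hom_def right_linear_def
    by (auto simp: ring_bimod_def right_hom_bimod_def)
  have h_eq: "h a = (\<lambda>m\<in>carrier \<A>. \<phi> (a * m))" if "a \<in> carrier \<A>" for a
    using act[OF one that] that by (simp add: \<phi>_def)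
  obtain P where P: "\<And>V. V \<in> carrier_mat n n \<Longrightarrow> P V \<in> carrier \<A>" "\<And>V. V \<in> carrier \<A> \<Longrightarrow> P V = V"
    "\<And>V W. V \<in> carrier_mat n n \<Longrightarrow> W \<in> carrier_mat n n \<Longrightarrow> P (V + W) = P V + P W"
    "\<And>r V. V \<in> carrier_mat n n \<Longrightarrow> P (r \<cdot>\<^sub>m V) = r \<cdot>\<^sub>m P V"
    by (rule exists_matrix_projection[of "carrier \<A>" n])
      (auto simp: square_mult_simps[where n = n])
  obtain g where g: "g \<in> carrier_mat n n" "\<And>V. V \<in> carrier_mat n n \<Longrightarrow> \<phi> (P V) = mat_trace (V * g)"
    by (rule linear_eq_mat_trace[of n "\<lambda>V. \<phi> (P V)"])
      (use P(1,3,4) add smult in \<open>auto simp del: mem_A\<close>)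
  have \<phi>: "\<phi> V = mat_trace (V * g)" if "V \<in> carrier \<A>" for V
    using g(2)[of V] P(2)[OF that] that by simp
  show ?thesis
  proof (rule that[OF g(1)])
    fix a assume a: "a \<in> carrier_mat n n" "a * c = c * a"
      and 0: "\<And>m. m \<in> carrier_mat n n \<Longrightarrow> m * c = c * m \<Longrightarrow> mat_trace (a * (m * g)) = 0"
    have aA: "a \<in> carrier \<A>"
      using a by simp
    have "\<phi> (a * m) = 0" if m: "m \<in> carrier \<A>" for m
      using \<phi>[OF A_mult_closed[OF aA m]] 0[of m] m a g(1) by (simp add: square_mult_simps(1)[where n = n])
    moreover have "\<phi> (0\<^sub>m n n * m) = 0" if m: "m \<in> carrier \<A>" for m
      using \<phi>[of "0\<^sub>m n n"] m g(1) by simp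
    ultimately have "h a = h (0\<^sub>m n n)"
      unfolding h_eq[OF aA] h_eq[OF zero] by (intro restrict_ext) simp
    then show "a = 0\<^sub>m n n"
      using bij aA zero by (metis bij_betw_def inj_onD)
  qed
qed

context
  fixes q :: "'a poly" and g :: "'a mat"
  assumes q: "poly_mat q c = 0\<^sub>m n n" and g [simp]: "g \<in> carrier_mat n n"
    and one: "poly_diff q c g = 1\<^sub>m n"
begin

abbreviation (input) "\<E> \<equiv> poly_diff q c"

lemma E_mem: "h \<in> carrier_mat n n \<Longrightarrow> \<E> h \<in> carrier \<A>"
  by (simp add: poly_diff_carrier[OF c] poly_diff_central[OF c _ q])

lemma E_left: "a \<in> carrier \<A> \<Longrightarrow> \<E> (a * g) = a" and E_right: "a \<in> carrier \<A> \<Longrightarrow> \<E> (g * a) = a"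
  by (simp_all add: poly_diff_commute_left[OF c] poly_diff_commute_right[OF c] one)

text \<open>The entries of a matrix, numbered row by row, embed the centralizer into a free module, and
  \<open>x \<mapsto> E(x g)\<close> splits this embedding because \<open>E(m g) = m E(g) = m\<close> on the centralizer.\<close>

lemma fg_projective_centralizer: "fg_projective_right \<R> (ring_bimod id \<A> scalar_map)"
proof -
  define \<iota> where "\<iota> m = (\<lambda>i\<in>{..<n * n}. m $$ (i div n, i mod n))" for m :: "'a mat"
  define \<pi> where "\<pi> u = \<E> (mat n n (\<lambda>(i, j). u (i * n + j)) * g)" for u :: "nat \<Rightarrow> 'a"
  have bound: "i div n < n" "i mod n < n" if "i < n * n" for i
    using that by (auto simp: less_mult_imp_div_less) (metis mod_less_divisor mult_0_right not_gr_zero not_less0)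
  have idx: "i * n + j < n * n" if "i < n" "j < n" for i j
  proof -
    have "i * n + j < Suc i * n"
      using that by simp
    also have "\<dots> \<le> n * n"
      using that by (intro mult_le_mono1) simp
    finally show ?thesis .
  qed
  have "\<iota> \<in> right_linear \<R> (ring_bimod id \<A> scalar_map) (free_bimod \<R> (n * n))"
    unfolding right_linear_def hom_def
    by (auto simp: \<iota>_def ring_bimod_def free_bimod_def scalar_mult bound mult.commute
        intro!: restrict_ext)
  moreover have "\<pi> \<in> right_linear \<R> (free_bimod \<R> (n * n)) (ring_bimod id \<A> scalar_map)"
    unfolding right_linear_def hom_def
  proof (intro CollectI conjI ballI Pi_I)
    show "\<pi> u \<in> carrier (ring_bimod id \<A> scalar_map)" for u
      unfolding \<pi>_def by (simp add: ring_bimod_def E_mem[simplified] square_mult_simps(7)[where n = n])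
    show "\<pi> (u \<otimes>\<^bsub>free_bimod \<R> (n * n)\<^esub> v) = \<pi> u \<otimes>\<^bsub>ring_bimod id \<A> scalar_map\<^esub> \<pi> v" for u v
    proof -
      have "mat n n (\<lambda>(i, j). (u \<otimes>\<^bsub>free_bimod \<R> (n * n)\<^esub> v) (i * n + j)) =
          mat n n (\<lambda>(i, j). u (i * n + j)) + mat n n (\<lambda>(i, j). v (i * n + j))"
        by (rule eq_matI) (auto simp: free_bimod_def idx)
      then show ?thesis
        unfolding \<pi>_def by (simp add: square_mult_simps[where n = n] poly_diff_add[OF c] ring_bimod_def)
    qed
    show "\<pi> (ract (free_bimod \<R> (n * n)) u r) = ract (ring_bimod id \<A> scalar_map) (\<pi> u) r" for u r
    proof -
      have "mat n n (\<lambda>(i, j). ract (free_bimod \<R> (n * n)) u r (i * n + j)) =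
          r \<cdot>\<^sub>m mat n n (\<lambda>(i, j). u (i * n + j))"
        by (rule eq_matI) (auto simp: free_bimod_def idx)
      then show ?thesis
        unfolding \<pi>_def by (simp add: square_mult_simps[where n = n] poly_diff_smult[OF c] ring_bimod_def
            scalar_mult poly_diff_carrier[OF c])
    qed
  qed
  moreover have "\<pi> (\<iota> m) = m" if m: "m \<in> carrier (ring_bimod id \<A> scalar_map)" for m
  proof -
    have m': "m \<in> carrier \<A>"
      using m by (simp add: ring_bimod_def)
    have "mat n n (\<lambda>(i, j). \<iota> m (i * n + j)) = m"
      using m' by (intro eq_matI) (auto simp: \<iota>_def idx)
    then show ?thesis
      unfolding \<pi>_def using E_left[OF m'] by simp
  qed
  ultimately show ?thesis
    unfolding fg_projective_right_def by blast
qed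

text \<open>Both parts of bijectivity are explicit.  For \<open>a\<close> in the centralizer, \<open>tr(a k) = tr(a E(k) g)\<close> for all matrices
  \<open>k\<close>, so the form determines \<open>a\<close>.  The functional \<open>m \<mapsto> tr(k m)\<close> is represented by \<open>E(k)\<close>, since
  \<open>tr(E(k) m g) = tr(k E(m g)) = tr(k m)\<close>.\<close>

lemma frobenius_algebra_centralizer: "frobenius_algebra \<R> \<A>"
proof -
  define h where "h a = (\<lambda>m\<in>carrier \<A>. mat_trace (a * m * g))" for a
  note carr [simp] = square_mult_simps(7)[where n = n]
  have tr: "mat_trace (\<E> k * (m * g)) = mat_trace (k * m)" if "k \<in> carrier_mat n n" "m \<in> carrier \<A>" for k m
    using that by (simp add: mat_trace_poly_diff[OF c] E_left[simplified])
  have tr': "mat_trace (a * k) = mat_trace (a * \<E> k * g)" if "a \<in> carrier \<A>" "k \<in> carrier_mat n n" for a k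
  proof -
    have "mat_trace (a * k) = mat_trace (\<E> (g * a) * k)"
      using E_right[OF that(1)] by simp
    also have "\<dots> = mat_trace (g * (a * \<E> k))"
      using that by (simp add: mat_trace_poly_diff[OF c] poly_diff_commute_left[OF c]
          square_mult_simps(1)[where n = n])
    also have "\<dots> = mat_trace (a * \<E> k * g)"
      using that by (intro mat_trace_comm[where n = n]) (simp_all add: poly_diff_carrier[OF c])
    finally show ?thesis .
  qed
  have dual: "h a \<in> carrier dual" if "a \<in> carrier \<A>" for a
    unfolding mem_dual h_def using that
    by (auto simp: square_mult_simps[where n = n] mat_trace_add[where n = n] mat_trace_smult[where n = n])
  have h_add: "h (a + b) = h a \<otimes>\<^bsub>dual\<^esub> h b" if "a \<in> carrier \<A>" "b \<in> carrier \<A>" for a b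
    using that unfolding h_def right_hom_bimod_def
    by (auto simp: ring_bimod_def square_mult_simps[where n = n] mat_trace_add[where n = n] intro!: restrict_ext)
  have h_left: "h (scalar_map r * a) = lact dual r (h a)" if "a \<in> carrier \<A>" for a r
    using that unfolding h_def right_hom_bimod_def
    by (auto simp: ring_bimod_def square_mult_simps[where n = n] mat_trace_smult[where n = n] scalar_mult
        intro!: restrict_ext)
  have h_right: "h (a * b) = ract dual (h a) b" if "a \<in> carrier \<A>" "b \<in> carrier \<A>" for a b
    using that A_mult_closed[of b] unfolding h_def right_hom_bimod_def
    by (auto simp: ring_bimod_def square_mult_simps(1)[where n = n] intro!: restrict_ext)
  have "h \<in> bimod_hom \<R> \<A> (ring_bimod scalar_map \<A> id) dual"
    unfolding bimod_hom_def left_linear_def right_linear_def hom_def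
    using dual h_add h_left h_right by (auto simp: ring_bimod_def simp del: A_ops(5))
  moreover have "bij_betw h (carrier \<A>) (carrier dual)"
    unfolding bij_betw_def
  proof (intro conjI inj_onI equalityI subsetI)
    fix a b assume ab: "a \<in> carrier \<A>" "b \<in> carrier \<A>" and eq: "h a = h b"
    have "mat_trace (a * k) = mat_trace (b * k)" if k: "k \<in> carrier_mat n n" for k
      unfolding tr'[OF ab(1) k] tr'[OF ab(2) k]
      using fun_cong[OF eq, of "\<E> k"] E_mem[OF k] by (simp add: h_def)
    from this[OF unit_mat_carrier] have "a $$ (i, j) = b $$ (i, j)" if "i < n" "j < n" for i j
      using mat_trace_unit_mat[of a n j i] mat_trace_unit_mat[of b n j i] ab that by simp
    then show "a = b"
      using ab by (intro eq_matI) auto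
  next
    fix \<phi> assume \<phi>: "\<phi> \<in> carrier dual"
    \<comment> \<open>Composing \<open>\<phi>\<close> with the projection \<open>V \<mapsto> E(V g)\<close> extends it to all matrices.\<close>
    have "\<exists>k\<in>carrier_mat n n. \<forall>V\<in>carrier_mat n n. \<phi> (\<E> (V * g)) = mat_trace (V * k)"
    proof (rule linear_eq_mat_trace[of n "\<lambda>V. \<phi> (\<E> (V * g))"])
      fix V W :: "'a mat" and r assume V: "V \<in> carrier_mat n n" and W: "W \<in> carrier_mat n n"
      show "\<phi> (\<E> ((V + W) * g)) = \<phi> (\<E> (V * g)) + \<phi> (\<E> (W * g))"
        using \<phi> E_mem[of "V * g"] E_mem[of "W * g"] V W unfolding mem_dual
        by (simp add: square_mult_simps[where n = n] poly_diff_add[OF c])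
    next
      fix V :: "'a mat" and r assume V: "V \<in> carrier_mat n n"
      show "\<phi> (\<E> (r \<cdot>\<^sub>m V * g)) = r * \<phi> (\<E> (V * g))"
        using \<phi> E_mem[of "V * g"] V unfolding mem_dual
        by (simp add: square_mult_simps[where n = n] poly_diff_smult[OF c])
    qed blast
    then obtain k where k: "k \<in> carrier_mat n n"
      "\<And>V. V \<in> carrier_mat n n \<Longrightarrow> \<phi> (\<E> (V * g)) = mat_trace (V * k)"
      by blast
    have ext: "\<phi> \<in> extensional (carrier \<A>)"
      using \<phi> unfolding mem_dual by blast
    have "h (\<E> k) = \<phi>"
    proof (rule extensionalityI[of _ "carrier \<A>"])
      fix m assume m: "m \<in> carrier \<A>"
      have "h (\<E> k) m = mat_trace (k * m)"
        using tr[OF k(1) m] m k(1) by (simp add: h_def square_mult_simps(1)[where n = n] poly_diff_carrier[OF c])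
      also have "\<dots> = mat_trace (m * k)"
        using k(1) m by (intro mat_trace_comm[where n = n]) auto
      also have "\<dots> = \<phi> m"
        using k(2)[of m] E_left[OF m] m by simp
      finally show "h (\<E> k) m = \<phi> m" .
    qed (use ext in \<open>simp_all add: h_def\<close>)
    then show "\<phi> \<in> h ` carrier \<A>"
      using E_mem[OF k(1)] by blast
  qed (use dual in auto)
  ultimately show ?thesis
    unfolding frobenius_algebra_def frobenius_extension_def bimod_isomorphic_def
    using fg_projective_centralizer ring_hom_ring_centralizer_algebra[OF c]
    by (auto simp: ring_bimod_def)
qed

end

section \<open>Separability of the centralizer\<close>

lemma centralizer_minus:
  assumes "a \<in> carrier \<A>" "b \<in> carrier \<A>"
  shows "a \<ominus>\<^bsub>\<A>\<^esub> b = a - b"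
proof -
  interpret f: ring_hom_ring \<R> \<A> scalar_map
    by (rule ring_hom_ring_centralizer_algebra[OF c])
  have cancel: "(x + b) - b = x" if "x \<in> carrier_mat n n" for x
    using that assms(2) by (intro eq_matI) auto
  have d: "a \<ominus>\<^bsub>\<A>\<^esub> b \<in> carrier \<A>"
    by (rule f.S.minus_closed[OF assms])
  have "(a \<ominus>\<^bsub>\<A>\<^esub> b) \<oplus>\<^bsub>\<A>\<^esub> b = a"
    unfolding a_minus_def f.S.a_assoc[OF assms(1) f.S.a_inv_closed[OF assms(2)] assms(2)]
      f.S.l_neg[OF assms(2)] by (rule f.S.r_zero[OF assms(1)])
  then have "(a \<ominus>\<^bsub>\<A>\<^esub> b) + b = a"
    by (simp only: A_ops(2))
  then show ?thesis
    using cancel[of "a \<ominus>\<^bsub>\<A>\<^esub> b"] d[unfolded mem_A] by argo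
qed

lemma finprod_centralizer:
  assumes "comm_group (ring_bimod id \<A> id)" "finite I" "\<And>i. i \<in> I \<Longrightarrow> F i \<in> carrier \<A>"
  shows "finprod (ring_bimod id \<A> id) F I = sum_mat n F I"
proof -
  interpret G: comm_group "ring_bimod id \<A> id" by fact
  show ?thesis
    using assms(2,3)
  proof (induction I)
    case empty
    show ?case
      unfolding G.finprod_empty by (simp add: ring_bimod_def)
  next
    case (insert x I)
    then have "F \<in> I \<rightarrow> carrier (ring_bimod id \<A> id)" "F x \<in> carrier (ring_bimod id \<A> id)"
      by (auto simp: ring_bimod_def)
    then show ?case
      using insert by (subst G.finprod_insert) (auto simp: ring_bimod_def sum_mat_insert)
  qed
qed

text \<open>The tensors \<open>D U V = E(U) \<otimes> E(Y V)\<close> are additive in both arguments and balanced over the base field.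
  Hence the sum of the \<open>D u(k, l) u(l, k)\<close> commutes with the centralizer for the reason that
  \<open>\<Sum> u(k, l) \<otimes> u(l, k)\<close> commutes with all matrices.\<close>

lemma separable_extension_centralizer:
  assumes q: "poly_mat q c = 0\<^sub>m n n" and Y [simp]: "Y \<in> carrier_mat n n"
    and one: "poly_diff q c (contraction n q c Y) = 1\<^sub>m n"
  shows "separable_extension \<R> \<A> scalar_map"
proof -
  note hom = ring_hom_ring_centralizer_algebra[OF c]
  interpret f: ring_hom_ring \<R> \<A> scalar_map by (rule hom)
  define T where "T = tensor_square \<R> \<A> scalar_map"
  define pt where "pt = pure_tensor \<R> (ring_bimod id \<A> scalar_map) (ring_bimod scalar_map \<A> id)"
  interpret T: bimodule \<A> \<A> T
    unfolding T_def by (rule tsquare_bimodule[OF hom])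
  note [simp] = square_mult_simps(7)[where n = n] poly_diff_carrier[OF c]
  have pt_closed: "pt x y \<in> carrier T"
    and pt_lact: "s \<in> carrier \<A> \<Longrightarrow> lact T s (pt x y) = pt (s * x) y"
    and pt_ract: "s \<in> carrier \<A> \<Longrightarrow> ract T (pt x y) s = pt x (y * s)"
    and pt_mult: "tensor_mult \<A> (pt x y) = x * y"
    if "x \<in> carrier \<A>" "y \<in> carrier \<A>" for x y s
    using tpure_closed[OF hom that] tpure_lact[OF hom _ that, of s] tpure_ract[OF hom _ that, of s]
      tensor_mult(2)[OF hom that]
    unfolding T_def pt_def A_ops(1) by blast+
  have pt_add: "pt (x + x') y = pt x y \<otimes>\<^bsub>T\<^esub> pt x' y" "pt y (x + x') = pt y x \<otimes>\<^bsub>T\<^esub> pt y x'"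
    if "x \<in> carrier \<A>" "x' \<in> carrier \<A>" "y \<in> carrier \<A>" for x x' y
    using tpure_add_left[OF hom that] tpure_add_right[OF hom that(3,1,2)]
    unfolding T_def pt_def A_ops(2) by blast+
  have pt_zero: "pt (0\<^sub>m n n) y = \<one>\<^bsub>T\<^esub>" "pt y (0\<^sub>m n n) = \<one>\<^bsub>T\<^esub>" if "y \<in> carrier \<A>" for y
    using tpure_zero[OF hom that] unfolding T_def pt_def A_ops(4) by blast+
  have pt_smult: "pt (r \<cdot>\<^sub>m x) y = pt x (r \<cdot>\<^sub>m y)" if "x \<in> carrier \<A>" "y \<in> carrier \<A>" for r x y
  proof -
    have "x \<otimes>\<^bsub>\<A>\<^esub> scalar_map r = r \<cdot>\<^sub>m x" "scalar_map r \<otimes>\<^bsub>\<A>\<^esub> y = r \<cdot>\<^sub>m y"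
      using that scalar_mult[of x r] scalar_mult[of y r] by auto
    then show ?thesis
      using tpure_balanced[OF hom that(1) _ that(2), of r] unfolding pt_def by simp
  qed
  let ?E = "poly_diff q c"
  have E: "?E U \<in> carrier \<A>" if "U \<in> carrier_mat n n" for U
    using that by (simp add: poly_diff_central[OF c _ q])
  define D where "D U V = pt (?E U) (?E (Y * V))" for U V
  have D_closed: "D U V \<in> carrier T" if "U \<in> carrier_mat n n" "V \<in> carrier_mat n n" for U V
    unfolding D_def using that by (intro pt_closed E) simp_all
  have D_sum: "D (sum_mat n F I) V = finprod T (\<lambda>i. D (F i) V) I" (is ?left)
    "D V (sum_mat n F I) = finprod T (\<lambda>i. D V (F i)) I" (is ?right)
    if "finite I" "\<And>i. i \<in> I \<Longrightarrow> F i \<in> carrier_mat n n" "V \<in> carrier_mat n n" for F I V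
  proof -
    show ?left
      using that(1,2)
    proof (induction I)
      case empty
      then show ?case
        using pt_zero(1)[OF E, of "Y * V"] that(3) by (simp add: D_def poly_diff_zero[OF c])
    next
      case (insert x I)
      have "D (sum_mat n F (insert x I)) V = D (F x) V \<otimes>\<^bsub>T\<^esub> D (sum_mat n F I) V"
        using insert that(3) pt_add(1)[OF E E E, of "F x" "sum_mat n F I" "Y * V"]
        by (simp add: D_def sum_mat_insert poly_diff_add[OF c])
      then show ?case
        using insert that(3) by (subst T.M.finprod_insert) (auto intro!: D_closed)
    qed
    show ?right
      using that(1,2)
    proof (induction I)
      case empty
      then show ?case
        using pt_zero(2)[OF E, of V] that(3) by (simp add: D_def poly_diff_zero[OF c])
    next
      case (insert x I)
      have "D V (sum_mat n F (insert x I)) = D V (F x) \<otimes>\<^bsub>T\<^esub> D V (sum_mat n F I)"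
        using insert that(3) pt_add(2)[OF E E E, of "Y * F x" "Y * sum_mat n F I" V]
        by (simp add: D_def sum_mat_insert poly_diff_add[OF c] square_mult_simps(3)[where n = n])
      then show ?case
        using insert that(3) by (subst T.M.finprod_insert) (auto intro!: D_closed)
    qed
  qed
  have D_smult: "D (r \<cdot>\<^sub>m U) V = D U (r \<cdot>\<^sub>m V)" if "U \<in> carrier_mat n n" "V \<in> carrier_mat n n" for r U V
    using that pt_smult[OF E E, of U "Y * V" r]
    by (simp add: D_def poly_diff_smult[OF c] square_mult_simps(5)[where n = n])
  have D_lact: "lact T a (D U V) = D (a * U) V" and D_ract: "ract T (D U V) a = D U (V * a)"
    if "U \<in> carrier_mat n n" "V \<in> carrier_mat n n" "a \<in> carrier \<A>" for U V a
    using that pt_lact[OF E E that(3), of U "Y * V"] pt_ract[OF E E that(3), of U "Y * V"]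
      poly_diff_commute_right[OF c, of a "Y * V" q]
    by (simp_all add: D_def poly_diff_commute_left[OF c] square_mult_simps(1)[where n = n])
  let ?u = "unit_mat n :: nat \<Rightarrow> nat \<Rightarrow> 'a mat"
  define e where "e l = finprod T (\<lambda>k. D (?u k l) (?u l k)) {..<n}" for l
  define e' where "e' = finprod T e {..<n}"
  have e: "e l \<in> carrier T" for l
    unfolding e_def by (auto intro!: T.M.finprod_closed D_closed)
  then have e': "e' \<in> carrier T"
    unfolding e'_def by (auto intro!: T.M.finprod_closed)
  note grp = T.M.comm_group_axioms
  have lact_hom: "lact T a \<in> hom T T" and ract_hom: "(\<lambda>x. ract T x a) \<in> hom T T" if "a \<in> carrier \<A>" for a
    using that lact_hom[OF hom] ract_hom[OF hom] unfolding T_def by blast+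
  \<comment> \<open>For fixed \<open>l\<close>, both sides are the sum over \<open>i\<close> and \<open>k\<close> of \<open>D u(i, l) (a(i, k) u(l, k))\<close>.\<close>
  have central: "lact T a (e l) = ract T (e l) a" if a: "a \<in> carrier \<A>" and l: "l < n" for a l
  proof -
    have "lact T a (e l) = finprod T (\<lambda>k. lact T a (D (?u k l) (?u l k))) {..<n}"
      unfolding e_def by (rule finprod_hom[OF grp grp lact_hom[OF a]]) (auto intro!: D_closed)
    also have "\<dots> = finprod T (\<lambda>k. finprod T (\<lambda>i. D (?u i l) (a $$ (i, k) \<cdot>\<^sub>m ?u l k)) {..<n}) {..<n}"
    proof (intro T.M.finprod_cong')
      fix k assume k: "k \<in> {..<n}"
      have "lact T a (D (?u k l) (?u l k)) = D (sum_mat n (\<lambda>i. a $$ (i, k) \<cdot>\<^sub>m ?u i l) {..<n}) (?u l k)"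
        using a k l D_lact[OF unit_mat_carrier unit_mat_carrier a] mult_unit_mat(1)[of a n k l] by simp
      then show "lact T a (D (?u k l) (?u l k)) = finprod T (\<lambda>i. D (?u i l) (a $$ (i, k) \<cdot>\<^sub>m ?u l k)) {..<n}"
        by (simp add: D_sum(1) D_smult)
    qed (auto intro!: T.M.finprod_closed D_closed)
    also have "\<dots> = finprod T (\<lambda>i. finprod T (\<lambda>k. D (?u i l) (a $$ (i, k) \<cdot>\<^sub>m ?u l k)) {..<n}) {..<n}"
      by (rule T.M.finprod_swap) (auto intro!: D_closed)
    also have "\<dots> = finprod T (\<lambda>i. ract T (D (?u i l) (?u l i)) a) {..<n}"
    proof (intro T.M.finprod_cong')
      fix i assume i: "i \<in> {..<n}"
      have "ract T (D (?u i l) (?u l i)) a = D (?u i l) (sum_mat n (\<lambda>k. a $$ (i, k) \<cdot>\<^sub>m ?u l k) {..<n})"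
        using a i l D_ract[OF unit_mat_carrier unit_mat_carrier a] mult_unit_mat(2)[of a n l i] by simp
      then show "finprod T (\<lambda>k. D (?u i l) (a $$ (i, k) \<cdot>\<^sub>m ?u l k)) {..<n} = ract T (D (?u i l) (?u l i)) a"
        by (simp add: D_sum(2))
    qed (use a in \<open>auto intro!: T.ract_closed D_closed\<close>)
    also have "\<dots> = ract T (e l) a"
      unfolding e_def by (rule finprod_hom[OF grp grp ract_hom[OF a], symmetric]) (auto intro!: D_closed)
    finally show ?thesis .
  qed
  have central': "lact T a e' = ract T e' a" if a: "a \<in> carrier \<A>" for a
  proof -
    have "lact T a e' = finprod T (\<lambda>l. lact T a (e l)) {..<n}"
      unfolding e'_def by (rule finprod_hom[OF grp grp lact_hom[OF a]]) (use e in auto)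
    also have "\<dots> = finprod T (\<lambda>l. ract T (e l) a) {..<n}"
      using central[OF a] by (intro T.M.finprod_cong') (use a e in \<open>auto intro!: T.ract_closed\<close>)
    also have "\<dots> = ract T e' a"
      unfolding e'_def by (rule finprod_hom[OF grp grp ract_hom[OF a], symmetric]) (use e in auto)
    finally show ?thesis .
  qed
  let ?G = "ring_bimod id \<A> id"
  have id: "ring_hom_ring \<A> \<A> id"
    using f.S.ring_axioms by (auto intro!: ring_hom_ring.intro ring_hom_ring_axioms.intro simp: ring_hom_def)
  interpret G: bimodule \<A> \<A> ?G
    by (rule bimodule_ring_bimod[OF id id])
  have tm: "tensor_mult \<A> \<in> hom T ?G"
    and tm_lact: "\<And>a x. a \<in> carrier \<A> \<Longrightarrow> x \<in> carrier T \<Longrightarrow> tensor_mult \<A> (lact T a x) = a * tensor_mult \<A> x"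
    using tensor_mult(1)[OF hom] unfolding T_def[symmetric]
    by (simp_all add: bimod_hom_def left_linear_def ring_bimod_def)
  have D_tm: "tensor_mult \<A> (D U V) = ?E (U * ?E (Y * V))"
    if "U \<in> carrier_mat n n" "V \<in> carrier_mat n n" for U V
    using that pt_mult[OF E E, of U "Y * V"] E[of "Y * V"]
    by (simp add: D_def poly_diff_commute_right[OF c])
  have tm_e: "tensor_mult \<A> (e l) = ?E (sum_mat n (\<lambda>k. ?u k l * ?E (Y * ?u l k)) {..<n})" for l
  proof -
    have mem: "tensor_mult \<A> (D (?u k l) (?u l k)) \<in> carrier \<A>" for k
      unfolding D_tm[OF unit_mat_carrier unit_mat_carrier] by (rule E) simp
    have "tensor_mult \<A> (e l) = finprod ?G (\<lambda>k. tensor_mult \<A> (D (?u k l) (?u l k))) {..<n}"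
      unfolding e_def by (rule finprod_hom[OF grp G.M.comm_group_axioms tm]) (auto intro!: D_closed)
    also have "\<dots> = sum_mat n (\<lambda>k. tensor_mult \<A> (D (?u k l) (?u l k))) {..<n}"
      by (rule finprod_centralizer[OF G.M.comm_group_axioms finite_lessThan mem])
    also have "\<dots> = sum_mat n (\<lambda>k. ?E (?u k l * ?E (Y * ?u l k))) {..<n}"
      by (intro sum_mat_cong D_tm) simp_all
    also have "\<dots> = ?E (sum_mat n (\<lambda>k. ?u k l * ?E (Y * ?u l k)) {..<n})"
      by (rule poly_diff_sum_mat[OF c, symmetric]) simp_all
    finally show ?thesis .
  qed
  have tm_e': "tensor_mult \<A> e' = 1\<^sub>m n"
  proof -
    have "tensor_mult \<A> e' = finprod ?G (\<lambda>l. tensor_mult \<A> (e l)) {..<n}"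
      unfolding e'_def by (rule finprod_hom[OF grp G.M.comm_group_axioms tm]) (use e in auto)
    also have "\<dots> = sum_mat n (\<lambda>l. tensor_mult \<A> (e l)) {..<n}"
      by (rule finprod_centralizer[OF G.M.comm_group_axioms finite_lessThan])
        (simp only: tm_e E sum_mat_carrier)
    also have "\<dots> = ?E (sum_mat n (\<lambda>l. sum_mat n (\<lambda>k. ?u k l * ?E (Y * ?u l k)) {..<n}) {..<n})"
      unfolding tm_e by (rule poly_diff_sum_mat[OF c, symmetric]) simp_all
    also have "\<dots> = 1\<^sub>m n"
      unfolding sum_mat_pairs by (rule one[unfolded contraction_def])
    finally show ?thesis .
  qed
  define \<sigma> where "\<sigma> a = lact T a e'" for a
  have \<sigma>: "\<sigma> a \<in> carrier T" "\<sigma> (a + b) = \<sigma> a \<otimes>\<^bsub>T\<^esub> \<sigma> b"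
    "\<sigma> (a * b) = lact T a (\<sigma> b)" "\<sigma> (a * b) = ract T (\<sigma> a) b"
    if ab: "a \<in> carrier \<A>" "b \<in> carrier \<A>" for a b
  proof -
    show "\<sigma> a \<in> carrier T" "\<sigma> (a + b) = \<sigma> a \<otimes>\<^bsub>T\<^esub> \<sigma> b" "\<sigma> (a * b) = lact T a (\<sigma> b)"
      unfolding \<sigma>_def
      using T.lact_closed[OF ab(1) e'] T.add_lact[OF ab e'] T.mult_lact[OF ab e'] by simp_all
    then show "\<sigma> (a * b) = ract T (\<sigma> a) b"
      unfolding \<sigma>_def by (simp only: central'[OF ab(2)] T.lact_ract[OF ab(1,2) e'])
  qed
  have \<sigma>_mid: "lact T a (\<sigma> b) = ract T (\<sigma> a) b" if "a \<in> carrier \<A>" "b \<in> carrier \<A>" for a b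
    using \<sigma>(3)[OF that] \<sigma>(4)[OF that] by (rule trans[OF sym])
  have "\<sigma> \<in> bimod_hom \<A> \<A> ?G T"
    unfolding bimod_hom_def left_linear_def right_linear_def hom_def
    by (intro IntI CollectI conjI ballI Pi_I)
      (simp_all only: ring_bimod_def partial_object.simps monoid.simps bimod.simps
        A_ops(1,2) id_apply \<sigma>(1-3) \<sigma>_mid)
  moreover have "tensor_mult \<A> (\<sigma> a) = a" if "a \<in> carrier \<A>" for a
    unfolding \<sigma>_def using tm_lact[OF that e'] tm_e' that by simp
  ultimately show ?thesis
    unfolding separable_extension_def T_def using hom by blast
qed

text \<open>For a fixed matrix \<open>h\<close>, the map \<open>x \<otimes> y \<mapsto> x h y\<close> respects the relations of the tensor square.  It is
  defined here on representatives, with values in matrices over the extension field, and evaluated at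
  the image of \<open>1\<close> under the splitting of the multiplication map.\<close>

lemma separable_extension_average:
  fixes hom :: "'a \<Rightarrow> 'b :: field"
  assumes "field_hom hom" and sep: "separable_extension \<R> \<A> scalar_map"
  obtains \<Phi> where "\<And>h. h \<in> carrier_mat n n \<Longrightarrow> \<Phi> h \<in> carrier_mat n n"
    "\<And>h. h \<in> carrier_mat n n \<Longrightarrow> \<Phi> h * map_mat hom c = map_mat hom c * \<Phi> h"
    "\<And>p h. h \<in> carrier_mat n n \<Longrightarrow> \<Phi> (poly_mat p (map_mat hom c) * h * poly_mat p (map_mat hom c)) =
      poly_mat p (map_mat hom c) * \<Phi> h * poly_mat p (map_mat hom c)"
    "\<And>p. \<Phi> (poly_mat p (map_mat hom c)) = poly_mat p (map_mat hom c)"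
proof -
  interpret field_hom hom by fact
  note rhom = ring_hom_ring_centralizer_algebra[OF c]
  interpret f: ring_hom_ring \<R> \<A> scalar_map by (rule rhom)
  let ?C = "map_mat hom c"
  have C [simp]: "?C \<in> carrier_mat n n"
    by simp
  let ?T = "tensor_square \<R> \<A> scalar_map"
  let ?F = "free_Abelian_group (carrier \<A> \<times> carrier \<A>)"
  let ?M = "ring_bimod id \<A> scalar_map" and ?N = "ring_bimod scalar_map \<A> id"
  let ?K = "tensor_relations \<R> ?M ?N"
  obtain \<sigma> where \<sigma>: "\<sigma> \<in> bimod_hom \<A> \<A> (ring_bimod id \<A> id) ?T"
    and split: "\<And>a. a \<in> carrier \<A> \<Longrightarrow> tensor_mult \<A> (\<sigma> a) = a"
    using sep unfolding separable_extension_def by blast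
  have one: "1\<^sub>m n \<in> carrier \<A>" and cA: "c \<in> carrier \<A>"
    by simp_all
  have \<sigma>_mem: "\<sigma> a \<in> carrier ?T" and \<sigma>_l: "b \<in> carrier \<A> \<Longrightarrow> \<sigma> (b * a) = lact ?T b (\<sigma> a)"
    and \<sigma>_r: "b \<in> carrier \<A> \<Longrightarrow> \<sigma> (a * b) = ract ?T (\<sigma> a) b" if "a \<in> carrier \<A>" for a b
    using \<sigma> that A_ops(1)
    by (auto simp del: mem_A A_ops simp: bimod_hom_def left_linear_def right_linear_def hom_def ring_bimod_def)
  obtain u where u: "u \<in> carrier ?F" and eu: "\<sigma> (1\<^sub>m n) = ?K #>\<^bsub>?F\<^esub> u"
    using tsquare_elem[OF rhom \<sigma>_mem[OF one]] by blast
  let ?lam = "frag_extend (\<lambda>(m, y). frag_of (lact ?M c m, y))"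
  let ?rho = "frag_extend (\<lambda>(m, y). frag_of (m, ract ?N y c))"
  have "lact ?T c (\<sigma> (1\<^sub>m n)) = ract ?T (\<sigma> (1\<^sub>m n)) c"
    using \<sigma>_l[OF one cA] \<sigma>_r[OF one cA] by simp
  then have cos: "?K #>\<^bsub>?F\<^esub> ?lam u = ?K #>\<^bsub>?F\<^esub> ?rho u"
    unfolding eu tensor_ops(3)[OF rhom cA u] tensor_ops(4)[OF rhom cA u] .
  \<comment> \<open>The additive extension of \<open>x \<otimes> y \<mapsto> x h y\<close>, taken entry by entry.\<close>
  define \<Psi> where "\<Psi> h w = mat n n (\<lambda>(i, j).
      frag_sum (\<lambda>(x, y). (map_mat hom x * h * map_mat hom y) $$ (i, j)) w)" for h :: "'b mat" and w
  have \<Psi>_carrier [simp]: "\<Psi> h w \<in> carrier_mat n n" for h w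
    by (simp add: \<Psi>_def)
  have \<Psi>_0 [simp]: "\<Psi> h 0 = 0\<^sub>m n n" for h
    by (rule eq_matI) (auto simp: \<Psi>_def)
  have \<Psi>_diff: "\<Psi> h (v - w) = \<Psi> h v - \<Psi> h w" for h v w
    by (rule eq_matI) (auto simp: \<Psi>_def frag_sum_diff)
  have \<Psi>_of: "\<Psi> h (frag_of (x, y)) = map_mat hom x * h * map_mat hom y"
    if "x \<in> carrier \<A>" "y \<in> carrier \<A>" "h \<in> carrier_mat n n" for x y h
    using that by (auto simp: \<Psi>_def)
  have F_ind: "P w" if "w \<in> carrier ?F" "P 0"
    "\<And>x y. x \<in> carrier \<A> \<Longrightarrow> y \<in> carrier \<A> \<Longrightarrow> P (frag_of (x, y))"
    "\<And>v w. v \<in> carrier ?F \<Longrightarrow> w \<in> carrier ?F \<Longrightarrow> P v \<Longrightarrow> P w \<Longrightarrow> P (v - w)" for P w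
  proof -
    have "Poly_Mapping.keys w \<subseteq> carrier \<A> \<times> carrier \<A>"
      using that(1) by simp
    then have "w \<in> carrier ?F \<and> P w"
    proof (induction rule: frag_induction)
      case (diff v w)
      then show ?case
        using tfree_diff[OF rhom] that(4) by blast
    qed (use that(2,3) in auto)
    then show ?thesis ..
  qed
  note [simp] = square_mult_simps(7)[where n = n] poly_mat_carrier[OF C]
  have mult_hom: "map_mat hom (x * y) = map_mat hom x * map_mat hom y"
    if "x \<in> carrier_mat n n" "y \<in> carrier_mat n n" for x y
    using that by (rule mat_hom_mult)
  have \<Psi>_K: "\<Psi> h w = 0\<^sub>m n n" if w: "w \<in> ?K" and h: "h \<in> carrier_mat n n" for h w
    using bimodule_left[OF rhom] bimodule_right[OF rhom] w
  proof (induction rule: tensor_relations_induct)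
    case (diff v w)
    then show ?case by (simp add: \<Psi>_diff)
  next
    case (left x x' y)
    then have xy: "x \<in> carrier \<A>" "x' \<in> carrier \<A>" "y \<in> carrier \<A>"
      by (simp_all only: carrier_ring_bimod[OF rhom])
    have "x \<otimes>\<^bsub>?M\<^esub> x' = x + x'"
      by (simp add: ring_bimod_def)
    then show ?case
      using \<Psi>_of[OF f.S.a_closed[OF xy(1,2)] xy(3) h] \<Psi>_of[OF xy(1,3) h] \<Psi>_of[OF xy(2,3) h] xy h
      by (auto simp: \<Psi>_diff map_mat_add[where n = n] square_mult_simps(2)[where n = n] intro!: eq_matI)
  next
    case (right x y y')
    then have xy: "x \<in> carrier \<A>" "y \<in> carrier \<A>" "y' \<in> carrier \<A>"
      by (simp_all only: carrier_ring_bimod[OF rhom])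
    have "y \<otimes>\<^bsub>?N\<^esub> y' = y + y'"
      by (simp add: ring_bimod_def)
    then show ?case
      using \<Psi>_of[OF xy(1) f.S.a_closed[OF xy(2,3)] h] \<Psi>_of[OF xy(1,2) h] \<Psi>_of[OF xy(1,3) h] xy h
      by (auto simp: \<Psi>_diff map_mat_add[where n = n] square_mult_simps(3)[where n = n] intro!: eq_matI)
  next
    case (mid x r y)
    then have xy: "x \<in> carrier \<A>" "y \<in> carrier \<A>"
      by (simp_all only: carrier_ring_bimod[OF rhom])
    have "ract ?M x r = r \<cdot>\<^sub>m x" "lact ?N r y = r \<cdot>\<^sub>m y"
      using xy scalar_mult[of x r] scalar_mult[of y r] by (auto simp: ring_bimod_def)
    moreover have "r \<cdot>\<^sub>m x \<in> carrier \<A>" "r \<cdot>\<^sub>m y \<in> carrier \<A>"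
      using xy by (auto simp: square_mult_simps(4,5)[where n = n])
    ultimately show ?case
      using \<Psi>_of[of "r \<cdot>\<^sub>m x" y h] \<Psi>_of[of x "r \<cdot>\<^sub>m y" h] xy h
      by (simp add: \<Psi>_diff map_mat_smult square_mult_simps(4,5)[where n = n])
  qed simp
  have lam: "?lam w \<in> carrier ?F \<and> \<Psi> h (?lam w) = ?C * \<Psi> h w"
    if w: "w \<in> carrier ?F" and h: "h \<in> carrier_mat n n" for h w
    using w
  proof (rule F_ind)
    fix x y assume xy: "x \<in> carrier \<A>" "y \<in> carrier \<A>"
    have cx: "lact ?M c x = c * x" "c * x \<in> carrier \<A>"
      using A_mult_closed[OF cA xy(1)] by (simp_all add: ring_bimod_def)
    show "?lam (frag_of (x, y)) \<in> carrier ?F \<and> \<Psi> h (?lam (frag_of (x, y))) = ?C * \<Psi> h (frag_of (x, y))"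
      using \<Psi>_of[OF cx(2) xy(2) h] \<Psi>_of[OF xy h] cx xy h
      by (simp add: mult_hom square_mult_simps(1)[where n = n])
  next
    fix v w assume vw: "v \<in> carrier ?F" "w \<in> carrier ?F"
      "?lam v \<in> carrier ?F \<and> \<Psi> h (?lam v) = ?C * \<Psi> h v"
      "?lam w \<in> carrier ?F \<and> \<Psi> h (?lam w) = ?C * \<Psi> h w"
    show "?lam (v - w) \<in> carrier ?F \<and> \<Psi> h (?lam (v - w)) = ?C * \<Psi> h (v - w)"
      unfolding frag_extend_diff \<Psi>_diff
      using vw tfree_diff[OF rhom] by (auto simp del: carrier_free_Abelian_group_iff simp: square_minus_simps[where n = n])
  qed simp
  have rho: "?rho w \<in> carrier ?F \<and> \<Psi> h (?rho w) = \<Psi> h w * ?C"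
    if w: "w \<in> carrier ?F" and h: "h \<in> carrier_mat n n" for h w
    using w
  proof (rule F_ind)
    fix x y assume xy: "x \<in> carrier \<A>" "y \<in> carrier \<A>"
    have cy: "ract ?N y c = y * c" "y * c \<in> carrier \<A>"
      using A_mult_closed[OF xy(2) cA] by (simp_all add: ring_bimod_def)
    have yc: "map_mat hom y * ?C = ?C * map_mat hom y"
      using xy(2) mult_hom[of y c] mult_hom[of c y] by simp
    show "?rho (frag_of (x, y)) \<in> carrier ?F \<and> \<Psi> h (?rho (frag_of (x, y))) = \<Psi> h (frag_of (x, y)) * ?C"
      using \<Psi>_of[OF xy(1) cy(2) h] \<Psi>_of[OF xy h] cy xy h
      by (simp add: mult_hom yc square_mult_simps(1)[where n = n])
  next
    fix v w assume vw: "v \<in> carrier ?F" "w \<in> carrier ?F"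
      "?rho v \<in> carrier ?F \<and> \<Psi> h (?rho v) = \<Psi> h v * ?C"
      "?rho w \<in> carrier ?F \<and> \<Psi> h (?rho w) = \<Psi> h w * ?C"
    show "?rho (v - w) \<in> carrier ?F \<and> \<Psi> h (?rho (v - w)) = \<Psi> h (v - w) * ?C"
      unfolding frag_extend_diff \<Psi>_diff
      using vw tfree_diff[OF rhom] by (auto simp del: carrier_free_Abelian_group_iff simp: square_minus_simps[where n = n])
  qed simp
  have comm_z: "map_mat hom x * poly_mat p ?C = poly_mat p ?C * map_mat hom x" if "x \<in> carrier \<A>" for x p
  proof -
    have x: "x \<in> carrier_mat n n" "x * c = c * x"
      using that by simp_all
    have "map_mat hom x * ?C = ?C * map_mat hom x"
      using arg_cong[OF x(2), of "map_mat hom"] x(1) by (simp add: mult_hom)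
    then show ?thesis
      using x(1) by (intro commute_poly_mat[OF C]) simp_all
  qed
  have bilin: "\<Psi> (poly_mat p ?C * h * poly_mat p ?C) w = poly_mat p ?C * \<Psi> h w * poly_mat p ?C"
    if w: "w \<in> carrier ?F" and h: "h \<in> carrier_mat n n" for h w p
    using w
  proof (rule F_ind)
    fix x y assume xy: "x \<in> carrier \<A>" "y \<in> carrier \<A>"
    let ?z = "poly_mat p ?C" and ?x = "map_mat hom x" and ?y = "map_mat hom y"
    have [simp]: "x \<in> carrier_mat n n" "y \<in> carrier_mat n n"
      using xy by simp_all
    have "?x * (?z * h * ?z) * ?y = (?x * ?z) * h * (?z * ?y)"
      using h by (simp add: square_mult_simps(1)[where n = n])
    also have "\<dots> = ?z * (?x * h * ?y) * ?z"
      unfolding comm_z[OF xy(1)] comm_z[OF xy(2), symmetric] using h by (simp add: square_mult_simps(1)[where n = n])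
    finally show "\<Psi> (?z * h * ?z) (frag_of (x, y)) = ?z * \<Psi> h (frag_of (x, y)) * ?z"
      using \<Psi>_of[OF xy, of "?z * h * ?z"] \<Psi>_of[OF xy h] h by simp
  next
    fix v w assume vw: "\<Psi> (poly_mat p ?C * h * poly_mat p ?C) v = poly_mat p ?C * \<Psi> h v * poly_mat p ?C"
      "\<Psi> (poly_mat p ?C * h * poly_mat p ?C) w = poly_mat p ?C * \<Psi> h w * poly_mat p ?C"
    show "\<Psi> (poly_mat p ?C * h * poly_mat p ?C) (v - w) = poly_mat p ?C * \<Psi> h (v - w) * poly_mat p ?C"
      unfolding \<Psi>_diff vw
      by (simp add: square_minus_simps[where n = n])
  qed simp
  have fixes_z: "\<Psi> (poly_mat p ?C) w = poly_mat p ?C * map_mat hom (tensor_mult \<A> (?K #>\<^bsub>?F\<^esub> w))"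
    if w: "w \<in> carrier ?F" for w p
    using w
  proof (rule F_ind)
    have z: "0 \<in> carrier ?F"
      by simp
    note coset0 = tensor_mult_coset_diff[OF rhom z z, unfolded diff_zero]
    have "tensor_mult \<A> (?K #>\<^bsub>?F\<^esub> 0) = 0\<^sub>m n n"
      by (rule trans[OF coset0(1)]) (simp only: a_minus_def f.S.r_neg[OF coset0(2)] A_ops(4))
    then show "\<Psi> (poly_mat p ?C) 0 = poly_mat p ?C * map_mat hom (tensor_mult \<A> (?K #>\<^bsub>?F\<^esub> 0))"
      by simp
  next
    fix x y assume xy: "x \<in> carrier \<A>" "y \<in> carrier \<A>"
    have "tensor_mult \<A> (?K #>\<^bsub>?F\<^esub> frag_of (x, y)) = x * y"
      using tensor_mult(2)[OF rhom xy] unfolding tpure_eq[OF rhom] by simp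
    then show "\<Psi> (poly_mat p ?C) (frag_of (x, y)) =
        poly_mat p ?C * map_mat hom (tensor_mult \<A> (?K #>\<^bsub>?F\<^esub> frag_of (x, y)))"
      using \<Psi>_of[OF xy, of "poly_mat p ?C"] comm_z[OF xy(1), of p] xy
      by (simp add: mult_hom square_mult_simps(1)[where n = n])
  next
    fix v w assume vw: "v \<in> carrier ?F" "w \<in> carrier ?F"
      "\<Psi> (poly_mat p ?C) v = poly_mat p ?C * map_mat hom (tensor_mult \<A> (?K #>\<^bsub>?F\<^esub> v))"
      "\<Psi> (poly_mat p ?C) w = poly_mat p ?C * map_mat hom (tensor_mult \<A> (?K #>\<^bsub>?F\<^esub> w))"
    let ?a = "tensor_mult \<A> (?K #>\<^bsub>?F\<^esub> v)" and ?b = "tensor_mult \<A> (?K #>\<^bsub>?F\<^esub> w)"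
    have ab: "?a \<in> carrier \<A>" "?b \<in> carrier \<A>"
      using tensor_mult_coset_diff(2)[OF rhom vw(1) vw(1)] tensor_mult_coset_diff(2)[OF rhom vw(2) vw(2)] .
    have eq: "?a \<ominus>\<^bsub>\<A>\<^esub> ?b = ?a - ?b"
      by (rule centralizer_minus[OF ab])
    have map_diff: "map_mat hom (?a - ?b) = map_mat hom ?a - map_mat hom ?b"
      using ab by (auto intro!: eq_matI simp: hom_distribs)
    show "\<Psi> (poly_mat p ?C) (v - w) = poly_mat p ?C * map_mat hom (tensor_mult \<A> (?K #>\<^bsub>?F\<^esub> (v - w)))"
      unfolding \<Psi>_diff vw(3,4) tensor_mult_coset_diff(1)[OF rhom vw(1,2)] eq map_diff
      using ab by (simp add: square_minus_simps[where n = n])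
  qed
  show ?thesis
  proof (rule that[of "\<lambda>h. \<Psi> h u"])
    fix h :: "'b mat" assume h: "h \<in> carrier_mat n n"
    have "?lam u - ?rho u \<in> ?K"
      using cos trel_coset_eq_iff[OF rhom, of "?lam u" "?rho u"] lam[OF u h] rho[OF u h] by blast
    from \<Psi>_K[OF this h] have "?C * \<Psi> h u - \<Psi> h u * ?C = 0\<^sub>m n n"
      unfolding \<Psi>_diff conjunct2[OF lam[OF u h]] conjunct2[OF rho[OF u h]] .
    then show "\<Psi> h u * ?C = ?C * \<Psi> h u"
      by (rule square_diff_eq_zero[symmetric, rotated 2]) simp_all
    show "\<Psi> (poly_mat p ?C * h * poly_mat p ?C) u = poly_mat p ?C * \<Psi> h u * poly_mat p ?C" for p
      by (rule bilin[OF u h])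
  next
    show "\<Psi> (poly_mat p ?C) u = poly_mat p ?C" for p
      using fixes_z[OF u, of p] split[OF one] unfolding eu by (simp add: mat_hom_one)
  qed simp
qed

end

theorem corollary1p2:
  fixes c :: "'a :: field mat"
    and n_as :: "(nat \<times> 'a alg_closure) list"
  assumes "c \<in> carrier_mat n n"
    and "jordan_nf (map_mat to_ac c) n_as"
  shows "(frobenius_algebra ring_of_type_algebra (centralizer_algebra n c) \<longleftrightarrow>
            (\<forall>i<length n_as. \<forall>j<length n_as.
               snd (n_as ! i) = snd (n_as ! j) \<longrightarrow> fst (n_as ! i) = fst (n_as ! j)))
       \<and> (separable_frobenius_algebra ring_of_type_algebra (centralizer_algebra n c) \<longleftrightarrow>
            (\<forall>i<length n_as. fst (n_as ! i) = 1))"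
proof -
  let ?A = "centralizer_algebra n c"
  let ?frob = "frobenius_algebra ring_of_type_algebra ?A"
  let ?sep = "separable_extension ring_of_type_algebra ?A (\<lambda>r. r \<odot>\<^bsub>?A\<^esub> \<one>\<^bsub>?A\<^esub>)"
  have hom: "field_hom (to_ac :: 'a \<Rightarrow> 'a alg_closure)"
    by unfold_locales simp_all
  note base = hom assms
  have equal: "(\<forall>i<length n_as. \<forall>j<length n_as.
      snd (n_as ! i) = snd (n_as ! j) \<longrightarrow> fst (n_as ! i) = fst (n_as ! j)) \<longleftrightarrow>
    (\<forall>k k' \<mu>. (k, \<mu>) \<in> set n_as \<longrightarrow> (k', \<mu>) \<in> set n_as \<longrightarrow> k = k')" (is "?eq_nth \<longleftrightarrow> ?eq_set")
  proof
    assume eq: ?eq_nth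
    show ?eq_set
    proof (intro allI impI)
      fix k k' \<mu> assume "(k, \<mu>) \<in> set n_as" "(k', \<mu>) \<in> set n_as"
      then obtain i j where ij: "i < length n_as" "n_as ! i = (k, \<mu>)" "j < length n_as" "n_as ! j = (k', \<mu>)"
        unfolding in_set_conv_nth by blast
      show "k = k'"
        using eq[rule_format, OF ij(1,3)] ij(2,4) by simp
    qed
  next
    assume eq: ?eq_set
    show ?eq_nth
    proof (intro allI impI)
      fix i j assume ij: "i < length n_as" "j < length n_as" "snd (n_as ! i) = snd (n_as ! j)"
      obtain k \<mu> where i: "n_as ! i = (k, \<mu>)"
        by (rule prod.exhaust)
      then obtain k' where j: "n_as ! j = (k', \<mu>)"
        using ij(3) by (metis prod.collapse snd_conv)
      show "fst (n_as ! i) = fst (n_as ! j)"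
        using eq nth_mem[OF ij(1)] nth_mem[OF ij(2)] unfolding i j by auto
    qed
  qed
  have ones: "(\<forall>i<length n_as. fst (n_as ! i) = 1) \<longleftrightarrow> (\<forall>k \<mu>. (k, \<mu>) \<in> set n_as \<longrightarrow> k = 1)"
    by (metis fst_conv in_set_conv_nth surjective_pairing)
  have witness: "\<exists>q g. poly_mat q c = 0\<^sub>m n n \<and> g \<in> carrier_mat n n \<and> poly_diff q c g = 1\<^sub>m n"
    if "\<And>k k' \<mu>. (k, \<mu>) \<in> set n_as \<Longrightarrow> (k', \<mu>) \<in> set n_as \<Longrightarrow> k = k'"
  proof -
    obtain q where q: "is_min_poly to_ac n c q"
      using exists_min_poly[OF base] by blast
    have "\<exists>g\<in>carrier_mat n n. poly_diff q c g = 1\<^sub>m n"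
      by (rule poly_diff_one_descends[OF base q]) (rule that)
    then show ?thesis
      using min_poly_annihilates[OF base q] by blast
  qed
  have frob_imp: "k = k'" if frob: "?frob" and k: "(k, \<mu>) \<in> set n_as" "(k', \<mu>) \<in> set n_as" for k k' \<mu>
  proof (rule nondegenerate_trace_form[OF assms(1) frob])
    fix g :: "'a mat" assume g: "g \<in> carrier_mat n n"
      and nondeg: "\<And>a. a \<in> carrier_mat n n \<Longrightarrow> a * c = c * a \<Longrightarrow>
        (\<And>m. m \<in> carrier_mat n n \<Longrightarrow> m * c = c * m \<Longrightarrow> mat_trace (a * (m * g)) = 0) \<Longrightarrow> a = 0\<^sub>m n n"
    show "k = k'"
    proof (rule nondegenerate_imp_equal_blocks[OF base g _ k])
      show "a = 0\<^sub>m n n" if "a \<in> carrier_mat n n" "a * c = c * a"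
        "\<And>m. m \<in> carrier_mat n n \<Longrightarrow> m * c = c * m \<Longrightarrow> mat_trace (a * (m * g)) = 0" for a
        using that by (rule nondeg)
    qed
  qed
  have frob: "?frob \<longleftrightarrow> (\<forall>k k' \<mu>. (k, \<mu>) \<in> set n_as \<longrightarrow> (k', \<mu>) \<in> set n_as \<longrightarrow> k = k')"
    using frob_imp witness frobenius_algebra_centralizer[OF assms(1)] by meson
  have sep: "k = 1" if frob: "?frob" and sep: "?sep" and k: "(k, \<mu>) \<in> set n_as" for k \<mu>
  proof -
    obtain q g where qg: "poly_mat q c = 0\<^sub>m n n" "g \<in> carrier_mat n n" "poly_diff q c g = 1\<^sub>m n"
      using witness frob_imp[OF frob] by blast
    show ?thesis
      by (rule separable_extension_average[OF assms(1) hom sep])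
        (rule separating_average_imp_diagonalizable[OF base qg _ _ _ _ k])
  qed
  have "?frob \<and> ?sep" if one: "\<And>k \<mu>. (k, \<mu>) \<in> set n_as \<Longrightarrow> k = 1"
  proof
    show ?frob
      unfolding frob using one by blast
    have "\<exists>q. poly_mat q c = 0\<^sub>m n n \<and>
      (\<exists>Y\<in>carrier_mat n n. poly_diff q c (contraction n q c Y) = 1\<^sub>m n)"
      by (rule exists_separating_matrix[OF base]) (rule one)
    then show ?sep
      using separable_extension_centralizer[OF assms(1)] by blast
  qed
  then have "?frob \<and> ?sep \<longleftrightarrow> (\<forall>k \<mu>. (k, \<mu>) \<in> set n_as \<longrightarrow> k = 1)"
    using sep by meson
  then show ?thesis
    unfolding equal ones using frob
    by (simp add: separable_frobenius_algebra_def separable_frobenius_extension_def frobenius_algebra_def)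
qed

end
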